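(* Let $c\in\{1,-1\}$, let $f\colon M^n\to\mathbb{Q}^n_c\times\mathbb{R}$ be a hypersurface with constant principal curvatures, and let $g$ be the number of distinct principal curvatures. Suppose that one of the following holds: $g=1$ and $n\ge 2$; $g=2$ and $n\ge 2$; or $g=3$, $n\ge 4$ and the multiplicities of the principal curvatures are constant. Then the function $\nu$ is constant and $f$ is isoparametric in $\mathbb{Q}^n_c\times\mathbb{R}$.
   Context: $\mathbb{Q}^n_c$ denotes the unit sphere $\mathbb{S}^n$ if $c=1$ and the hyperbolic space $\mathbb{H}^n$ (curvature $-1$) if $c=-1$. A hypersurface $f\colon M^n\to\mathbb{Q}^n_c\times\mathbb{R}$ is an isometric immersion of a (connected) Riemannian $n$-manifold with unit normal field $\eta$ and shape operator $A$; principal curvatures are the eigenvalues of $A$. With $\partial/\partial t$ the unit vector field tangent to the factor $\mathbb{R}$, the tangent vector field $T$ on $M^n$ and the smooth function $\nu$ are defined by $\partial/\partial t=df(T)+\nu\eta$. The hypersurfaces parallel to $f$ are $f_t(p)=\exp_{f(p)}(t\,\eta(p))$, where $\exp$ is the exponential map of $\mathbb{Q}^n_c\times\mathbb{R}$. The hypersurface $f$ is isoparametric if its parallel hypersurfaces $f_t$ (for $t$ near $0$, locally on $M^n$, where $f_t$ is an immersion) all have constant mean curvature, $f_0=f$ included. *)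

theory Defs
  imports "HOL-Analysis.Analysis"
begin

section \<open>Smooth maps and smooth manifolds\<close>

primrec Ck_on :: "nat \<Rightarrow> 'a::euclidean_space set \<Rightarrow> ('a \<Rightarrow> 'b::real_normed_vector) \<Rightarrow> bool" where
  "Ck_on 0 S h \<longleftrightarrow> continuous_on S h"
| "Ck_on (Suc k) S h \<longleftrightarrow>
     (\<forall>x\<in>S. h differentiable (at x)) \<and>
     (\<forall>v. Ck_on k S (\<lambda>x. frechet_derivative h (at x) v))"

text \<open>Only used for open \<open>S\<close>.\<close>

definition smooth_on :: "'a::euclidean_space set \<Rightarrow> ('a \<Rightarrow> 'b::real_normed_vector) \<Rightarrow> bool" where
  "smooth_on S h \<longleftrightarrow> (\<forall>k. Ck_on k S h)"

text \<open>An atlas is given by local parametrizations \<open>(D, y)\<close>, where \<open>y\<close> maps the open set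
  \<open>D\<close> of Euclidean \<open>n\<close>-space, \<open>n = CARD('n)\<close>, homeomorphically onto an open subset of \<open>M\<close>.
  The values of \<open>y\<close> outside \<open>D\<close> are irrelevant.\<close>

type_synonym ('n, 'm) atlas = "((real ^ 'n) set \<times> (real ^ 'n \<Rightarrow> 'm)) set"

definition smooth_manifold :: "'m topology \<Rightarrow> ('n::finite, 'm) atlas \<Rightarrow> bool" where
  "smooth_manifold M \<A> \<longleftrightarrow>
     Hausdorff_space M \<and> second_countable M \<and>
     (\<forall>(D, y)\<in>\<A>. open D \<and> openin M (y ` D) \<and>
        homeomorphic_map (top_of_set D) (subtopology M (y ` D)) y) \<and>
     (\<Union>(D, y)\<in>\<A>. y ` D) = topspace M \<and>
     (\<forall>(D, y)\<in>\<A>. \<forall>(E, z)\<in>\<A>. smooth_on {u\<in>D. y u \<in> z ` E} (\<lambda>u. inv_into E z (y u)))"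

definition smooth_map_on ::
  "('n::finite, 'm) atlas \<Rightarrow> 'm set \<Rightarrow> ('m \<Rightarrow> 'b::real_normed_vector) \<Rightarrow> bool" where
  "smooth_map_on \<A> W h \<longleftrightarrow> (\<forall>(D, y)\<in>\<A>. smooth_on {u\<in>D. y u \<in> W} (h \<circ> y))"

text \<open>The tangent space of \<open>M\<close> at \<open>p\<close> is identified with \<open>real ^ 'n\<close> by means of one local
  parametrization around \<open>p\<close>, chosen once for all for each \<open>p\<close>. Another choice changes the
  endomorphisms of the tangent space below only by a conjugation.\<close>

definition param_at :: "('n::finite, 'm) atlas \<Rightarrow> 'm \<Rightarrow> (real ^ 'n) set \<times> (real ^ 'n \<Rightarrow> 'm)" where
  "param_at \<A> p = (SOME P. P \<in> \<A> \<and> p \<in> snd P ` fst P)"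

definition differential ::
  "('n::finite, 'm) atlas \<Rightarrow> ('m \<Rightarrow> 'b::real_normed_vector) \<Rightarrow> 'm \<Rightarrow> real ^ 'n \<Rightarrow> 'b" where
  "differential \<A> h p =
     (let (D, y) = param_at \<A> p in frechet_derivative (h \<circ> y) (at (inv_into D y p)))"


section \<open>The ambient space\<close>

text \<open>For \<open>c = 1\<close> the unit sphere in Euclidean space, for \<open>c = -1\<close> the hyperboloid model of
  hyperbolic space in Lorentz space, times the real line. A point is \<open>((x, s), t)\<close> with
  \<open>(x, s)\<close> in the sphere or the hyperboloid.\<close>

type_synonym 'n ambient = "((real ^ 'n) \<times> real) \<times> real"

definition bil :: "real \<Rightarrow> 'n::finite ambient \<Rightarrow> 'n ambient \<Rightarrow> real" where
  "bil c v w = fst (fst v) \<bullet> fst (fst w) + c * (snd (fst v) * snd (fst w)) + snd v * snd w"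

definition QxR :: "real \<Rightarrow> 'n::finite ambient set" where
  "QxR c = {((x, s), t) |x s t. x \<bullet> x + c * s\<^sup>2 = c \<and> (c = -1 \<longrightarrow> s > 0)}"

definition tangent_space :: "real \<Rightarrow> 'n::finite ambient \<Rightarrow> 'n ambient set" where
  "tangent_space c z = {v. bil c (fst z, 0) v = 0}"

text \<open>The normal line at \<open>z\<close> in the flat space is spanned by \<open>(fst z, 0)\<close>, whose square is
  \<open>c = 1 / c\<close>; the following is the orthogonal projection onto the tangent space.\<close>

definition tan_proj :: "real \<Rightarrow> 'n::finite ambient \<Rightarrow> 'n ambient \<Rightarrow> 'n ambient" where
  "tan_proj c z v = v - (c * bil c (fst z, 0) v) *\<^sub>R (fst z, 0)"

definition d_dt :: "'n::finite ambient" where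
  "d_dt = (0, 1)"

text \<open>The Levi-Civita connection of the ambient space is the tangential part of the flat
  derivative; a geodesic is a curve whose acceleration has zero tangential part.\<close>

definition is_geodesic ::
  "real \<Rightarrow> (real \<Rightarrow> 'n::finite ambient) \<Rightarrow> (real \<Rightarrow> 'n ambient) \<Rightarrow> bool" where
  "is_geodesic c \<gamma> \<gamma>' \<longleftrightarrow>
     (\<forall>s. \<gamma> s \<in> QxR c) \<and>
     (\<forall>s. (\<gamma> has_vector_derivative \<gamma>' s) (at s)) \<and>
     (\<forall>s. \<exists>a. (\<gamma>' has_vector_derivative a) (at s) \<and> tan_proj c (\<gamma> s) a = 0)"

definition exp_map :: "real \<Rightarrow> 'n::finite ambient \<Rightarrow> 'n ambient \<Rightarrow> 'n ambient" where
  "exp_map c z v = (THE w. \<exists>\<gamma> \<gamma>'. is_geodesic c \<gamma> \<gamma>' \<and> \<gamma> 0 = z \<and> \<gamma>' 0 = v \<and> \<gamma> 1 = w)"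


section \<open>Hypersurfaces\<close>

text \<open>\<open>W\<close> is an open subset of the manifold. It carries the metric induced by \<open>f\<close>, so that
  \<open>f\<close> is isometric.\<close>

definition hypersurface_on ::
  "('n::finite, 'm) atlas \<Rightarrow> real \<Rightarrow> 'm set \<Rightarrow> ('m \<Rightarrow> 'n ambient) \<Rightarrow> ('m \<Rightarrow> 'n ambient) \<Rightarrow> bool" where
  "hypersurface_on \<A> c W f \<eta> \<longleftrightarrow>
     f ` W \<subseteq> QxR c \<and> smooth_map_on \<A> W f \<and> (\<forall>p\<in>W. inj (differential \<A> f p)) \<and>
     smooth_map_on \<A> W \<eta> \<and>
     (\<forall>p\<in>W. \<eta> p \<in> tangent_space c (f p) \<and> bil c (\<eta> p) (\<eta> p) = 1 \<and>
        (\<forall>X. bil c (differential \<A> f p X) (\<eta> p) = 0))"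

definition shape_operator ::
  "('n::finite, 'm) atlas \<Rightarrow> real \<Rightarrow> ('m \<Rightarrow> 'n ambient) \<Rightarrow> ('m \<Rightarrow> 'n ambient) \<Rightarrow>
     'm \<Rightarrow> real ^ 'n \<Rightarrow> real ^ 'n" where
  "shape_operator \<A> c f \<eta> p X =
     (THE Y. differential \<A> f p Y = - tan_proj c (f p) (differential \<A> \<eta> p X))"

definition principal_curvatures ::
  "('n::finite, 'm) atlas \<Rightarrow> real \<Rightarrow> ('m \<Rightarrow> 'n ambient) \<Rightarrow> ('m \<Rightarrow> 'n ambient) \<Rightarrow> 'm \<Rightarrow> real set" where
  "principal_curvatures \<A> c f \<eta> p = {l. \<exists>X. X \<noteq> 0 \<and> shape_operator \<A> c f \<eta> p X = l *\<^sub>R X}"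

definition curvature_multiplicity ::
  "('n::finite, 'm) atlas \<Rightarrow> real \<Rightarrow> ('m \<Rightarrow> 'n ambient) \<Rightarrow> ('m \<Rightarrow> 'n ambient) \<Rightarrow>
     real \<Rightarrow> 'm \<Rightarrow> nat" where
  "curvature_multiplicity \<A> c f \<eta> l p = dim {X. shape_operator \<A> c f \<eta> p X = l *\<^sub>R X}"

definition mean_curvature ::
  "('n::finite, 'm) atlas \<Rightarrow> real \<Rightarrow> ('m \<Rightarrow> 'n ambient) \<Rightarrow> ('m \<Rightarrow> 'n ambient) \<Rightarrow> 'm \<Rightarrow> real" where
  "mean_curvature \<A> c f \<eta> p = trace (matrix (shape_operator \<A> c f \<eta> p)) / real CARD('n)"

text \<open>The function \<open>\<nu>\<close> in \<open>d_dt = df T + \<nu> \<eta>\<close>.\<close>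

definition angle_function ::
  "('n::finite, 'm) atlas \<Rightarrow> ('m \<Rightarrow> 'n ambient) \<Rightarrow> ('m \<Rightarrow> 'n ambient) \<Rightarrow> 'm \<Rightarrow> real" where
  "angle_function \<A> f \<eta> p = (THE a. \<exists>T. d_dt = differential \<A> f p T + a *\<^sub>R \<eta> p)"

definition parallel_map ::
  "real \<Rightarrow> ('m \<Rightarrow> 'n::finite ambient) \<Rightarrow> ('m \<Rightarrow> 'n ambient) \<Rightarrow> real \<Rightarrow> 'm \<Rightarrow> 'n ambient" where
  "parallel_map c f \<eta> t p = exp_map c (f p) (t *\<^sub>R \<eta> p)"

text \<open>Since \<open>W\<close> is connected, the unit normal field \<open>\<xi>\<close> of the parallel hypersurface is unique
  up to a global sign, which does not affect constancy of the mean curvature. The case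
  \<open>t = 0\<close> is the hypersurface \<open>f\<close> itself.\<close>

definition isoparametric ::
  "'m topology \<Rightarrow> ('n::finite, 'm) atlas \<Rightarrow> real \<Rightarrow> ('m \<Rightarrow> 'n ambient) \<Rightarrow> ('m \<Rightarrow> 'n ambient) \<Rightarrow> bool" where
  "isoparametric M \<A> c f \<eta> \<longleftrightarrow>
     (\<forall>p\<in>topspace M. \<exists>W \<epsilon>. openin M W \<and> connectedin M W \<and> p \<in> W \<and> \<epsilon> > 0 \<and>
        (\<forall>t. \<bar>t\<bar> < \<epsilon> \<longrightarrow>
           (\<exists>\<xi>. hypersurface_on \<A> c W (parallel_map c f \<eta> t) \<xi> \<and>
                mean_curvature \<A> c (parallel_map c f \<eta> t) \<xi> constant_on W)))"

end

theory Submission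
  imports Defs
begin

text \<open>Let \<open>h\<close> be the height function and \<open>T\<close> its gradient on the hypersurface, so that
  \<open>\<nabla>\<^sub>X T = \<nu> A X\<close>, \<open>d\<nu> = - \<langle>A T, -\<rangle>\<close> and \<open>\<bar>T\<bar>\<^sup>2 = 1 - \<nu>\<^sup>2\<close>. Three numbers contain all principal
  curvatures, and it suffices to confine \<open>\<nu>\<^sup>2\<close> to a finite set depending only on them, since \<open>\<nu>\<close> is
  continuous.

  Near a point with \<open>\<nu> \<noteq> 0\<close> an eigenspace of dimension at least two is orthogonal to \<open>T\<close> by the
  Codazzi equation. If such an eigenspace (for \<open>\<gamma>\<close>) exists, then \<open>T = U + V\<close> with \<open>U\<close>, \<open>V\<close> in the other
  two eigenspaces (for \<open>\<alpha>\<close>, \<open>\<beta>\<close>), and the Codazzi equation turns the derivative of the condition that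
  \<open>T\<close> is orthogonal to the eigenspace of \<open>\<gamma>\<close> into
  \<open>c \<bar>U\<bar>\<^sup>2 / (\<alpha> - \<gamma>) + c \<bar>V\<bar>\<^sup>2 / (\<beta> - \<gamma>) = \<gamma>\<close>. Differentiating this in the direction \<open>U\<close> gives a second
  equation, and both determine \<open>\<nu>\<^sup>2 = 1 - \<bar>U\<bar>\<^sup>2 - \<bar>V\<bar>\<^sup>2\<close>. The only remaining case is a surface with two
  principal curvatures, where the Gauss equation and its derivatives along \<open>U\<close> and \<open>V\<close> determine
  \<open>\<nu>\<^sup>2\<close>, unless \<open>U\<close> or \<open>V\<close> vanishes identically nearby, and then the first equation applies again.

  Once \<open>\<nu>\<close> is constant, \<open>A T = 0\<close>, and the shape operator of a parallel hypersurface is an explicit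
  function of \<open>A\<close>, up to a multiple of the projection to \<open>T\<close>. Its trace is a combination of the
  traces of the projections to the eigenspaces of \<open>A\<close>, which are constant because
  \<open>P\<^sup>2 = P\<close> implies that \<open>P'\<close> has trace zero.\<close>

section \<open>Smooth functions\<close>

text \<open>No eigenframe is ever chosen. Padding the principal curvatures to three distinct numbers
  lets a single cubic polynomial annihilate \<open>A\<close>, whether one, two or three of them
  occur. The eigenprojections are then polynomials in \<open>A\<close>, hence smooth, and projecting
  a constant vector extends an eigenvector to an eigenfield. The bound n \<ge> 4 for g = 3 enters
  through a pigeonhole: more dimensions than eigenvalues force a multiple eigenvalue. Only g = n = 2
  escapes it. Connection and curvature are read off the surrounding flat space: the Codazzi equation
  amounts to the symmetry of second derivatives of the immersion and of its normal. An equation can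
  be differentiated only if it holds on an open set, so the conditions on a point (nonzero \<nu>,
  positive Gram determinant, nonzero component of \<open>T\<close>) are all phrased as open ones.
  The final statement is needed only pointwise, because a continuous function with values in a
  finite set is locally constant.\<close>

abbreviation dd :: "('a::real_normed_vector \<Rightarrow> 'b::real_normed_vector) \<Rightarrow> 'a \<Rightarrow> 'a \<Rightarrow> 'b" where
  "dd f u \<equiv> frechet_derivative f (at u)"

lemma dd_eq: "(f has_derivative f') (at x) \<Longrightarrow> dd f x = f'"
  by (rule frechet_derivative_at[symmetric])

lemma Ck_on_SucE:
  assumes "Ck_on (Suc k) S f"
  shows "x \<in> S \<Longrightarrow> (f has_derivative dd f x) (at x)" "Ck_on k S (\<lambda>x. dd f x v)"
  using assms by (auto simp: frechet_derivative_works[symmetric])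

lemma Ck_on_SucI_dd:
  "(\<And>x. x \<in> S \<Longrightarrow> f differentiable (at x)) \<Longrightarrow> (\<And>v. Ck_on k S (\<lambda>x. dd f x v)) \<Longrightarrow>
    Ck_on (Suc k) S f"
  by simp

lemma Ck_on_cong:
  assumes "open S" "\<And>x. x \<in> S \<Longrightarrow> f x = g x" "Ck_on k S f"
  shows "Ck_on k S g"
  using assms(2,3)
proof (induction k arbitrary: f g)
  case 0
  then show ?case by (simp cong: continuous_on_cong)
next
  case (Suc k)
  have *: "(g has_derivative dd f x) (at x)" if "x \<in> S" for x
    by (rule has_derivative_transform_within_open[OF Ck_on_SucE(1)[OF Suc.prems(2) that] assms(1) that])
      (rule Suc.prems(1))
  have "Ck_on k S (\<lambda>x. dd g x v)" for v
    by (rule Suc.IH[OF _ Ck_on_SucE(2)[OF Suc.prems(2), of v]]) (simp add: dd_eq[OF *])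
  then show ?case
    using * by (auto simp: differentiable_def)
qed

text \<open>The recursion of \<open>Ck_on\<close> speaks about \<open>frechet_derivative\<close>. On
  an open set any derivative formula may stand in for it, so each closure property follows by
  induction from its differentiation rule.\<close>

lemma Ck_on_SucI:
  assumes "open S" "\<And>x. x \<in> S \<Longrightarrow> (f has_derivative f' x) (at x)"
    and "\<And>v. Ck_on k S (\<lambda>x. f' x v)"
  shows "Ck_on (Suc k) S f"
proof -
  have "Ck_on k S (\<lambda>x. dd f x v)" for v
    by (rule Ck_on_cong[OF assms(1) _ assms(3)[of v]]) (simp add: dd_eq[OF assms(2)])
  then show ?thesis
    using assms(2) by (auto simp: differentiable_def)
qed

lemma Ck_on_SucD: "Ck_on (Suc k) S f \<Longrightarrow> Ck_on k S f"
proof (induction k arbitrary: f)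
  case 0
  have "isCont f x" if "x \<in> S" for x
    using has_derivative_continuous[OF Ck_on_SucE(1)[OF 0 that]] .
  then show ?case
    by (simp add: continuous_at_imp_continuous_on)
next
  case (Suc k)
  show ?case
    by (rule Ck_on_SucI_dd) (use Ck_on_SucE(1)[OF Suc.prems] Suc.IH[OF Ck_on_SucE(2)[OF Suc.prems]]
        in \<open>auto simp: differentiable_def simp del: Ck_on.simps\<close>)
qed

lemma Ck_on_subset: "Ck_on k S f \<Longrightarrow> T \<subseteq> S \<Longrightarrow> Ck_on k T f"
proof (induction k arbitrary: f)
  case 0
  then show ?case by (auto intro: continuous_on_subset)
next
  case (Suc k)
  show ?case
    by (rule Ck_on_SucI_dd) (use Ck_on_SucE(1)[OF Suc.prems(1)] Suc.prems(2)
        Suc.IH[OF Ck_on_SucE(2)[OF Suc.prems(1)] Suc.prems(2)]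
        in \<open>auto simp: differentiable_def simp del: Ck_on.simps\<close>)
qed

lemma Ck_on_const: "Ck_on k S (\<lambda>x. a)"
  by (induction k arbitrary: a) auto

lemma Ck_on_add:
  assumes "open S" "Ck_on k S f" "Ck_on k S g"
  shows "Ck_on k S (\<lambda>x. f x + g x)"
  using assms(2,3)
proof (induction k arbitrary: f g)
  case 0
  then show ?case by (auto intro: continuous_intros)
next
  case (Suc k)
  show ?case
    by (rule Ck_on_SucI[OF assms(1) has_derivative_add Suc.IH])
      (rule Ck_on_SucE[OF Suc.prems(1)] Ck_on_SucE[OF Suc.prems(2)] | assumption)+
qed

lemma Ck_on_bounded_linear:
  assumes "open S" "bounded_linear L" "Ck_on k S f"
  shows "Ck_on k S (\<lambda>x. L (f x))"
  using assms(3)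
proof (induction k arbitrary: f)
  case 0
  then show ?case using assms(2) by (auto intro: bounded_linear.continuous_on)
next
  case (Suc k)
  show ?case
    by (rule Ck_on_SucI[OF assms(1) bounded_linear.has_derivative[OF assms(2)] Suc.IH])
      (rule Ck_on_SucE[OF Suc.prems] | assumption)+
qed

lemma Ck_on_bilinear:
  assumes "open S" "bounded_bilinear B" "Ck_on k S f" "Ck_on k S g"
  shows "Ck_on k S (\<lambda>x. B (f x) (g x))"
  using assms(3,4)
proof (induction k arbitrary: f g)
  case 0
  then show ?case using assms(2) by (auto intro: bounded_bilinear.continuous_on)
next
  case (Suc k)
  \<comment> \<open>The product rule contains \<open>f\<close> and \<open>g\<close> themselves, so
    they are also needed one order lower.\<close>
  note Suc.prems[THEN Ck_on_SucD]
  then show ?case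
    by (intro Ck_on_SucI[OF assms(1) bounded_bilinear.FDERIV[OF assms(2)]]
        Ck_on_add[OF assms(1)] Suc.IH)
      (rule Ck_on_SucE[OF Suc.prems(1)] Ck_on_SucE[OF Suc.prems(2)] | assumption)+
qed

lemma Ck_on_inverse:
  fixes f :: "'a::euclidean_space \<Rightarrow> real"
  assumes "open S" "\<And>x. x \<in> S \<Longrightarrow> f x \<noteq> 0" "Ck_on k S f"
  shows "Ck_on k S (\<lambda>x. inverse (f x))"
  using assms(3)
proof (induction k)
  case 0
  then show ?case using assms(2) by (auto intro: continuous_intros)
next
  case (Suc k)
  have i: "Ck_on k S (\<lambda>x. inverse (f x))"
    using Suc Ck_on_SucD by blast
  show ?case
  proof (rule Ck_on_SucI[OF assms(1) Deriv.has_derivative_inverse])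
    show "Ck_on k S (\<lambda>x. - (inverse (f x) * dd f x v * inverse (f x)))" for v
      by (intro Ck_on_bounded_linear[OF assms(1) bounded_linear_minus[OF bounded_linear_ident]]
          Ck_on_bilinear[OF assms(1) bounded_bilinear_mult] i Ck_on_SucE(2)[OF Suc.prems])
  qed (use assms(2) Ck_on_SucE(1)[OF Suc.prems] in auto)
qed

lemma smooth_on_cong:
  "open S \<Longrightarrow> (\<And>x. x \<in> S \<Longrightarrow> f x = g x) \<Longrightarrow> smooth_on S f \<Longrightarrow> smooth_on S g"
  unfolding smooth_on_def using Ck_on_cong by blast

lemma smooth_on_subset: "smooth_on S f \<Longrightarrow> T \<subseteq> S \<Longrightarrow> smooth_on T f"
  unfolding smooth_on_def using Ck_on_subset by blast

lemma smooth_on_const: "smooth_on S (\<lambda>x. a)"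
  unfolding smooth_on_def using Ck_on_const by blast

lemma smooth_on_add:
  "open S \<Longrightarrow> smooth_on S f \<Longrightarrow> smooth_on S g \<Longrightarrow> smooth_on S (\<lambda>x. f x + g x)"
  unfolding smooth_on_def using Ck_on_add by blast

lemma smooth_on_bounded_linear:
  "open S \<Longrightarrow> bounded_linear L \<Longrightarrow> smooth_on S f \<Longrightarrow> smooth_on S (\<lambda>x. L (f x))"
  unfolding smooth_on_def using Ck_on_bounded_linear by blast

lemma smooth_on_bilinear:
  "open S \<Longrightarrow> bounded_bilinear B \<Longrightarrow> smooth_on S f \<Longrightarrow> smooth_on S g \<Longrightarrow>
    smooth_on S (\<lambda>x. B (f x) (g x))"
  unfolding smooth_on_def using Ck_on_bilinear by blast

lemma smooth_on_inverse:
  fixes f :: "'a::euclidean_space \<Rightarrow> real"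
  shows "open S \<Longrightarrow> (\<And>x. x \<in> S \<Longrightarrow> f x \<noteq> 0) \<Longrightarrow> smooth_on S f \<Longrightarrow> smooth_on S (\<lambda>x. inverse (f x))"
  unfolding smooth_on_def using Ck_on_inverse by blast

lemma smooth_on_minus: "open S \<Longrightarrow> smooth_on S f \<Longrightarrow> smooth_on S (\<lambda>x. - f x)"
  by (rule smooth_on_bounded_linear[OF _ bounded_linear_minus[OF bounded_linear_ident]])

lemma smooth_on_diff:
  "open S \<Longrightarrow> smooth_on S f \<Longrightarrow> smooth_on S g \<Longrightarrow> smooth_on S (\<lambda>x. f x - g x)"
  using smooth_on_add[OF _ _ smooth_on_minus, of S f g] by simp

lemma smooth_on_mult:
  fixes f g :: "'a::euclidean_space \<Rightarrow> 'b::real_normed_algebra"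
  shows "open S \<Longrightarrow> smooth_on S f \<Longrightarrow> smooth_on S g \<Longrightarrow> smooth_on S (\<lambda>x. f x * g x)"
  by (rule smooth_on_bilinear[OF _ bounded_bilinear_mult])

lemma smooth_on_scaleR:
  "open S \<Longrightarrow> smooth_on S f \<Longrightarrow> smooth_on S g \<Longrightarrow> smooth_on S (\<lambda>x. f x *\<^sub>R g x)"
  by (rule smooth_on_bilinear[OF _ bounded_bilinear_scaleR])

lemma smooth_on_sum:
  assumes "open S" "\<And>i. i \<in> I \<Longrightarrow> smooth_on S (f i)"
  shows "smooth_on S (\<lambda>x. \<Sum>i\<in>I. f i x)"
  using assms(2)
  by (induction I rule: infinite_finite_induct) (auto intro: smooth_on_const smooth_on_add assms(1))

lemma smooth_on_prod:
  fixes f :: "'i \<Rightarrow> 'a::euclidean_space \<Rightarrow> 'b::{real_normed_algebra, comm_ring_1}"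
  assumes "open S" "\<And>i. i \<in> I \<Longrightarrow> smooth_on S (f i)"
  shows "smooth_on S (\<lambda>x. \<Prod>i\<in>I. f i x)"
  using assms(2)
  by (induction I rule: infinite_finite_induct) (auto intro: smooth_on_const smooth_on_mult assms(1))

lemma smooth_on_det:
  fixes B :: "'a::euclidean_space \<Rightarrow> real ^ 'n ^ 'n"
  assumes "open S" "\<And>i j. smooth_on S (\<lambda>x. B x $ i $ j)"
  shows "smooth_on S (\<lambda>x. det (B x))"
  unfolding det_def using assms by (intro smooth_on_sum smooth_on_mult smooth_on_prod smooth_on_const)

lemma smooth_on_component: "open S \<Longrightarrow> smooth_on S f \<Longrightarrow> smooth_on S (\<lambda>x. f x $ i)"
  by (rule smooth_on_bounded_linear[OF _ bounded_linear_vec_nth])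

lemma smooth_on_vec:
  fixes f :: "'a::euclidean_space \<Rightarrow> real ^ 'n"
  assumes "open S" "\<And>i. smooth_on S (\<lambda>x. f x $ i)"
  shows "smooth_on S f"
proof -
  have "smooth_on S (\<lambda>x. \<Sum>i\<in>UNIV. f x $ i *\<^sub>R axis i 1)"
    using assms by (intro smooth_on_sum smooth_on_scaleR smooth_on_const) auto
  also have "(\<lambda>x. \<Sum>i\<in>UNIV. f x $ i *\<^sub>R axis i 1) = f"
    by (simp add: basis_expansion scalar_mult_eq_scaleR[symmetric])
  finally show ?thesis .
qed

lemma smooth_on_differentiable: "smooth_on S f \<Longrightarrow> x \<in> S \<Longrightarrow> f differentiable (at x)"
  unfolding smooth_on_def by (metis Ck_on.simps(2))

lemma smooth_on_has_derivative: "smooth_on S f \<Longrightarrow> x \<in> S \<Longrightarrow> (f has_derivative dd f x) (at x)"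
  using smooth_on_differentiable frechet_derivative_works by blast

lemma smooth_on_continuous_on: "smooth_on S f \<Longrightarrow> continuous_on S f"
  unfolding smooth_on_def by (metis Ck_on.simps(1))

lemma smooth_on_dd: "smooth_on S f \<Longrightarrow> smooth_on S (\<lambda>x. dd f x v)"
  unfolding smooth_on_def by (metis Ck_on.simps(2))

lemma smooth_on_linear_dd: "smooth_on S f \<Longrightarrow> x \<in> S \<Longrightarrow> linear (dd f x)"
  by (simp add: linear_frechet_derivative smooth_on_differentiable)

text \<open>\<open>Ck_on\<close> controls derivatives in fixed directions only; a variable direction
  is expanded in the standard basis.\<close>

lemma smooth_on_dd_field:
  fixes f :: "real ^ 'n \<Rightarrow> 'b::real_normed_vector"
  assumes "open S" "smooth_on S f" "smooth_on S Z"
  shows "smooth_on S (\<lambda>x. dd f x (Z x))"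
proof (rule smooth_on_cong[OF assms(1)])
  show "smooth_on S (\<lambda>x. \<Sum>i\<in>UNIV. Z x $ i *\<^sub>R dd f x (axis i 1))"
    using assms by (intro smooth_on_sum smooth_on_scaleR smooth_on_component smooth_on_dd)
next
  fix x assume "x \<in> S"
  then have l: "linear (dd f x)" using smooth_on_linear_dd assms(2) by blast
  have "Z x = (\<Sum>i\<in>UNIV. Z x $ i *\<^sub>R axis i 1)"
    by (simp add: basis_expansion scalar_mult_eq_scaleR[symmetric])
  then have "dd f x (Z x) = dd f x (\<Sum>i\<in>UNIV. Z x $ i *\<^sub>R axis i 1)" by simp
  also have "\<dots> = (\<Sum>i\<in>UNIV. Z x $ i *\<^sub>R dd f x (axis i 1))"
    by (simp add: linear_sum[OF l] linear_scale[OF l])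
  finally show "(\<Sum>i\<in>UNIV. Z x $ i *\<^sub>R dd f x (axis i 1)) = dd f x (Z x)" by simp
qed

section \<open>Symmetry of second derivatives\<close>

lemma second_difference_mvt:
  fixes f :: "'a::euclidean_space \<Rightarrow> real"
  assumes "smooth_on S f" "0 < t"
    and in_S: "\<And>r s. r \<in> {0..t} \<Longrightarrow> s \<in> {0..t} \<Longrightarrow> x + r *\<^sub>R v + s *\<^sub>R w \<in> S"
  shows "\<exists>r s. r \<in> {0..t} \<and> s \<in> {0..t} \<and>
    f (x + t *\<^sub>R v + t *\<^sub>R w) - f (x + t *\<^sub>R v) - f (x + t *\<^sub>R w) + f x =
      t\<^sup>2 * dd (\<lambda>y. dd f y v) (x + r *\<^sub>R v + s *\<^sub>R w) w"
proof -
  have line: "((\<lambda>r. h (y + r *\<^sub>R e)) has_derivative (\<lambda>k. k * dd h (y + r *\<^sub>R e) e)) (at r within X)"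
    if "smooth_on S h" "y + r *\<^sub>R e \<in> S" for h :: "'a \<Rightarrow> real" and y e r X
  proof -
    have "((\<lambda>r. h (y + r *\<^sub>R e)) has_derivative (\<lambda>k. dd h (y + r *\<^sub>R e) (k *\<^sub>R e))) (at r within X)"
      by (rule has_derivative_compose[where g = h])
        (use that in \<open>auto intro!: derivative_eq_intros smooth_on_has_derivative[OF that(1)]\<close>)
    then show ?thesis
      using linear_scale[OF smooth_on_linear_dd[OF that]] by simp
  qed
  \<comment> \<open>The second difference is the increment of \<open>\<phi>\<close>. The mean value
    theorem, applied to \<open>\<phi>\<close> and then to its derivative, turns it into a mixed
    derivative; since it is symmetric in \<open>v\<close> and \<open>w\<close>, both orders of
    differentiation can be compared.\<close>
  define \<phi> where "\<phi> r = f ((x + t *\<^sub>R w) + r *\<^sub>R v) - f (x + r *\<^sub>R v)" for r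
  have "\<exists>r\<in>{0<..<t}. \<phi> t - \<phi> 0 =
      (\<lambda>k. k * dd f ((x + t *\<^sub>R w) + r *\<^sub>R v) v - k * dd f (x + r *\<^sub>R v) v) (t - 0)"
  proof (rule mvt_simple[OF assms(2)])
    fix r assume r: "0 \<le> r" "r \<le> t"
    show "(\<phi> has_derivative (\<lambda>k. k * dd f ((x + t *\<^sub>R w) + r *\<^sub>R v) v - k * dd f (x + r *\<^sub>R v) v))
        (at r within {0..t})"
      unfolding \<phi>_def
      using in_S[of r t] in_S[of r 0] r assms(2)
      by (intro has_derivative_diff line assms(1)) (auto simp: algebra_simps)
  qed
  then obtain r where r: "r \<in> {0<..<t}"
    and 1: "\<phi> t - \<phi> 0 = t * (dd f ((x + t *\<^sub>R w) + r *\<^sub>R v) v - dd f (x + r *\<^sub>R v) v)"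
    by (auto simp: algebra_simps)
  define \<psi> where "\<psi> s = dd f ((x + r *\<^sub>R v) + s *\<^sub>R w) v" for s
  have "\<exists>s\<in>{0<..<t}. \<psi> t - \<psi> 0 =
      (\<lambda>k. k * dd (\<lambda>y. dd f y v) ((x + r *\<^sub>R v) + s *\<^sub>R w) w) (t - 0)"
  proof (rule mvt_simple[OF assms(2)])
    fix s assume s: "0 \<le> s" "s \<le> t"
    show "(\<psi> has_derivative (\<lambda>k. k * dd (\<lambda>y. dd f y v) ((x + r *\<^sub>R v) + s *\<^sub>R w) w))
        (at s within {0..t})"
      unfolding \<psi>_def
      using in_S[of r s] s r
      by (intro line smooth_on_dd assms(1)) auto
  qed
  then obtain s where s: "s \<in> {0<..<t}"
    and 2: "\<psi> t - \<psi> 0 = t * dd (\<lambda>y. dd f y v) ((x + r *\<^sub>R v) + s *\<^sub>R w) w"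
    by auto
  have "f (x + t *\<^sub>R v + t *\<^sub>R w) - f (x + t *\<^sub>R v) - f (x + t *\<^sub>R w) + f x = \<phi> t - \<phi> 0"
    by (simp add: \<phi>_def algebra_simps)
  also have "\<dots> = t * (\<psi> t - \<psi> 0)"
    unfolding 1 by (simp add: \<psi>_def algebra_simps)
  finally show ?thesis
    using r s 2 by (intro exI[of _ r] exI[of _ s]) (auto simp: power2_eq_square)
qed

lemma dd_dd_commute_real:
  fixes f :: "'a::euclidean_space \<Rightarrow> real"
  assumes "open S" "smooth_on S f" "x \<in> S"
  shows "dd (\<lambda>y. dd f y v) x w = dd (\<lambda>y. dd f y w) x v"
proof (rule ccontr)
  define p where "p = (\<lambda>y. dd (\<lambda>y. dd f y v) y w)"
  define q where "q = (\<lambda>y. dd (\<lambda>y. dd f y w) y v)"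
  assume "\<not> ?thesis"
  then have e: "\<bar>p x - q x\<bar> / 2 > 0" (is "?e > 0") by (simp add: p_def q_def)
  have cont: "continuous_on S p" "continuous_on S q"
    unfolding p_def q_def by (intro smooth_on_continuous_on smooth_on_dd assms)+
  have "isCont p x" "isCont q x"
    using cont assms continuous_on_eq_continuous_at by blast+
  then have "\<forall>\<^sub>F y in nhds x. y \<in> S \<and> dist (p y) (p x) < ?e \<and> dist (q y) (q x) < ?e"
    using e assms(1,3)
    by (intro eventually_conj eventually_nhds_in_open tendstoD)
      (auto simp: continuous_at tendsto_nhds_iff)
  then obtain d where d: "d > 0"
    and near: "\<And>y. dist y x < d \<Longrightarrow> y \<in> S \<and> dist (p y) (p x) < ?e \<and> dist (q y) (q x) < ?e"
    unfolding eventually_nhds_metric by blast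
  \<comment> \<open>With this \<open>t\<close> the parallelogram spanned by
    \<open>t *\<^sub>R v\<close> and \<open>t *\<^sub>R w\<close> stays within distance
    \<open>d\<close> of \<open>x\<close>; the summand 1 covers \<open>v = w = 0\<close>.\<close>
  define t where "t = d / (2 * (norm v + norm w + 1))"
  have t: "t > 0" unfolding t_def using d by (intro divide_pos_pos) (auto intro: add_nonneg_pos)
  have close: "dist (x + r *\<^sub>R v + s *\<^sub>R w) x < d" if "r \<in> {0..t}" "s \<in> {0..t}" for r s
  proof -
    have "dist (x + r *\<^sub>R v + s *\<^sub>R w) x = norm (r *\<^sub>R v + s *\<^sub>R w)"
      by (simp add: dist_norm algebra_simps)
    also have "\<dots> \<le> r * norm v + s * norm w"
      using norm_triangle_ineq[of "r *\<^sub>R v" "s *\<^sub>R w"] that by simp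
    also have "\<dots> \<le> t * norm v + t * norm w"
      using that by (intro add_mono mult_right_mono) auto
    also have "\<dots> < t * (2 * (norm v + norm w + 1))"
      using t by (simp add: algebra_simps add_nonneg_pos)
    also have "\<dots> = d"
      unfolding t_def using norm_ge_zero[of v] norm_ge_zero[of w]
      by (simp add: field_simps add_nonneg_eq_0_iff)
    finally show ?thesis .
  qed
  obtain r s where 1: "r \<in> {0..t}" "s \<in> {0..t}" and
    A: "f (x + t *\<^sub>R v + t *\<^sub>R w) - f (x + t *\<^sub>R v) - f (x + t *\<^sub>R w) + f x =
      t\<^sup>2 * p (x + r *\<^sub>R v + s *\<^sub>R w)"
    unfolding p_def using second_difference_mvt[OF assms(2) t, of x v w] close near by blast
  have "\<And>r s. r \<in> {0..t} \<Longrightarrow> s \<in> {0..t} \<Longrightarrow> x + r *\<^sub>R w + s *\<^sub>R v \<in> S"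
    using close near by (metis add.commute add.left_commute)
  then obtain r' s' where 2: "r' \<in> {0..t}" "s' \<in> {0..t}" and
    B: "f (x + t *\<^sub>R w + t *\<^sub>R v) - f (x + t *\<^sub>R w) - f (x + t *\<^sub>R v) + f x =
      t\<^sup>2 * q (x + r' *\<^sub>R w + s' *\<^sub>R v)"
    unfolding q_def using second_difference_mvt[OF assms(2) t, of x w v] by blast
  have "p (x + r *\<^sub>R v + s *\<^sub>R w) = q (x + s' *\<^sub>R v + r' *\<^sub>R w)"
    using A B t by (simp add: algebra_simps)
  then show False
    using near[OF close[OF 1]] near[OF close[OF 2(2,1)]] unfolding dist_real_def
    by (smt (verit) field_sum_of_halves)
qed

lemma dd_bounded_linear:
  assumes "bounded_linear L" "f differentiable (at x)"
  shows "dd (\<lambda>y. L (f y)) x v = L (dd f x v)"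
  using assms by (subst dd_eq[OF bounded_linear.has_derivative[OF assms(1)]])
    (auto simp: frechet_derivative_works[symmetric])

lemma dd_cong:
  assumes "open S" "x \<in> S" "\<And>y. y \<in> S \<Longrightarrow> f y = g y"
  shows "dd f x = dd g x"
proof -
  have "(f has_derivative d) (at x) \<longleftrightarrow> (g has_derivative d) (at x)" for d
    using assms has_derivative_transform_within_open[of f d x UNIV S g]
      has_derivative_transform_within_open[of g d x UNIV S f] by auto
  then show ?thesis by (simp add: frechet_derivative_def)
qed

lemma dd_dd_commute:
  fixes f :: "'a::euclidean_space \<Rightarrow> 'b::euclidean_space"
  assumes "open S" "smooth_on S f" "x \<in> S"
  shows "dd (\<lambda>y. dd f y v) x w = dd (\<lambda>y. dd f y w) x v"
proof (rule euclidean_eqI)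
  fix b :: 'b
  have bl: "bounded_linear (\<lambda>z. z \<bullet> b)" by (rule bounded_linear_inner_left)
  have *: "dd (\<lambda>y. dd f y v) x w \<bullet> b = dd (\<lambda>y. dd (\<lambda>y. f y \<bullet> b) y v) x w" for v w
  proof -
    have "dd (\<lambda>y. dd (\<lambda>y. f y \<bullet> b) y v) x w = dd (\<lambda>y. dd f y v \<bullet> b) x w"
      using dd_bounded_linear[OF bl smooth_on_differentiable[OF assms(2)]]
      by (intro fun_cong[OF dd_cong[OF assms(1,3)]]) auto
    then show ?thesis
      using dd_bounded_linear[OF bl smooth_on_differentiable[OF smooth_on_dd[OF assms(2)] assms(3)]]
      by simp
  qed
  show "dd (\<lambda>y. dd f y v) x w \<bullet> b = dd (\<lambda>y. dd f y w) x v \<bullet> b"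
    unfolding * by (intro dd_dd_commute_real[OF assms(1) _ assms(3)]
        smooth_on_bounded_linear[OF assms(1) bl assms(2)])
qed

section \<open>Symmetric operators with three eigenvalues\<close>

text \<open>The induced metric in a chart varies from point to point and differs from the Euclidean
  inner product of the coordinates, so the linear algebra is done for an arbitrary positive
  form.\<close>

locale inner_form =
  fixes G :: "'a::euclidean_space \<Rightarrow> 'a \<Rightarrow> real"
  assumes bilinear_G: "bilinear G"
    and G_commute: "G X Y = G Y X"
    and G_pos: "X \<noteq> 0 \<Longrightarrow> G X X > 0"
begin

lemmas G_simps = bilinear_ladd[OF bilinear_G] bilinear_radd[OF bilinear_G]
  bilinear_lsub[OF bilinear_G] bilinear_rsub[OF bilinear_G]
  bilinear_lmul[OF bilinear_G] bilinear_rmul[OF bilinear_G]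
  bilinear_lneg[OF bilinear_G] bilinear_rneg[OF bilinear_G]
  bilinear_lzero[OF bilinear_G] bilinear_rzero[OF bilinear_G]

lemma G_eq_0_iff: "G X X = 0 \<longleftrightarrow> X = 0"
  using G_pos[of X] by (cases "X = 0") (auto simp: G_simps)

lemma continuous_on_G: "continuous_on S f \<Longrightarrow> continuous_on S g \<Longrightarrow> continuous_on S (\<lambda>x. G (f x) (g x))"
  using bilinear_G by (intro bounded_bilinear.continuous_on[of G]) (auto simp: bilinear_conv_bounded_bilinear)

text \<open>The determinant is \<open>G X X\<close> times the squared length of the part of
  \<open>Y\<close> orthogonal to \<open>X\<close>. In this form linear independence is visibly an
  open condition on continuous fields.\<close>

lemma G_Gram_pos:
  assumes "X \<noteq> 0" "\<And>r. Y \<noteq> r *\<^sub>R X"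
  shows "G X X * G Y Y - (G X Y)\<^sup>2 > 0"
proof -
  have p: "G X X > 0" using assms(1) by (rule G_pos)
  define r where "r = G X Y / G X X"
  have "Y - r *\<^sub>R X \<noteq> 0" using assms(2)[of r] by auto
  then have "0 < G X X * G (Y - r *\<^sub>R X) (Y - r *\<^sub>R X)" using p G_pos by simp
  also have "\<dots> = G X X * G Y Y - (G X Y)\<^sup>2"
    using p by (simp add: G_simps r_def G_commute[of Y X] field_simps power2_eq_square)
  finally show ?thesis .
qed

lemma exists_orthogonal_combination:
  assumes "G X X * G Y Y - (G X Y)\<^sup>2 > 0"
  shows "\<exists>r s. r *\<^sub>R X + s *\<^sub>R Y \<noteq> 0 \<and> G (r *\<^sub>R X + s *\<^sub>R Y) W = 0"
proof (cases "G X W = 0")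
  case True
  moreover have "X \<noteq> 0" using assms by (auto simp: G_simps)
  ultimately show ?thesis by (intro exI[of _ 1] exI[of _ 0]) auto
next
  case False
  let ?Z = "G Y W *\<^sub>R X + (- G X W) *\<^sub>R Y"
  have "?Z \<noteq> 0"
  proof
    assume "?Z = 0"
    then have "G X W *\<^sub>R Y = G Y W *\<^sub>R X" by simp
    then have Y: "Y = (G Y W / G X W) *\<^sub>R X" using False
      by (metis (no_types, opaque_lifting) divideR_right divide_inverse mult.commute scaleR_scaleR)
    define k where "k = G Y W / G X W"
    have "G X X * G Y Y - (G X Y)\<^sup>2 = 0"
      unfolding Y[folded k_def] by (simp add: G_simps power2_eq_square)
    then show False using assms by simp
  qed
  then show ?thesis by (intro exI[of _ "G Y W"] exI[of _ "- G X W"]) (auto simp: G_simps)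
qed

lemma orthogonal_to_pair_dim2:
  assumes "DIM('a) = 2" "U \<noteq> 0" "V \<noteq> 0" "G U V = 0" "G W U = 0" "G W V = 0"
  shows "W = 0"
proof -
  have "U \<notin> span {V}"
  proof
    assume "U \<in> span {V}"
    then obtain k where "U = k *\<^sub>R V" by (auto simp: span_singleton)
    then show False using assms by (auto simp: G_simps G_eq_0_iff)
  qed
  then have i: "independent {U, V}" and ne: "U \<noteq> V"
    using assms(2,3) by (auto simp: independent_insert span_base)
  have "UNIV \<subseteq> span {U, V}"
    by (rule card_ge_dim_independent) (use i ne assms(1) in auto)
  then have "W \<in> span {U, V}" by blast
  then obtain a b where "W - a *\<^sub>R U = b *\<^sub>R V"
    unfolding span_breakdown_eq span_singleton by blast
  then have W: "W = a *\<^sub>R U + b *\<^sub>R V" by (simp add: algebra_simps)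
  have "G W (a *\<^sub>R U + b *\<^sub>R V) = 0" using assms by (simp add: G_simps)
  then show ?thesis unfolding W[symmetric] by (simp add: G_eq_0_iff)
qed

end

text \<open>The first variation vanishes at an extremum. Dividing by \<open>d + 1\<close> instead of
  \<open>d\<close> in the witness covers \<open>d = 0\<close> as well.\<close>

lemma quadratic_nonneg_imp_zero:
  fixes b d :: real
  assumes "\<And>s. 2 * s * b + s\<^sup>2 * d \<ge> 0" "d \<ge> 0"
  shows "b = 0"
proof -
  define e where "e = b / (d + 1)"
  have b: "b = e * (d + 1)" using assms(2) by (simp add: e_def)
  have "0 \<le> - (e\<^sup>2 * (d + 2))"
    using assms(1)[of "- e"] unfolding b by (simp add: algebra_simps power2_eq_square)
  moreover have "e\<^sup>2 * (d + 2) \<ge> e\<^sup>2 * 2" using assms(2) by (intro mult_left_mono) auto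
  ultimately have "e\<^sup>2 \<le> 0" by linarith
  then show ?thesis by (simp add: b)
qed

locale self_adjoint_form = inner_form G for G :: "'a::euclidean_space \<Rightarrow> 'a \<Rightarrow> real" +
  fixes A :: "'a \<Rightarrow> 'a"
  assumes linear_A: "linear A" and G_A: "G (A X) Y = G X (A Y)"
begin

lemmas A_simps = linear_add[OF linear_A] linear_diff[OF linear_A] linear_scale[OF linear_A]
  linear_neg[OF linear_A] linear_0[OF linear_A]

text \<open>The maximum of the Rayleigh quotient on the invariant subspace is an eigenvalue.\<close>

lemma invariant_subspace_has_eigenvector:
  assumes K: "subspace K" "A ` K \<subseteq> K" "K \<noteq> {0}"
  shows "\<exists>e\<in>K. e \<noteq> 0 \<and> (\<exists>l. A e = l *\<^sub>R e)"
proof -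
  define S where "S = K \<inter> sphere 0 1"
  define \<rho> where "\<rho> v = G (A v) v / G v v" for v
  obtain k where "k \<in> K" "k \<noteq> 0" using K subspace_0 by blast
  then have "k /\<^sub>R norm k \<in> S" using K(1) by (auto simp: S_def subspace_scale)
  then have ne: "S \<noteq> {}" by auto
  have comp: "compact S" unfolding S_def by (simp add: closed_Int_compact closed_subspace K(1))
  have A_cont: "continuous_on S A"
    using linear_A by (simp add: linear_continuous_on linear_conv_bounded_linear)
  have "continuous_on S \<rho>"
    unfolding \<rho>_def using A_cont
    by (intro continuous_on_divide continuous_on_G continuous_on_id) (auto simp: S_def G_eq_0_iff)
  from continuous_attains_sup[OF comp ne this]
  obtain e where e: "e \<in> S" and max: "\<And>v. v \<in> S \<Longrightarrow> \<rho> v \<le> \<rho> e" by auto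
  define l where "l = \<rho> e"
  \<comment> \<open>\<open>H\<close> is positive semidefinite on \<open>K\<close> by maximality and
    vanishes at \<open>e\<close>; hence \<open>H e w = 0\<close> for all \<open>w\<close> in
    \<open>K\<close>.\<close>
  define H where "H v w = l * G v w - G (A v) w" for v w
  have eK: "e \<in> K" "e \<noteq> 0" using e by (auto simp: S_def)
  have Hnn: "H v v \<ge> 0" if "v \<in> K" for v
  proof (cases "v = 0")
    case False
    have "\<rho> (v /\<^sub>R norm v) \<le> l"
      unfolding l_def using that False K(1) by (intro max) (auto simp: S_def subspace_scale)
    moreover have "\<rho> (v /\<^sub>R norm v) = \<rho> v"
      using False by (simp add: \<rho>_def A_simps G_simps)
    ultimately have "G (A v) v / G v v \<le> l" by (simp add: \<rho>_def)
    then show ?thesis using G_pos[OF False] by (simp add: H_def field_simps)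
  qed (simp add: H_def G_simps A_simps)
  have H0: "H e e = 0" using G_pos[OF eK(2)] by (simp add: H_def l_def \<rho>_def)
  have Hw: "H e w = 0" if "w \<in> K" for w
  proof (rule quadratic_nonneg_imp_zero)
    fix s :: real
    have sym: "H w e = H e w" by (simp add: H_def G_A G_commute[of w])
    have "e + s *\<^sub>R w \<in> K" using that eK K(1) by (simp add: subspace_add subspace_scale)
    then have "0 \<le> H (e + s *\<^sub>R w) (e + s *\<^sub>R w)" by (rule Hnn)
    also have "\<dots> = H e e + s * H e w + s * H w e + s\<^sup>2 * H w w"
      by (simp add: H_def A_simps G_simps algebra_simps power2_eq_square)
    finally show "0 \<le> 2 * s * H e w + s\<^sup>2 * H w w" by (simp add: H0 sym)
  qed (rule Hnn[OF that])
  \<comment> \<open>By invariance the defect of the eigenvalue equation lies in \<open>K\<close>, so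
    it may be tested against itself.\<close>
  have "l *\<^sub>R e - A e \<in> K" using eK K by (auto simp: subspace_diff subspace_scale)
  from Hw[OF this] have "G (l *\<^sub>R e - A e) (l *\<^sub>R e - A e) = 0"
    by (simp add: H_def G_simps A_simps algebra_simps)
  then have "A e = l *\<^sub>R e" by (simp add: G_eq_0_iff)
  then show ?thesis using eK by blast
qed

end

definition shift :: "('a::real_vector \<Rightarrow> 'a) \<Rightarrow> real \<Rightarrow> 'a \<Rightarrow> 'a" where
  "shift A l X = A X - l *\<^sub>R X"

lemma linear_shift: "linear A \<Longrightarrow> linear (shift A l)"
  unfolding shift_def by (intro linear_compose_sub linear_scale_self) auto

lemma shift_commute: "linear A \<Longrightarrow> shift A k (shift A l X) = shift A l (shift A k X)"
  by (simp add: shift_def linear_diff linear_scale algebra_simps)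

lemma shift_eigenvector: "A X = l *\<^sub>R X \<Longrightarrow> shift A k X = (l - k) *\<^sub>R X"
  by (simp add: shift_def algebra_simps)

text \<open>The range of the polynomial \<open>q\<close> in \<open>A\<close> is invariant, so if
  nonzero it contains an eigenvector \<open>e = q v\<close>. Its eigenvalue is a root, whence
  \<open>q e = 0\<close> and \<open>G e e = G v (q e) = 0\<close>. This replaces a diagonalization
  of \<open>A\<close>.\<close>

lemma (in self_adjoint_form) cubic_annihilates:
  assumes "\<And>l X. X \<noteq> 0 \<Longrightarrow> A X = l *\<^sub>R X \<Longrightarrow> l \<in> {l1, l2, l3}"
  shows "shift A l1 (shift A l2 (shift A l3 X)) = 0"
proof -
  define q where "q X = shift A l1 (shift A l2 (shift A l3 X))" for X
  have lin: "linear q"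
    using linear_compose[OF linear_compose[OF linear_shift[OF linear_A] linear_shift[OF linear_A]]
        linear_shift[OF linear_A], of l1 l2 l3]
    by (simp add: q_def[abs_def] o_def shift_commute[OF linear_A, of l3 l2]
        shift_commute[OF linear_A, of l3 l1] shift_commute[OF linear_A, of l2 l1])
  have sh: "G (shift A l X) Y = G X (shift A l Y)" for l X Y
    by (simp add: shift_def G_simps G_A)
  have q_adj: "G (q X) Y = G X (q Y)" for X Y
    unfolding q_def sh by (simp add: shift_commute[OF linear_A])
  have "A (q v) = q (A v)" for v
    by (simp add: q_def shift_def A_simps)
  then have "A ` range q \<subseteq> range q" by auto
  moreover have "subspace (range q)" using lin by (simp add: linear_subspace_image subspace_UNIV)
  moreover have False if er: "e \<in> range q" and that: "e \<noteq> 0" "A e = l *\<^sub>R e" for e l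
  proof -
    obtain v where v: "e = q v" using er by (rule rangeE)
    have "q e = ((l - l1) * (l - l2) * (l - l3)) *\<^sub>R e"
      unfolding q_def
      by (simp add: shift_eigenvector[of A e l, OF that(2)] linear_scale[OF linear_shift[OF linear_A]] mult_ac)
    then have "q e = 0" using assms[OF that] by auto
    then have "G e e = 0" using q_adj[of v e] by (simp add: v G_simps)
    then show False using that(1) G_eq_0_iff by simp
  qed
  ultimately have "range q = {0}" using invariant_subspace_has_eigenvector by blast
  then show ?thesis unfolding q_def[symmetric] by auto
qed

text \<open>If \<open>(A - l1) (A - l2) (A - l3) = 0\<close>, the projection onto the eigenspace of \<open>l1\<close>.\<close>

definition eigenproj :: "('a::real_vector \<Rightarrow> 'a) \<Rightarrow> real \<Rightarrow> real \<Rightarrow> real \<Rightarrow> 'a \<Rightarrow> 'a" where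
  "eigenproj A l1 l2 l3 X = (1 / ((l1 - l2) * (l1 - l3))) *\<^sub>R shift A l2 (shift A l3 X)"

lemma linear_eigenproj: "linear A \<Longrightarrow> linear (eigenproj A l1 l2 l3)"
  unfolding eigenproj_def
  using linear_compose[OF linear_shift linear_shift, of A A l3 l2]
  by (auto simp: o_def shift_commute[of A l3] intro: linear_compose_scale_right)

text \<open>The three numbers need not all be eigenvalues; the projection belonging to a number that
  is not an eigenvalue is 0. The cyclic symmetry \<open>rotate\<close> transfers every fact about
  \<open>l1\<close> to the other two.\<close>

locale three_eigenvalues =
  fixes A :: "'a::real_vector \<Rightarrow> 'a" and l1 l2 l3 :: real
  assumes linear_A: "linear A"
    and distinct: "l1 \<noteq> l2" "l1 \<noteq> l3" "l2 \<noteq> l3"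
    and cubic: "shift A l1 (shift A l2 (shift A l3 X)) = 0"
begin

lemma rotate: "three_eigenvalues A l2 l3 l1"
  by (rule three_eigenvalues.intro)
    (use linear_A distinct cubic in \<open>auto simp: shift_commute[OF linear_A, of l3 l1]
      shift_commute[OF linear_A, of l2 l1]\<close>)

lemma A_eigenproj: "A (eigenproj A l1 l2 l3 X) = l1 *\<^sub>R eigenproj A l1 l2 l3 X"
  using cubic[of X] unfolding eigenproj_def shift_def[of A l1]
  by (simp add: linear_scale[OF linear_A] mult_ac)

lemma eigenproj_eigenvector:
  "A X = l1 *\<^sub>R X \<Longrightarrow> eigenproj A l1 l2 l3 X = X"
  using distinct
  by (simp add: eigenproj_def shift_eigenvector[of A X l1] linear_scale[OF linear_shift[OF linear_A]])

lemma eigenproj_idem: "eigenproj A l1 l2 l3 (eigenproj A l1 l2 l3 X) = eigenproj A l1 l2 l3 X"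
  by (rule eigenproj_eigenvector[OF A_eigenproj])

text \<open>The projections are the Lagrange basis polynomials at \<open>l1\<close>,
  \<open>l2\<close>, \<open>l3\<close> evaluated at \<open>A\<close>, and these add up to the
  constant 1. The numbers \<open>a\<close>, \<open>b\<close>, \<open>d\<close> are their leading
  coefficients.\<close>

lemma eigenproj_sum:
  "eigenproj A l1 l2 l3 X + eigenproj A l2 l3 l1 X + eigenproj A l3 l1 l2 X = X"
proof -
  define a b d where "a = 1 / ((l1 - l2) * (l1 - l3))" and "b = 1 / ((l2 - l3) * (l2 - l1))"
    and "d = 1 / ((l3 - l1) * (l3 - l2))"
  have 0: "a + b + d = 0" "a * (l2 + l3) + b * (l3 + l1) + d * (l1 + l2) = 0"
    "a * (l2 * l3) + b * (l3 * l1) + d * (l1 * l2) = 1"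
    unfolding a_def b_def d_def using distinct
    by (simp_all add: divide_simps) (simp_all add: algebra_simps)
  have "eigenproj A l1 l2 l3 X + eigenproj A l2 l3 l1 X + eigenproj A l3 l1 l2 X =
      (a + b + d) *\<^sub>R A (A X) - (a * (l2 + l3) + b * (l3 + l1) + d * (l1 + l2)) *\<^sub>R A X
        + (a * (l2 * l3) + b * (l3 * l1) + d * (l1 * l2)) *\<^sub>R X"
    unfolding eigenproj_def a_def[symmetric] b_def[symmetric] d_def[symmetric] shift_def
    by (simp add: linear_diff[OF linear_A] linear_scale[OF linear_A] algebra_simps)
  then show ?thesis unfolding 0 by simp
qed

end

text \<open>Otherwise a single vector \<open>v l\<close> per eigenvalue would span the whole
  space.\<close>

lemma multiple_eigenvalue:
  fixes A :: "'a::euclidean_space \<Rightarrow> 'a"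
  assumes "finite L" "card L < DIM('a)"
    and "UNIV \<subseteq> span (\<Union>l\<in>L. {X. A X = l *\<^sub>R X})"
  shows "\<exists>l\<in>L. \<exists>X Y. X \<noteq> 0 \<and> A X = l *\<^sub>R X \<and> A Y = l *\<^sub>R Y \<and> (\<forall>r. Y \<noteq> r *\<^sub>R X)"
proof (rule ccontr)
  assume contra: "\<not> ?thesis"
  have "\<exists>v. \<forall>Y. A Y = l *\<^sub>R Y \<longrightarrow> Y \<in> span {v}" if "l \<in> L" for l
  proof (cases "\<exists>X. X \<noteq> 0 \<and> A X = l *\<^sub>R X")
    case True
    then obtain X where X: "X \<noteq> 0" "A X = l *\<^sub>R X" by blast
    then have "\<exists>r. Y = r *\<^sub>R X" if "A Y = l *\<^sub>R Y" for Y
      using contra \<open>l \<in> L\<close> that by blast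
    then show ?thesis by (intro exI[of _ X]) (auto simp: span_singleton)
  next
    case False
    then show ?thesis by (intro exI[of _ 0]) auto
  qed
  then obtain v where v: "\<And>l Y. l \<in> L \<Longrightarrow> A Y = l *\<^sub>R Y \<Longrightarrow> Y \<in> span {v l}" by metis
  have "(\<Union>l\<in>L. {X. A X = l *\<^sub>R X}) \<subseteq> span (v ` L)"
  proof (rule UN_least)
    fix l assume "l \<in> L"
    then have "span {v l} \<subseteq> span (v ` L)" by (intro span_mono) auto
    then show "{X. A X = l *\<^sub>R X} \<subseteq> span (v ` L)" using v[OF \<open>l \<in> L\<close>] by auto
  qed
  then have "UNIV \<subseteq> span (v ` L)"
    using assms(3) span_minimal[of _ "span (v ` L)"] by blast
  then have "dim (UNIV :: 'a set) \<le> card (v ` L)"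
    using assms(1) by (intro span_card_ge_dim) auto
  also have "\<dots> \<le> card L" using assms(1) by (rule card_image_le)
  finally show False using assms(2) by simp
qed

section \<open>Traces of smooth families of projections\<close>

lemma trace_idempotent_derivative:
  fixes P Q :: "real ^ 'n ^ 'n"
  assumes "P ** P = P" "Q = Q ** P + P ** Q"
  shows "trace Q = 0"
proof -
  \<comment> \<open>Multiplying \<open>Q = Q ** P + P ** Q\<close> by \<open>P\<close> from the left
    leaves P Q P = 0, and P Q P has the same trace as P Q by cyclicity.\<close>
  have "P ** Q = P ** (Q ** P) + P ** (P ** Q)"
    by (subst assms(2)) (simp add: matrix_add_ldistrib)
  then have "P ** (Q ** P) = 0" by (simp add: matrix_mul_assoc assms(1))
  moreover have "trace (P ** (Q ** P)) = trace (P ** Q)"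
    by (metis assms(1) matrix_mul_assoc trace_mul_sym)
  ultimately have "trace (P ** Q) = 0" by (simp add: trace_def)
  moreover have "trace (Q ** P) = trace (P ** Q)" by (rule trace_mul_sym)
  ultimately show ?thesis using assms(2) trace_add[of "Q ** P" "P ** Q"] by simp
qed

lemma trace_idempotent_constant:
  fixes P :: "real ^ 'm \<Rightarrow> real ^ 'n \<Rightarrow> real ^ 'n"
  assumes "open S" "connected S"
    and lin: "\<And>u. u \<in> S \<Longrightarrow> linear (P u)"
    and idem: "\<And>u X. u \<in> S \<Longrightarrow> P u (P u X) = P u X"
    and smooth: "\<And>X. smooth_on S (\<lambda>u. P u X)"
  shows "(\<lambda>u. trace (matrix (P u))) constant_on S"
proof (rule has_derivative_zero_connected_constant_on[of S "{}"])
  have ent: "smooth_on S (\<lambda>u. matrix (P u) $ i $ j)" for i j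
    using smooth_on_component[OF assms(1) smooth[of "axis j 1"], of i] by (simp add: matrix_def)
  have mul: "matrix (P u) ** matrix (P u) = matrix (P u)" if "u \<in> S" for u
    unfolding matrix_compose[OF lin[OF that] lin[OF that], symmetric] o_def idem[OF that] ..
  have d: "((\<lambda>u. matrix (P u) $ i $ j) has_derivative dd (\<lambda>u. matrix (P u) $ i $ j) u) (at u)"
    if "u \<in> S" for u i j
    by (rule smooth_on_has_derivative[OF ent that])
  show "continuous_on S (\<lambda>u. trace (matrix (P u)))"
    unfolding trace_def by (intro continuous_intros smooth_on_continuous_on ent)
  show "\<forall>u\<in>S - {}. ((\<lambda>u. trace (matrix (P u))) has_derivative (\<lambda>v. 0)) (at u within S)"
  proof
    fix u assume "u \<in> S - {}"
    then have u: "u \<in> S" by simp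
    have "(\<Sum>i\<in>UNIV. dd (\<lambda>u. matrix (P u) $ i $ i) u v) = 0" for v
    proof -
      define Q where "Q = (\<chi> i j. dd (\<lambda>u. matrix (P u) $ i $ j) u v)"
      have "Q $ i $ j = (Q ** matrix (P u) + matrix (P u) ** Q) $ i $ j" for i j
      proof -
        have 1: "((\<lambda>u. \<Sum>k\<in>UNIV. matrix (P u) $ i $ k * matrix (P u) $ k $ j) has_derivative
           (\<lambda>v. \<Sum>k\<in>UNIV. matrix (P u) $ i $ k * dd (\<lambda>u. matrix (P u) $ k $ j) u v
              + dd (\<lambda>u. matrix (P u) $ i $ k) u v * matrix (P u) $ k $ j)) (at u)"
          by (intro has_derivative_sum has_derivative_mult d u)
        \<comment> \<open>Entrywise form of P P = P; differentiating it gives the equation Q = Q P +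
          P Q.\<close>
        have 2: "dd (\<lambda>u. \<Sum>k\<in>UNIV. matrix (P u) $ i $ k * matrix (P u) $ k $ j) u =
            dd (\<lambda>u. matrix (P u) $ i $ j) u"
        proof (rule dd_cong[OF assms(1) u])
          fix u assume "u \<in> S"
          then show "(\<Sum>k\<in>UNIV. matrix (P u) $ i $ k * matrix (P u) $ k $ j) = matrix (P u) $ i $ j"
            by (subst (3) mul[symmetric]) (auto simp: matrix_matrix_mult_def)
        qed
        show ?thesis
          using fun_cong[OF trans[OF 2[symmetric] dd_eq[OF 1]], of v]
          by (simp add: Q_def matrix_matrix_mult_def sum.distrib algebra_simps)
      qed
      then have "Q = Q ** matrix (P u) + matrix (P u) ** Q" by (simp add: vec_eq_iff)
      from trace_idempotent_derivative[OF mul[OF u] this] show ?thesis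
        by (simp add: trace_def Q_def)
    qed
    then show "((\<lambda>u. trace (matrix (P u))) has_derivative (\<lambda>v. 0)) (at u within S)"
      unfolding trace_def
      using has_derivative_sum[of UNIV "\<lambda>i u. matrix (P u) $ i $ i", OF d[OF u]]
      by (simp add: has_derivative_at_withinI)
  qed
qed (use assms in auto)

lemma trace_matrix_conj:
  fixes A J K :: "real ^ 'n \<Rightarrow> real ^ 'n"
  assumes "linear A" "linear J" "linear K" "\<And>X. J (K X) = X"
  shows "trace (matrix (\<lambda>X. K (A (J X)))) = trace (matrix A)"
proof -
  have "matrix (\<lambda>X. K (A (J X))) = matrix K ** (matrix A ** matrix J)"
    using matrix_compose[OF linear_compose[OF assms(2,1)] assms(3)] matrix_compose[OF assms(2,1)]
    by (simp add: o_def)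
  moreover have "matrix J ** matrix K = mat 1"
    using matrix_compose[OF assms(3,2)] assms(4) by (simp add: o_def matrix_id_mat_1[unfolded id_def])
  ultimately show ?thesis
    by (metis matrix_mul_assoc matrix_mul_rid trace_mul_sym)
qed

section \<open>Hypersurfaces in a chart\<close>

text \<open>The projection along \<open>d_dt\<close>. At a point of \<open>QxR c\<close> it yields
  the normal vector of \<open>QxR c\<close> in the flat space; on tangent vectors it yields the
  component tangent to the curved factor.\<close>

definition horizontal :: "'n::finite ambient \<Rightarrow> 'n ambient" where
  "horizontal z = (fst z, 0)"

lemma bil_simps:
  "bil c (v + v') w = bil c v w + bil c v' w"
  "bil c v (w + w') = bil c v w + bil c v w'"
  "bil c (v - v') w = bil c v w - bil c v' w"
  "bil c v (w - w') = bil c v w - bil c v w'"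
  "bil c (r *\<^sub>R v) w = r * bil c v w"
  "bil c v (r *\<^sub>R w) = r * bil c v w"
  "bil c (- v) w = - bil c v w"
  "bil c v (- w) = - bil c v w"
  "bil c 0 w = 0"
  "bil c v 0 = 0"
  by (simp_all add: bil_def inner_simps algebra_simps)

lemma bil_commute: "bil c v w = bil c w v"
  by (simp add: bil_def inner_commute)

lemma bounded_bilinear_bil: "bounded_bilinear (bil c :: 'n::finite ambient \<Rightarrow> _)"
  unfolding bilinear_conv_bounded_bilinear[symmetric] bilinear_def
  by (intro conjI allI linearI) (simp_all add: bil_simps)

lemma bil_horizontal: "bil c (horizontal v) w = bil c v w - snd v * snd w"
  "bil c v (horizontal w) = bil c v w - snd v * snd w"
  by (simp_all add: bil_def horizontal_def)

lemma snd_horizontal [simp]: "snd (horizontal z) = 0"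
  by (simp add: horizontal_def)

lemma tan_proj_eq: "tan_proj c z v = v - (c * bil c (horizontal z) v) *\<^sub>R horizontal z"
  by (simp add: tan_proj_def horizontal_def)

lemma bounded_linear_horizontal: "bounded_linear (horizontal :: 'n::finite ambient \<Rightarrow> _)"
  unfolding horizontal_def
  by (intro bounded_linear_Pair bounded_linear_fst bounded_linear_zero)

lemma bil_d_dt: "bil c d_dt v = snd v" "bil c v d_dt = snd v"
  by (simp_all add: bil_def d_dt_def)

lemma QxR_bil: "z \<in> QxR c \<Longrightarrow> bil c (horizontal z) (horizontal z) = c"
  by (auto simp: QxR_def bil_def horizontal_def power2_eq_square)

text \<open>For \<open>c = -1\<close> this says that tangent vectors of the hyperboloid are
  spacelike. Orthogonality reads \<open>x \<bullet> v1 = s * v2\<close>, and Cauchy-Schwarz together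
  with \<open>x \<bullet> x = s\<^sup>2 - 1\<close> bounds the negative square by the positive
  one.\<close>

lemma bil_tangent_pos:
  fixes v :: "'n::finite ambient"
  assumes c: "c = 1 \<or> c = -1" and "z \<in> QxR c" "bil c (horizontal z) v = 0" "v \<noteq> 0"
  shows "bil c v v > 0"
  using c
proof
  assume "c = 1"
  then have "bil c v v = v \<bullet> v" by (simp add: bil_def inner_prod_def)
  then show ?thesis using assms(4) by simp
next
  assume c: "c = -1"
  obtain x s t where z: "z = ((x, s), t)" and xs: "x \<bullet> x - s\<^sup>2 = -1" and s: "s > 0"
    using assms(2) c by (auto simp: QxR_def)
  obtain v1 v2 v3 where v: "v = ((v1, v2), v3)" by (metis surj_pair)
  have e: "x \<bullet> v1 = s * v2" using assms(3) c by (simp add: z v bil_def horizontal_def)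
  have "(s * v2)\<^sup>2 \<le> (x \<bullet> x) * (v1 \<bullet> v1)"
    unfolding e[symmetric] by (simp add: Cauchy_Schwarz_ineq)
  also have "x \<bullet> x = s\<^sup>2 - 1" using xs by simp
  finally have 1: "s\<^sup>2 * v2\<^sup>2 \<le> s\<^sup>2 * (v1 \<bullet> v1) - v1 \<bullet> v1"
    by (simp add: power_mult_distrib algebra_simps)
  have b: "bil c v v = v1 \<bullet> v1 - v2\<^sup>2 + v3\<^sup>2" by (simp add: bil_def v c power2_eq_square)
  have s2: "s\<^sup>2 > 0" using s by simp
  show ?thesis
  proof (cases "v1 = 0")
    case True
    then have "v2 = 0" using e s by simp
    then show ?thesis using True assms(4) unfolding b by (simp add: v zero_prod_def)
  next
    case False
    then have "v1 \<bullet> v1 > 0" by simp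
    then have "s\<^sup>2 * v2\<^sup>2 < s\<^sup>2 * (v1 \<bullet> v1)" using 1 by linarith
    then have "v2\<^sup>2 < v1 \<bullet> v1" using s2 by simp
    then show ?thesis unfolding b by (smt (verit) zero_le_power2)
  qed
qed

lemma dd_bil:
  assumes "f differentiable (at u)" "g differentiable (at u)"
  shows "dd (\<lambda>u. bil c (f u) (g u)) u v = bil c (f u) (dd g u v) + bil c (dd f u v) (g u)"
  using assms
  by (subst dd_eq[OF bounded_bilinear.FDERIV[OF bounded_bilinear_bil]])
    (auto simp: frechet_derivative_works[symmetric])

lemma dd_eq_0:
  assumes "open S" "u \<in> S" "\<And>y. y \<in> S \<Longrightarrow> f y = k"
  shows "dd f u v = 0"
  using dd_cong[OF assms(1,2), of f "\<lambda>_. k"] assms(3) by simp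

lemma dd_add:
  "f differentiable (at u) \<Longrightarrow> g differentiable (at u) \<Longrightarrow> dd (\<lambda>u. f u + g u) u v = dd f u v + dd g u v"
  by (subst dd_eq[OF has_derivative_add]) (auto simp: frechet_derivative_works[symmetric])

lemma dd_scaleR:
  fixes f :: "_ \<Rightarrow> real"
  shows "f differentiable (at u) \<Longrightarrow> g differentiable (at u) \<Longrightarrow>
    dd (\<lambda>u. f u *\<^sub>R g u) u v = f u *\<^sub>R dd g u v + dd f u v *\<^sub>R g u"
  by (subst dd_eq[OF has_derivative_scaleR]) (auto simp: frechet_derivative_works[symmetric])

text \<open>Separates the second derivative with the direction frozen at \<open>u\<close>, which is
  symmetric, from the derivative of the field itself.\<close>

lemma dd_dd_field:
  fixes f :: "real ^ 'n \<Rightarrow> 'b::real_normed_vector"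
  assumes "open S" "smooth_on S f" "smooth_on S Z" "u \<in> S"
  shows "dd (\<lambda>y. dd f y (Z y)) u Y = dd (\<lambda>y. dd f y (Z u)) u Y + dd f u (dd Z u Y)"
proof -
  have expand: "dd f y W = (\<Sum>i\<in>UNIV. W $ i *\<^sub>R dd f y (axis i 1))" if "y \<in> S" for y W
  proof -
    have l: "linear (dd f y)" using smooth_on_linear_dd assms(2) that by blast
    have "dd f y W = dd f y (\<Sum>i\<in>UNIV. W $ i *\<^sub>R axis i 1)"
      by (simp add: basis_expansion scalar_mult_eq_scaleR[symmetric])
    then show ?thesis by (simp add: linear_sum[OF l] linear_scale[OF l])
  qed
  have dZ: "((\<lambda>y. Z y $ i) has_derivative (\<lambda>v. dd Z u v $ i)) (at u)" for i
    by (rule bounded_linear.has_derivative[OF bounded_linear_vec_nth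
          smooth_on_has_derivative[OF assms(3,4)]])
  have df: "((\<lambda>y. dd f y w) has_derivative dd (\<lambda>y. dd f y w) u) (at u)" for w
    by (rule smooth_on_has_derivative[OF smooth_on_dd[OF assms(2)] assms(4)])
  have 1: "dd (\<lambda>y. dd f y (Z y)) u Y =
      (\<Sum>i\<in>UNIV. Z u $ i *\<^sub>R dd (\<lambda>y. dd f y (axis i 1)) u Y + dd Z u Y $ i *\<^sub>R dd f u (axis i 1))"
    by (subst dd_cong[OF assms(1,4) expand], assumption,
        subst dd_eq[OF has_derivative_sum[OF has_derivative_scaleR[OF dZ df]]]) simp
  have 2: "dd (\<lambda>y. dd f y (Z u)) u Y = (\<Sum>i\<in>UNIV. Z u $ i *\<^sub>R dd (\<lambda>y. dd f y (axis i 1)) u Y)"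
    by (subst dd_cong[OF assms(1,4) expand], assumption,
        subst dd_eq[OF has_derivative_sum[OF has_derivative_scaleR_right[OF df]]]) simp
  show ?thesis
    unfolding 1 2 expand[OF assms(4), of "dd Z u Y"] by (simp add: sum.distrib)
qed

lemma dd_commutator:
  fixes f :: "real ^ 'n \<Rightarrow> 'b::euclidean_space"
  assumes "open S" "smooth_on S f" "smooth_on S U" "smooth_on S V" "u \<in> S"
  shows "dd (\<lambda>y. dd f y (V y)) u (U u) - dd (\<lambda>y. dd f y (U y)) u (V u) =
    dd f u (dd V u (U u) - dd U u (V u))"
  unfolding dd_dd_field[OF assms(1,2,3,5)] dd_dd_field[OF assms(1,2,4,5)]
    dd_dd_commute[OF assms(1,2,5), of "V u"]
  by (simp add: linear_diff[OF smooth_on_linear_dd[OF assms(2,5)]])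

text \<open>The hypersurface pulled back by one parametrization: \<open>F\<close> and
  \<open>N\<close> are the immersion and its unit normal, and tangent vectors at \<open>u\<close>
  become elements of \<open>real ^ 'n\<close> through \<open>dd F u\<close>.\<close>

locale hypersurface_chart =
  fixes c :: real and D :: "(real ^ 'n::finite) set" and F N :: "real ^ 'n \<Rightarrow> 'n ambient"
  assumes c: "c = 1 \<or> c = -1"
    and open_D: "open D"
    and smooth_F: "smooth_on D F" and smooth_N: "smooth_on D N"
    and F_QxR: "u \<in> D \<Longrightarrow> F u \<in> QxR c"
    and inj_dF: "u \<in> D \<Longrightarrow> inj (dd F u)"
    and x_N: "u \<in> D \<Longrightarrow> bil c (horizontal (F u)) (N u) = 0"
    and N_N: "u \<in> D \<Longrightarrow> bil c (N u) (N u) = 1"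
    and dF_N: "u \<in> D \<Longrightarrow> bil c (dd F u X) (N u) = 0"
begin

lemma subchart: "open S \<Longrightarrow> S \<subseteq> D \<Longrightarrow> hypersurface_chart c S F N"
  using c smooth_on_subset[OF smooth_F] smooth_on_subset[OF smooth_N] F_QxR inj_dF x_N N_N dF_N
  by unfold_locales auto

lemma c_c: "c * c = 1" "c * (c * r) = r"
  using c by auto

lemmas smooth_intros = smooth_on_const smooth_on_add[OF open_D] smooth_on_diff[OF open_D]
  smooth_on_minus[OF open_D] smooth_on_mult[OF open_D] smooth_on_scaleR[OF open_D]
  smooth_on_bilinear[OF open_D bounded_bilinear_bil]
  smooth_on_bounded_linear[OF open_D bounded_linear_horizontal]
  smooth_on_bounded_linear[OF open_D bounded_linear_snd]
  smooth_on_dd_field[OF open_D] smooth_F smooth_N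

lemmas diff_F = smooth_on_differentiable[OF smooth_F]
lemmas diff_N = smooth_on_differentiable[OF smooth_N]
lemmas linear_dF = smooth_on_linear_dd[OF smooth_F]
lemmas linear_dN = smooth_on_linear_dd[OF smooth_N]
lemmas dF_simps = linear_add[OF linear_dF] linear_diff[OF linear_dF] linear_scale[OF linear_dF]
  linear_0[OF linear_dF] linear_neg[OF linear_dF]
lemmas dN_simps = linear_add[OF linear_dN] linear_diff[OF linear_dN] linear_scale[OF linear_dN]

definition "\<nu> u = snd (N u)"
definition "dh u X = snd (dd F u X)"
definition "G u X Y = bil c (dd F u X) (dd F u Y)"

lemma N_x: "u \<in> D \<Longrightarrow> bil c (N u) (horizontal (F u)) = 0"
  and N_dF: "u \<in> D \<Longrightarrow> bil c (N u) (dd F u X) = 0"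
  using x_N dF_N by (simp_all add: bil_commute)

lemma x_x: "u \<in> D \<Longrightarrow> bil c (horizontal (F u)) (horizontal (F u)) = c"
  using QxR_bil[OF F_QxR] .

lemma dd_x: "u \<in> D \<Longrightarrow> dd (\<lambda>u. horizontal (F u)) u v = horizontal (dd F u v)"
  by (rule dd_bounded_linear[OF bounded_linear_horizontal diff_F])

lemma diff_x: "u \<in> D \<Longrightarrow> (\<lambda>u. horizontal (F u)) differentiable (at u)"
  by (rule smooth_on_differentiable[of D]) (intro smooth_intros)

lemma x_dF: assumes u: "u \<in> D" shows "bil c (horizontal (F u)) (dd F u X) = 0"
  using dd_eq_0[OF open_D u, of "\<lambda>u. bil c (horizontal (F u)) (horizontal (F u))" c X]
    dd_bil[OF diff_x[OF u] diff_x[OF u], of c X]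
  by (simp add: x_x u dd_x) (simp add: bil_def horizontal_def inner_commute)

lemma dF_x: "u \<in> D \<Longrightarrow> bil c (dd F u X) (horizontal (F u)) = 0"
  using x_dF by (simp add: bil_commute)

lemma N_dN: assumes u: "u \<in> D" shows "bil c (N u) (dd N u X) = 0"
  using dd_eq_0[OF open_D u, of "\<lambda>u. bil c (N u) (N u)" 1 X]
    dd_bil[OF diff_N[OF u] diff_N[OF u], of c X]
  by (simp add: N_N bil_commute[of c "dd N u X"])

lemma x_dN: assumes u: "u \<in> D" shows "bil c (horizontal (F u)) (dd N u X) = \<nu> u * dh u X"
  using dd_eq_0[OF open_D u, of "\<lambda>u. bil c (horizontal (F u)) (N u)" 0 X]
    dd_bil[OF diff_x[OF u] diff_N[OF u], of c X]
  by (simp add: x_N u dd_x bil_horizontal(1)[of c "dd F u X"] dF_N \<nu>_def dh_def)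

lemma inner_form_G: assumes u: "u \<in> D" shows "inner_form (G u)"
proof
  show "bilinear (G u)"
    unfolding bilinear_def
    by (intro conjI allI linearI) (simp_all add: G_def dF_simps[OF u] bil_simps)
  show "G u X Y = G u Y X" for X Y by (simp add: G_def bil_commute)
  show "0 < G u X X" if "X \<noteq> 0" for X
  proof -
    have "dd F u X \<noteq> 0"
      using that inj_dF[OF u] dF_simps(4)[OF u] by (metis injD)
    then show ?thesis
      unfolding G_def using bil_tangent_pos[OF c F_QxR[OF u] x_dF[OF u]] by blast
  qed
qed

text \<open>A dimension count. The type \<open>'n ambient\<close> is reused as coefficient space for
  tangent directions, the position normal and \<open>N u\<close>; the resulting linear endomorphism
  is injective, hence surjective.\<close>

lemma tangent_vector_is_dF:
  assumes u: "u \<in> D" and "bil c (horizontal (F u)) w = 0" "bil c (N u) w = 0"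
  shows "\<exists>X. dd F u X = w"
proof -
  define \<Phi> :: "'n ambient \<Rightarrow> 'n ambient"
    where "\<Phi> v = dd F u (fst (fst v)) + snd (fst v) *\<^sub>R horizontal (F u) + snd v *\<^sub>R N u" for v
  have lin: "linear \<Phi>"
    using u by (intro linearI) (auto simp: \<Phi>_def dF_simps algebra_simps)
  have coef: "bil c (horizontal (F u)) (\<Phi> v) = snd (fst v) * c" "bil c (N u) (\<Phi> v) = snd v" for v
    by (simp_all add: \<Phi>_def bil_simps x_x[OF u] x_N[OF u] N_N[OF u] x_dF[OF u] N_x[OF u] N_dF[OF u])
  have cnz: "c \<noteq> 0" using c by auto
  have "v = 0" if "\<Phi> v = 0" for v
  proof -
    have "snd (fst v) = 0" "snd v = 0" using coef[of v] that cnz by (simp_all add: bil_simps)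
    moreover from this have "dd F u (fst (fst v)) = dd F u 0"
      using that by (simp add: \<Phi>_def dF_simps(4)[OF u])
    ultimately show ?thesis using injD[OF inj_dF[OF u]] by (simp add: prod_eq_iff)
  qed
  then have "inj \<Phi>" using linear_injective_0[OF lin] by blast
  then have "surj \<Phi>" using linear_injective_imp_surjective[OF lin] by blast
  then obtain v where v: "w = \<Phi> v" by blast
  then have "snd (fst v) = 0" "snd v = 0" using coef[of v] assms cnz by simp_all
  then show ?thesis using v by (auto simp: \<Phi>_def)
qed

definition "lift u w = (THE X. dd F u X = w)"

lemma lift_dF: "u \<in> D \<Longrightarrow> lift u (dd F u X) = X"
  unfolding lift_def using injD[OF inj_dF] by blast

lemma dF_lift:
  "u \<in> D \<Longrightarrow> bil c (horizontal (F u)) w = 0 \<Longrightarrow> bil c (N u) w = 0 \<Longrightarrow> dd F u (lift u w) = w"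
  using tangent_vector_is_dF lift_dF by metis

text \<open>The coordinates of the lift solve a linear system with the Gram matrix \<open>g\<close>
  of the induced metric. Cramer's rule writes them as quotients of determinants with smooth
  entries.\<close>

lemma smooth_lift:
  assumes W: "smooth_on D W"
    and tan: "\<And>u. u \<in> D \<Longrightarrow> bil c (horizontal (F u)) (W u) = 0" "\<And>u. u \<in> D \<Longrightarrow> bil c (N u) (W u) = 0"
  shows "smooth_on D (\<lambda>u. lift u (W u))"
proof -
  define g where "g u = (\<chi> i j. G u (axis i 1) (axis j 1))" for u
  define b where "b u = (\<chi> i. bil c (dd F u (axis i 1)) (W u))" for u
  have g_mult: "g u *v X = (\<chi> i. G u (axis i 1) X)" if u: "u \<in> D" for u X
  proof -
    interpret inner_form "G u" by (rule inner_form_G[OF u])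
    have "(g u *v X) $ i = G u (axis i 1) X" for i
    proof -
      have "G u (axis i 1) X = G u (axis i 1) (\<Sum>j\<in>UNIV. X $ j *\<^sub>R axis j 1)"
        by (simp add: basis_expansion scalar_mult_eq_scaleR[symmetric])
      also have "\<dots> = (\<Sum>j\<in>UNIV. X $ j * G u (axis i 1) (axis j 1))"
        using bilinear_G by (subst linear_sum) (simp_all add: bilinear_def G_simps)
      finally show ?thesis by (simp add: matrix_vector_mult_def g_def mult.commute)
    qed
    then show ?thesis by (simp add: vec_eq_iff)
  qed
  have det: "det (g u) \<noteq> 0" if u: "u \<in> D" for u
  proof -
    interpret inner_form "G u" by (rule inner_form_G[OF u])
    have "X = 0" if "g u *v X = 0" for X
    proof -
      have i: "G u (axis i 1) X = 0" for i
        using that unfolding g_mult[OF u] by (simp add: vec_eq_iff)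
      have "G u (\<Sum>j\<in>UNIV. X $ j *\<^sub>R axis j 1) X = (\<Sum>j\<in>UNIV. X $ j * G u (axis j 1) X)"
        using bilinear_G by (subst linear_sum[of "\<lambda>Y. G u Y X"]) (simp_all add: bilinear_def G_simps)
      then have "G u X X = 0"
        by (simp add: basis_expansion scalar_mult_eq_scaleR[symmetric] i)
      then show "X = 0" by (simp add: G_eq_0_iff)
    qed
    then have "invertible (g u)"
      using matrix_left_invertible_ker invertible_left_inverse by blast
    then show ?thesis by (simp add: invertible_det_nz)
  qed
  have sol: "g u *v lift u (W u) = b u" if u: "u \<in> D" for u
    unfolding g_mult[OF u] by (simp add: b_def G_def dF_lift u tan)
  have sg: "smooth_on D (\<lambda>u. g u $ i $ j)" for i j
    unfolding g_def G_def by simp (intro smooth_intros)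
  have sb: "smooth_on D (\<lambda>u. b u $ i)" for i
    unfolding b_def by simp (intro smooth_intros W)
  have sif: "smooth_on D (\<lambda>u. if j = k then b u $ i else g u $ i $ j)" for i j k
    by (cases "j = k") (simp_all add: sg sb)
  have sm: "smooth_on D (\<lambda>u. \<chi> k. det (\<chi> i j. if j = k then b u $ i else g u $ i $ j) * inverse (det (g u)))"
  proof (rule smooth_on_vec[OF open_D])
    fix k
    have "smooth_on D (\<lambda>u. det (\<chi> i j. if j = k then b u $ i else g u $ i $ j) * inverse (det (g u)))"
      by (intro smooth_intros smooth_on_det[OF open_D] smooth_on_inverse[OF open_D] det sg)
        (simp add: sif)
    then show "smooth_on D (\<lambda>u. (\<chi> k. det (\<chi> i j. if j = k then b u $ i else g u $ i $ j)
        * inverse (det (g u))) $ k)" by simp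
  qed
  show ?thesis
    by (rule smooth_on_cong[OF open_D _ sm]) (use cramer[OF det] sol in \<open>simp add: divide_inverse\<close>)
qed

definition "A u X = lift u (- tan_proj c (F u) (dd N u X))"
definition "T u = lift u (d_dt - \<nu> u *\<^sub>R N u)"

lemma tan_proj_dN:
  "u \<in> D \<Longrightarrow> - tan_proj c (F u) (dd N u X) = (c * \<nu> u * dh u X) *\<^sub>R horizontal (F u) - dd N u X"
  by (simp add: tan_proj_eq x_dN)

lemma dF_A:
  assumes u: "u \<in> D"
  shows "dd F u (A u X) = (c * \<nu> u * dh u X) *\<^sub>R horizontal (F u) - dd N u X"
  unfolding A_def tan_proj_dN[OF u] using c
  by (intro dF_lift[OF u])
    (auto simp: bil_simps x_x u x_dN N_dN N_x c_c)

lemma dF_T: "u \<in> D \<Longrightarrow> dd F u (T u) = d_dt - \<nu> u *\<^sub>R N u"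
  unfolding T_def
  by (intro dF_lift) (auto simp: bil_simps bil_d_dt x_N N_N \<nu>_def)

lemma smooth_\<nu>: "smooth_on D \<nu>"
  unfolding \<nu>_def by (intro smooth_intros)

lemma smooth_G: "smooth_on D X \<Longrightarrow> smooth_on D Y \<Longrightarrow> smooth_on D (\<lambda>u. G u (X u) (Y u))"
  unfolding G_def by (intro smooth_intros)

lemma smooth_T: "smooth_on D T"
  unfolding T_def
  by (intro smooth_lift smooth_intros smooth_\<nu>) (auto simp: bil_simps bil_d_dt x_N N_N \<nu>_def)

lemma smooth_A: assumes "smooth_on D X" shows "smooth_on D (\<lambda>u. A u (X u))"
proof (rule smooth_on_cong[OF open_D])
  show "smooth_on D (\<lambda>u. lift u ((c * \<nu> u * dh u (X u)) *\<^sub>R horizontal (F u) - dd N u (X u)))"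
    unfolding dh_def
    by (intro smooth_lift smooth_intros smooth_\<nu> assms)
      (auto simp: bil_simps x_x x_dN N_dN N_x algebra_simps c_c dh_def)
qed (simp add: A_def tan_proj_dN)

lemma A_unique: "u \<in> D \<Longrightarrow> dd F u Y = - tan_proj c (F u) (dd N u X) \<Longrightarrow> A u X = Y"
  unfolding A_def using lift_dF by metis

lemma dh_add: "u \<in> D \<Longrightarrow> dh u (X + Y) = dh u X + dh u Y"
  and dh_scale: "u \<in> D \<Longrightarrow> dh u (r *\<^sub>R X) = r * dh u X"
  and dh_diff: "u \<in> D \<Longrightarrow> dh u (X - Y) = dh u X - dh u Y"
  by (simp_all add: dh_def dF_simps)

lemma linear_A: assumes u: "u \<in> D" shows "linear (A u)"
proof -
  have i: "X = Y" if "dd F u X = dd F u Y" for X Y using injD[OF inj_dF[OF u] that] .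
  show ?thesis
    by (rule linearI; rule i)
      (simp_all add: dF_simps[OF u] dF_A[OF u] dN_simps[OF u] dh_add[OF u] dh_scale[OF u] algebra_simps)
qed

lemma G_T: "u \<in> D \<Longrightarrow> G u X (T u) = dh u X" "u \<in> D \<Longrightarrow> G u (T u) X = dh u X"
  by (simp_all add: G_def dF_T bil_simps bil_d_dt dF_N N_dF dh_def)

lemma dh_T: "u \<in> D \<Longrightarrow> dh u (T u) = 1 - (\<nu> u)\<^sup>2"
  by (simp add: dh_def dF_T d_dt_def \<nu>_def power2_eq_square)

lemma G_A_dN: "u \<in> D \<Longrightarrow> G u (A u X) Y = - bil c (dd N u X) (dd F u Y)"
  by (simp add: G_def dF_A bil_simps x_dF)

text \<open>Differentiating the orthogonality of \<open>dd F u Y\<close> and \<open>N u\<close>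
  along \<open>X\<close> expresses the left side by a second derivative of \<open>F\<close>, which
  is symmetric. This is the self-adjointness of \<open>A\<close>.\<close>

lemma dN_dF_commute: assumes u: "u \<in> D"
  shows "bil c (dd N u X) (dd F u Y) = bil c (dd N u Y) (dd F u X)"
proof -
  have "bil c (dd F u Y) (dd N u X) + bil c (dd (\<lambda>u. dd F u Y) u X) (N u) = 0" for X Y
    using dd_eq_0[OF open_D u, of "\<lambda>u. bil c (dd F u Y) (N u)" 0 X, OF dF_N]
      dd_bil[OF smooth_on_differentiable[OF smooth_on_dd[OF smooth_F] u] diff_N[OF u], of c Y X]
    by simp
  from this[of Y X] this[of X Y] show ?thesis
    using dd_dd_commute[OF open_D smooth_F u, of X Y] by (simp add: bil_commute)
qed

lemma self_adjoint_A: assumes u: "u \<in> D" shows "self_adjoint_form (G u) (A u)"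
proof -
  interpret inner_form "G u" by (rule inner_form_G[OF u])
  show ?thesis
    by (intro self_adjoint_form.intro self_adjoint_form_axioms.intro inner_form_axioms linear_A u)
      (metis G_A_dN[OF u] G_commute dN_dF_commute[OF u])
qed

lemma d\<nu>: "u \<in> D \<Longrightarrow> dd \<nu> u X = - dh u (A u X)"
  unfolding \<nu>_def using dd_bounded_linear[OF bounded_linear_snd diff_N, of u X]
  by (simp add: dh_def dF_A)

end

section \<open>The Codazzi equation along eigenfields\<close>

context hypersurface_chart
begin

text \<open>\<open>cov u Y Z W\<close> is the inner product of the covariant derivative of the field \<open>Z\<close> in the direction
  \<open>Y\<close> with \<open>W\<close>, and \<open>b u Y X Z\<close> is the inner product of \<open>(\<nabla>\<^sub>Y A) X\<close> with \<open>Z\<close>, expressed through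
  the flat second derivatives.\<close>

definition "cov u Y Z W = bil c (dd (\<lambda>u. dd F u (Z u)) u Y) (dd F u W)"

definition "b u Y X Z =
  - bil c (dd (\<lambda>u. dd N u X) u Y) (dd F u Z) + bil c (dd N u Z) (dd (\<lambda>u. dd F u X) u Y)
  + c * \<nu> u * dh u X * (G u Y Z - dh u Y * dh u Z)
  + c * \<nu> u * dh u Z * (G u Y X - dh u Y * dh u X)"

text \<open>The terms with second derivatives of \<open>F\<close> and \<open>N\<close>, and the last
  term of \<open>b\<close>, are symmetric in \<open>X\<close> and \<open>Y\<close>. The remainder on
  the right is the curvature of the ambient product.\<close>

lemma codazzi:
  assumes u: "u \<in> D"
  shows "b u Y X Z - b u X Y Z = c * \<nu> u * (dh u X * G u Y Z - dh u Y * G u X Z)"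
  unfolding b_def
  using dd_dd_commute[OF open_D smooth_F u, of X Y] dd_dd_commute[OF open_D smooth_N u, of X Y]
  by (simp add: inner_form.G_commute[OF inner_form_G[OF u], of Y X] algebra_simps)

lemma b_commute:
  assumes u: "u \<in> D"
  shows "b u Y X Z = b u Y Z X"
proof -
  have dN: "(\<lambda>u. dd N u X) differentiable (at u)" and dF: "(\<lambda>u. dd F u X) differentiable (at u)" for X
    using smooth_on_differentiable[OF smooth_on_dd u] smooth_N smooth_F by blast+
  have "dd (\<lambda>u. bil c (dd N u X) (dd F u Z)) u Y = dd (\<lambda>u. bil c (dd N u Z) (dd F u X)) u Y"
    by (rule fun_cong[OF dd_cong[OF open_D u]]) (rule dN_dF_commute)
  then show ?thesis
    unfolding dd_bil[OF dN dF] b_def by (simp add: bil_commute algebra_simps)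
qed

lemma cov_cong:
  assumes "u \<in> D" "\<And>y. y \<in> D \<Longrightarrow> Z y = Z' y"
  shows "cov u Y Z W = cov u Y Z' W"
proof -
  have "dd (\<lambda>u. dd F u (Z u)) u = dd (\<lambda>u. dd F u (Z' u)) u"
    by (rule dd_cong[OF open_D assms(1)]) (simp add: assms(2))
  then show ?thesis by (simp add: cov_def)
qed

lemma cov_add_field:
  assumes u: "u \<in> D" and "smooth_on D Z" "smooth_on D Z'"
  shows "cov u Y (\<lambda>u. Z u + Z' u) W = cov u Y Z W + cov u Y Z' W"
proof -
  have d: "(\<lambda>u. dd F u (Z u)) differentiable (at u)" if "smooth_on D Z" for Z
    by (rule smooth_on_differentiable[OF _ u]) (intro smooth_intros that)
  have "dd (\<lambda>u. dd F u (Z u + Z' u)) u = dd (\<lambda>u. dd F u (Z u) + dd F u (Z' u)) u"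
    by (rule dd_cong[OF open_D u]) (rule dF_simps(1))
  then show ?thesis
    unfolding cov_def by (simp add: dd_add[OF d d] assms bil_simps)
qed

lemma cov_right: "u \<in> D \<Longrightarrow> cov u Y Z (r *\<^sub>R W) = r * cov u Y Z W"
  "u \<in> D \<Longrightarrow> cov u Y Z (W - W') = cov u Y Z W - cov u Y Z W'"
  by (simp_all add: cov_def dF_simps bil_simps)

lemma dd_G:
  assumes u: "u \<in> D" and "smooth_on D X" "smooth_on D Z"
  shows "dd (\<lambda>u. G u (X u) (Z u)) u Y = cov u Y X (Z u) + cov u Y Z (X u)"
proof -
  have d: "(\<lambda>u. dd F u (Z u)) differentiable (at u)" if "smooth_on D Z" for Z
    by (rule smooth_on_differentiable[OF _ u]) (intro smooth_intros that)
  show ?thesis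
    unfolding G_def cov_def dd_bil[OF d[OF assms(2)] d[OF assms(3)]] by (simp add: bil_commute)
qed

lemma cov_T:
  assumes u: "u \<in> D"
  shows "cov u Y T W = \<nu> u * G u (A u Y) W"
proof -
  have "dd (\<lambda>u. dd F u (T u)) u Y = dd (\<lambda>u. d_dt + (- \<nu> u) *\<^sub>R N u) u Y"
    by (rule fun_cong[OF dd_cong[OF open_D u]]) (simp add: dF_T)
  also have "\<dots> = dd (\<lambda>u. (- \<nu> u) *\<^sub>R N u) u Y"
    by (subst dd_add)
      (auto intro!: smooth_on_differentiable[OF _ u] smooth_intros smooth_\<nu>
        simp: scaleR_minus_left[symmetric] simp del: scaleR_minus_left)
  also have "\<dots> = (- \<nu> u) *\<^sub>R dd N u Y + dd (\<lambda>u. - \<nu> u) u Y *\<^sub>R N u"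
    by (rule dd_scaleR; rule smooth_on_differentiable[OF _ u]; intro smooth_intros smooth_\<nu>)
  finally show ?thesis
    by (simp add: cov_def G_A_dN[OF u] bil_simps N_dF[OF u])
qed

lemma commutator:
  assumes u: "u \<in> D" and "smooth_on D U" "smooth_on D V"
  shows "G u (dd V u (U u) - dd U u (V u)) W = cov u (U u) V W - cov u (V u) U W"
  unfolding cov_def G_def dd_commutator[OF open_D smooth_F assms(2,3) u, symmetric]
  by (simp add: bil_simps)

text \<open>For an eigenfield, \<open>(\<nabla>\<^sub>Y A) Z = (l - A) \<nabla>\<^sub>Y Z\<close>;
  self-adjointness moves \<open>l - A\<close> onto \<open>W\<close>.\<close>

lemma eigenfield:
  assumes u: "u \<in> D" and Z: "smooth_on D Z" and eig: "\<And>y. y \<in> D \<Longrightarrow> A y (Z y) = l *\<^sub>R Z y"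
  shows "b u Y (Z u) W = cov u Y Z (l *\<^sub>R W - A u W)"
proof -
  define s where "s y = c * \<nu> y * dh y (Z y)" for y
  have ss: "smooth_on D s" unfolding s_def dh_def by (intro smooth_intros smooth_\<nu> Z)
  \<comment> \<open>Second derivatives of \<open>F\<close> leave the tangent space of
    \<open>QxR c\<close>; this is their component along the position normal, obtained from
    \<open>x_dF\<close> by the product rule.\<close>
  have dx: "bil c (horizontal (F u)) (dd (\<lambda>y. dd F y (Z y)) u Y) = dh u Y * dh u (Z u) - G u Y (Z u)"
  proof -
    have "dd (\<lambda>y. bil c (horizontal (F y)) (dd F y (Z y))) u Y = 0"
      by (rule dd_eq_0[OF open_D u]) (rule x_dF)
    moreover have "dd (\<lambda>y. bil c (horizontal (F y)) (dd F y (Z y))) u Y =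
       bil c (horizontal (F u)) (dd (\<lambda>y. dd F y (Z y)) u Y) + bil c (horizontal (dd F u Y)) (dd F u (Z u))"
      unfolding dd_x[OF u, symmetric]
      by (intro dd_bil diff_x[OF u] smooth_on_differentiable[OF _ u] smooth_intros Z)
    ultimately show ?thesis by (simp add: bil_horizontal G_def dh_def)
  qed
  \<comment> \<open>The eigenvalue equation in flat space, with \<open>s\<close> the coefficient
    that \<open>tan_proj\<close> removes from the derivative of \<open>N\<close>; it is
    differentiated along \<open>Y\<close>.\<close>
  have "dd (\<lambda>y. dd N y (Z y)) u Y = dd (\<lambda>y. s y *\<^sub>R horizontal (F y) + (- l) *\<^sub>R dd F y (Z y)) u Y"
  proof (rule fun_cong[OF dd_cong[OF open_D u]])
    fix y assume y: "y \<in> D"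
    show "dd N y (Z y) = s y *\<^sub>R horizontal (F y) + (- l) *\<^sub>R dd F y (Z y)"
      using dF_A[OF y, of "Z y"] by (simp add: eig[OF y] dF_simps[OF y] s_def algebra_simps)
  qed
  also have "\<dots> = dd (\<lambda>y. s y *\<^sub>R horizontal (F y)) u Y + dd (\<lambda>y. (- l) *\<^sub>R dd F y (Z y)) u Y"
    by (intro dd_add smooth_on_differentiable[OF _ u] smooth_intros Z ss)
  also have "dd (\<lambda>y. (- l) *\<^sub>R dd F y (Z y)) u Y = (- l) *\<^sub>R dd (\<lambda>y. dd F y (Z y)) u Y"
    by (intro dd_bounded_linear bounded_linear_scaleR_right smooth_on_differentiable[OF _ u]
        smooth_intros Z)
  also have "dd (\<lambda>y. s y *\<^sub>R horizontal (F y)) u Y =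
      s u *\<^sub>R horizontal (dd F u Y) + dd s u Y *\<^sub>R horizontal (F u)"
    unfolding dd_x[OF u, symmetric]
    by (intro dd_scaleR smooth_on_differentiable[OF ss u] diff_x u)
  finally have "bil c (dd (\<lambda>y. dd N y (Z y)) u Y) (dd F u W) =
      s u * (G u Y W - dh u Y * dh u W) - l * cov u Y Z W"
    by (simp add: bil_simps x_dF[OF u] bil_horizontal(1)[of c "dd F u Y"] G_def dh_def cov_def)
  then have 1: "bil c (dd (\<lambda>y. dd N y (Z u)) u Y) (dd F u W) + bil c (dd N u (dd Z u Y)) (dd F u W) =
      s u * (G u Y W - dh u Y * dh u W) - l * cov u Y Z W"
    unfolding dd_dd_field[OF open_D smooth_N Z u] by (simp add: bil_simps)
  have "cov u Y Z (A u W) = bil c (dd (\<lambda>y. dd F y (Z y)) u Y)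
      ((c * \<nu> u * dh u W) *\<^sub>R horizontal (F u) - dd N u W)"
    unfolding cov_def dF_A[OF u] ..
  also have "\<dots> = c * \<nu> u * dh u W * (dh u Y * dh u (Z u) - G u Y (Z u))
      - bil c (dd N u W) (dd (\<lambda>y. dd F y (Z y)) u Y)"
    using dx by (simp add: bil_simps bil_commute)
  also have "bil c (dd N u W) (dd (\<lambda>y. dd F y (Z y)) u Y) =
      bil c (dd N u W) (dd (\<lambda>y. dd F y (Z u)) u Y) + bil c (dd N u (dd Z u Y)) (dd F u W)"
    unfolding dd_dd_field[OF open_D smooth_F Z u]
    by (simp add: bil_simps dN_dF_commute[OF u, of W])
  finally show ?thesis
    using 1 unfolding cov_right[OF u] b_def s_def by (simp add: algebra_simps)
qed

lemma eigenfield_diagonal: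
  assumes "u \<in> D" "smooth_on D Z" "\<And>y. y \<in> D \<Longrightarrow> A y (Z y) = l *\<^sub>R Z y" "A u W = l *\<^sub>R W"
  shows "b u Y (Z u) W = 0"
  using eigenfield[OF assms(1-3), of Y W] assms(1,4)
  by (simp add: cov_def dF_simps bil_simps)

text \<open>Between different eigenspaces the Codazzi equation thus becomes a formula for the
  connection.\<close>

lemma eigenfield_off_diagonal:
  assumes "u \<in> D" "smooth_on D Z" "\<And>y. y \<in> D \<Longrightarrow> A y (Z y) = l *\<^sub>R Z y" "A u W = m *\<^sub>R W"
  shows "b u Y (Z u) W = (l - m) * cov u Y Z W"
  using eigenfield[OF assms(1-3), of Y W] assms(4) cov_right[OF assms(1)] 
  by (simp add: algebra_simps)

lemma eigenvectors_orthogonal: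
  assumes "u \<in> D" "A u X = l *\<^sub>R X" "A u Y = m *\<^sub>R Y" "l \<noteq> m"
  shows "G u X Y = 0"
proof -
  interpret self_adjoint_form "G u" "A u" by (rule self_adjoint_A[OF assms(1)])
  show ?thesis using G_A[of X Y] assms by (simp add: G_simps)
qed

end

section \<open>Components of \<open>T\<close> in two eigenspaces\<close>

locale two_component_chart = hypersurface_chart c D F N
  for c and D :: "(real ^ 'n::finite) set" and F N :: "real ^ 'n \<Rightarrow> 'n ambient" +
  fixes U V :: "real ^ 'n \<Rightarrow> real ^ 'n" and \<alpha> \<beta> :: real
  assumes smooth_U: "smooth_on D U" and smooth_V: "smooth_on D V"
    and T_UV: "u \<in> D \<Longrightarrow> T u = U u + V u"
    and A_U: "u \<in> D \<Longrightarrow> A u (U u) = \<alpha> *\<^sub>R U u"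
    and A_V: "u \<in> D \<Longrightarrow> A u (V u) = \<beta> *\<^sub>R V u"
    and \<alpha>_\<beta>: "\<alpha> \<noteq> \<beta>"
begin

definition "p u = G u (U u) (U u)"
definition "q u = G u (V u) (V u)"

lemma smooth_pq: "smooth_on D p" "smooth_on D q"
  unfolding p_def q_def by (intro smooth_G smooth_U smooth_V)+

lemma G_UV: "u \<in> D \<Longrightarrow> G u (U u) (V u) = 0" "u \<in> D \<Longrightarrow> G u (V u) (U u) = 0"
  using eigenvectors_orthogonal[OF _ A_U A_V \<alpha>_\<beta>] eigenvectors_orthogonal[OF _ A_V A_U \<alpha>_\<beta>[symmetric]]
  by auto

lemma dh_UV: assumes u: "u \<in> D" shows "dh u (U u) = p u" "dh u (V u) = q u"
proof -
  interpret inner_form "G u" by (rule inner_form_G[OF u])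
  show "dh u (U u) = p u" "dh u (V u) = q u"
    unfolding G_T(1)[OF u, symmetric] T_UV[OF u] p_def q_def by (simp_all add: G_simps G_UV[OF u])
qed

lemma pq_\<nu>: "u \<in> D \<Longrightarrow> p u + q u = 1 - (\<nu> u)\<^sup>2"
  using dh_T[of u] by (simp add: T_UV dh_add dh_UV)

text \<open>Codazzi for the pair \<open>U\<close>, \<open>V\<close> gives the mixed components,
  because \<open>b u (V u) (U u) (U u) = 0\<close>. The other two follow from
  \<open>T = U + V\<close> and \<open>\<nabla>\<^sub>U T = \<nu> A U\<close>.\<close>

lemma cov_U_U:
  assumes u: "u \<in> D"
  shows "cov u (U u) U (V u) = c * \<nu> u * p u * q u / (\<alpha> - \<beta>)"
    "cov u (U u) V (U u) = - c * \<nu> u * p u * q u / (\<alpha> - \<beta>)"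
    "cov u (U u) U (U u) = \<nu> u * \<alpha> * p u + c * \<nu> u * p u * q u / (\<alpha> - \<beta>)"
    "cov u (U u) V (V u) = - c * \<nu> u * p u * q u / (\<alpha> - \<beta>)"
proof -
  interpret inner_form "G u" by (rule inner_form_G[OF u])
  have "b u (U u) (V u) (U u) = c * \<nu> u * p u * q u"
    using codazzi[OF u, of "U u" "V u" "U u"]
      eigenfield_diagonal[OF u smooth_U A_U A_U[OF u], of "V u"]
    by (simp add: dh_UV[OF u] p_def[symmetric] G_UV[OF u])
  moreover from this have "b u (U u) (U u) (V u) = c * \<nu> u * p u * q u"
    using b_commute[OF u] by simp
  ultimately show 1: "cov u (U u) U (V u) = c * \<nu> u * p u * q u / (\<alpha> - \<beta>)"
    and 2: "cov u (U u) V (U u) = - c * \<nu> u * p u * q u / (\<alpha> - \<beta>)"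
    using eigenfield_off_diagonal[OF u smooth_U A_U A_V[OF u], of "U u"]
      eigenfield_off_diagonal[OF u smooth_V A_V A_U[OF u], of "U u"] \<alpha>_\<beta>
    by (simp_all add: field_simps)
  have "cov u (U u) U W + cov u (U u) V W = \<nu> u * \<alpha> * G u (U u) W" for W
    using cov_T[OF u, of "U u" W] cov_cong[OF u, of T "\<lambda>y. U y + V y" "U u" W, OF T_UV]
      cov_add_field[OF u smooth_U smooth_V, where Y = "U u" and W = W]
    by (simp add: A_U[OF u] G_simps)
  from this[of "U u"] this[of "V u"]
  show "cov u (U u) U (U u) = \<nu> u * \<alpha> * p u + c * \<nu> u * p u * q u / (\<alpha> - \<beta>)"
    "cov u (U u) V (V u) = - c * \<nu> u * p u * q u / (\<alpha> - \<beta>)"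
    by (simp_all add: 1 2 p_def G_UV[OF u])
qed

lemma dU_pq:
  assumes u: "u \<in> D"
  shows "dd p u (U u) = 2 * \<nu> u * p u * (\<alpha> + c * q u / (\<alpha> - \<beta>))"
    "dd q u (U u) = - 2 * c * \<nu> u * p u * q u / (\<alpha> - \<beta>)"
proof -
  have "dd p u (U u) = 2 * cov u (U u) U (U u)" "dd q u (U u) = 2 * cov u (U u) V (V u)"
    using dd_G[OF u smooth_U smooth_U, of "U u"] dd_G[OF u smooth_V smooth_V, of "U u"]
    by (simp_all add: p_def[abs_def] q_def[abs_def])
  then show "dd p u (U u) = 2 * \<nu> u * p u * (\<alpha> + c * q u / (\<alpha> - \<beta>))"
    "dd q u (U u) = - 2 * c * \<nu> u * p u * q u / (\<alpha> - \<beta>)"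
    unfolding cov_U_U[OF u] by (simp_all add: algebra_simps)
qed

lemma d\<nu>_U: "u \<in> D \<Longrightarrow> dd \<nu> u (U u) = - \<alpha> * p u"
  by (simp add: d\<nu> A_U dh_scale dh_UV)

lemma swapped: "two_component_chart c D F N V U \<beta> \<alpha>"
  by unfold_locales (use smooth_U smooth_V T_UV A_U A_V \<alpha>_\<beta> in auto)

text \<open>Two evaluations of the inner product of \<open>\<nabla>\<^sub>X T\<close> and
  \<open>X\<close>: it equals \<nu> \<gamma> times \<open>G u (X u) (X u)\<close>, and it is also
  the sum of the contributions of \<open>U\<close> and \<open>V\<close>, each known from Codazzi.
  The common factor \<nu> cancels.\<close>

lemma third_eigenfield:
  assumes u: "u \<in> D" and X: "smooth_on D X" "\<And>y. y \<in> D \<Longrightarrow> A y (X y) = \<gamma> *\<^sub>R X y"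
    and "X u \<noteq> 0" "\<nu> u \<noteq> 0" "\<gamma> \<noteq> \<alpha>" "\<gamma> \<noteq> \<beta>"
  shows "c * p u / (\<alpha> - \<gamma>) + c * q u / (\<beta> - \<gamma>) = \<gamma>"
proof -
  interpret inner_form "G u" by (rule inner_form_G[OF u])
  have g: "G u (X u) (X u) \<noteq> 0" using assms(4) G_eq_0_iff by blast
  have o: "G u (U u) (X u) = 0" "G u (V u) (X u) = 0"
    using eigenvectors_orthogonal[OF u A_U[OF u] X(2)[OF u]]
      eigenvectors_orthogonal[OF u A_V[OF u] X(2)[OF u]] assms(6,7) by auto
  then have hX: "dh u (X u) = 0"
    unfolding G_T(2)[OF u, symmetric] T_UV[OF u] by (simp add: G_simps)
  have "b u (X u) (U u) (X u) = c * \<nu> u * p u * G u (X u) (X u)"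
    using codazzi[OF u, of "X u" "U u" "X u"] eigenfield_diagonal[OF u X X(2)[OF u], of "U u"]
    by (simp add: hX dh_UV[OF u])
  then have 1: "(\<alpha> - \<gamma>) * cov u (X u) U (X u) = c * \<nu> u * p u * G u (X u) (X u)"
    using eigenfield_off_diagonal[OF u smooth_U A_U X(2)[OF u], of "X u"] by simp
  have "b u (X u) (V u) (X u) = c * \<nu> u * q u * G u (X u) (X u)"
    using codazzi[OF u, of "X u" "V u" "X u"] eigenfield_diagonal[OF u X X(2)[OF u], of "V u"]
    by (simp add: hX dh_UV[OF u])
  then have 2: "(\<beta> - \<gamma>) * cov u (X u) V (X u) = c * \<nu> u * q u * G u (X u) (X u)"
    using eigenfield_off_diagonal[OF u smooth_V A_V X(2)[OF u], of "X u"] by simp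
  have "cov u (X u) U (X u) + cov u (X u) V (X u) = \<nu> u * \<gamma> * G u (X u) (X u)"
    using cov_T[OF u, of "X u" "X u"] cov_cong[OF u, of T "\<lambda>y. U y + V y" "X u" "X u", OF T_UV]
      cov_add_field[OF u smooth_U smooth_V, where Y = "X u" and W = "X u"]
    by (simp add: X(2)[OF u] G_simps)
  moreover have "cov u (X u) U (X u) = (c * p u / (\<alpha> - \<gamma>)) * (\<nu> u * G u (X u) (X u))"
    "cov u (X u) V (X u) = (c * q u / (\<beta> - \<gamma>)) * (\<nu> u * G u (X u) (X u))"
    using 1 2 assms(6,7) by (simp_all add: field_simps)
  ultimately have "(c * p u / (\<alpha> - \<gamma>) + c * q u / (\<beta> - \<gamma>)) * (\<nu> u * G u (X u) (X u)) =
      \<gamma> * (\<nu> u * G u (X u) (X u))"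
    by (simp add: algebra_simps)
  then show ?thesis using g assms(5) by simp
qed

end

section \<open>The angle function in a chart\<close>

text \<open>The candidate values of \<open>\<nu>\<^sup>2\<close> when the principal curvatures lie in \<open>L\<close>.\<close>

definition angle_values :: "real \<Rightarrow> real set \<Rightarrow> real set" where
  "angle_values c L = (\<Union>\<alpha>\<in>L. \<Union>\<beta>\<in>L. \<Union>\<gamma>\<in>L. let \<kappa> = c / (\<alpha> - \<beta>) in
    {0, 1, 1 - c * \<gamma> * (\<beta> - \<gamma>), 1 - c * \<alpha> * (\<beta> - \<gamma>) + c * (\<alpha> - \<gamma>)\<^sup>2,
     3 * (c + \<kappa>\<^sup>2) / (5 * \<kappa>\<^sup>2), (\<kappa> * \<alpha> + 2 * c + 2 * \<kappa>\<^sup>2) / (4 * \<kappa>\<^sup>2)})"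

lemma finite_angle_values: "finite L \<Longrightarrow> finite (angle_values c L)"
  by (auto simp: angle_values_def Let_def)

text \<open>Origin of the candidates: 0 for \<nu> = 0, where Codazzi carries no information; 1 for T
  = 0; the third and fourth come from \<open>angle_if_third_eigenfield\<close>, the third also from
  surfaces with \<open>T\<close> in one eigenspace; the last two from \<open>angle_dim2\<close>.
  Triples with \<alpha> = \<beta>, where \<kappa> = 0, serve only to supply 0 and 1.\<close>

lemma angle_valuesI:
  assumes "\<alpha> \<in> L" "\<beta> \<in> L" "\<gamma> \<in> L" "\<kappa> = c / (\<alpha> - \<beta>)"
    and "w \<in> {0, 1, 1 - c * \<gamma> * (\<beta> - \<gamma>), 1 - c * \<alpha> * (\<beta> - \<gamma>) + c * (\<alpha> - \<gamma>)\<^sup>2,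
     3 * (c + \<kappa>\<^sup>2) / (5 * \<kappa>\<^sup>2), (\<kappa> * \<alpha> + 2 * c + 2 * \<kappa>\<^sup>2) / (4 * \<kappa>\<^sup>2)}"
  shows "w \<in> angle_values c L"
  unfolding angle_values_def Let_def
  by (rule UN_I[OF assms(1)], rule UN_I[OF assms(2)], rule UN_I[OF assms(3)])
    (use assms(5) in \<open>simp only: assms(4)\<close>)

lemma open_vimage_Int: "continuous_on D f \<Longrightarrow> open D \<Longrightarrow> open B \<Longrightarrow> open (f -` B \<inter> D)"
  by (simp add: continuous_on_open_vimage)

context two_component_chart
begin

lemma has_derivative_pq\<nu>:
  assumes "u \<in> D"
  shows "(p has_derivative dd p u) (at u)" "(q has_derivative dd q u) (at u)"
    "(\<nu> has_derivative dd \<nu> u) (at u)"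
  using smooth_on_has_derivative assms smooth_pq smooth_\<nu> by blast+

text \<open>With \<open>r\<close> and \<open>s\<close> the reciprocals of \<alpha> - \<gamma> and
  \<beta> - \<gamma>, the relation \<open>c p r + c q s = \<gamma>\<close> has derivative
  \<open>2 c \<nu> p r (\<alpha> - c q s)\<close> along \<open>U\<close>. If p \<noteq> 0 this fixes
  q and then p; if p = 0 the relation alone fixes q.\<close>

lemma angle_if_third_eigenfield:
  assumes u: "u \<in> D" and X: "smooth_on D X" "\<And>y. y \<in> D \<Longrightarrow> A y (X y) = \<gamma> *\<^sub>R X y"
    and nz: "\<And>y. y \<in> D \<Longrightarrow> X y \<noteq> 0" "\<And>y. y \<in> D \<Longrightarrow> \<nu> y \<noteq> 0" and \<gamma>: "\<gamma> \<noteq> \<alpha>" "\<gamma> \<noteq> \<beta>"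
  shows "(\<nu> u)\<^sup>2 \<in> {1 - c * \<gamma> * (\<beta> - \<gamma>), 1 - c * \<alpha> * (\<beta> - \<gamma>) + c * (\<alpha> - \<gamma>)\<^sup>2}"
proof -
  define r s where "r = 1 / (\<alpha> - \<gamma>)" and "s = 1 / (\<beta> - \<gamma>)"
  have rs: "r * (\<alpha> - \<gamma>) = 1" "s * (\<beta> - \<gamma>) = 1" using \<gamma> by (simp_all add: r_def s_def)
  have rel: "c * p y * r + c * q y * s = \<gamma>" if "y \<in> D" for y
    using third_eigenfield[OF that X nz(1)[OF that] nz(2)[OF that] \<gamma>] by (simp add: r_def s_def)
  have solve: "x = c * m * d" if "e * d = 1" "c * x * e = m" for x e d m
  proof -
    have "x = (c * c) * x * (e * d)" using that(1) c_c(1) by simp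
    also have "\<dots> = c * (c * x * e) * d" by (simp only: mult_ac)
    finally show ?thesis unfolding that(2) .
  qed
  have pq: "(\<nu> u)\<^sup>2 = 1 - p u - q u" using pq_\<nu>[OF u] by simp
  show ?thesis
  proof (cases "p u = 0")
    case True
    then have "c * q u * s = \<gamma>" using rel[OF u] by simp
    then have "q u = c * \<gamma> * (\<beta> - \<gamma>)" by (rule solve[OF rs(2)])
    then show ?thesis using True pq by simp
  next
    case False
    have "((\<lambda>y. c * p y * r + c * q y * s) has_derivative (\<lambda>v. c * dd p u v * r + c * dd q u v * s)) (at u)"
      using has_derivative_pq\<nu>[OF u] by (auto intro!: derivative_eq_intros)
    then have "c * dd p u (U u) * r + c * dd q u (U u) * s = 0"
      using dd_eq_0[OF open_D u, of "\<lambda>y. c * p y * r + c * q y * s" \<gamma> "U u", OF rel] by (simp add: dd_eq)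
    moreover have "c * dd p u (U u) * r + c * dd q u (U u) * s =
        2 * c * \<nu> u * p u * (\<alpha> * r + c * q u * ((r - s) / (\<alpha> - \<beta>)))"
      unfolding dU_pq[OF u] by (simp add: algebra_simps diff_divide_distrib)
    moreover have "(r - s) / (\<alpha> - \<beta>) = - r * s"
      using \<gamma> \<alpha>_\<beta> by (simp add: r_def s_def divide_simps)
    moreover have "c \<noteq> 0" "r \<noteq> 0" using c \<gamma> by (auto simp: r_def)
    ultimately have "c * q u * s = \<alpha>"
      using False nz(2)[OF u] by (simp add: algebra_simps)
    then have q: "q u = c * \<alpha> * (\<beta> - \<gamma>)" by (rule solve[OF rs(2)])
    have "c * p u * r = \<gamma> - \<alpha>" using rel[OF u] \<open>c * q u * s = \<alpha>\<close> by simp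
    then have "p u = c * (\<gamma> - \<alpha>) * (\<alpha> - \<gamma>)" by (rule solve[OF rs(1)])
    then have "p u = - c * (\<alpha> - \<gamma>)\<^sup>2" by (simp add: power2_eq_square algebra_simps)
    then show ?thesis using pq q by (simp add: algebra_simps)
  qed
qed

lemma V_derivatives:
  assumes u: "u \<in> D"
  shows "cov u (V u) U (V u) = c * \<nu> u * p u * q u / (\<alpha> - \<beta>)"
    "cov u (V u) U (U u) = c * \<nu> u * p u * q u / (\<alpha> - \<beta>)"
    "dd q u (V u) = 2 * \<nu> u * q u * (\<beta> - c * p u / (\<alpha> - \<beta>))"
    "dd p u (V u) = 2 * c * \<nu> u * p u * q u / (\<alpha> - \<beta>)"
    "dd \<nu> u (V u) = - \<beta> * q u"
proof -
  interpret S: two_component_chart c D F N V U \<beta> \<alpha> by (rule swapped)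
  have [simp]: "S.p = q" "S.q = p" by (simp_all add: fun_eq_iff S.p_def S.q_def p_def q_def)
  have n: "x / (\<beta> - \<alpha>) = - (x / (\<alpha> - \<beta>))" for x
    by (metis minus_diff_eq minus_divide_right)
  show "cov u (V u) U (V u) = c * \<nu> u * p u * q u / (\<alpha> - \<beta>)"
    "cov u (V u) U (U u) = c * \<nu> u * p u * q u / (\<alpha> - \<beta>)"
    "dd q u (V u) = 2 * \<nu> u * q u * (\<beta> - c * p u / (\<alpha> - \<beta>))"
    "dd p u (V u) = 2 * c * \<nu> u * p u * q u / (\<alpha> - \<beta>)"
    "dd \<nu> u (V u) = - \<beta> * q u"
    using S.cov_U_U(2,4)[OF u] S.dU_pq[OF u] S.d\<nu>_U[OF u] unfolding n
    by (simp_all add: mult_ac)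
qed

definition "\<kappa> = c / (\<alpha> - \<beta>)"

lemma \<kappa>: "\<kappa> * (\<alpha> - \<beta>) = c" "\<kappa> \<noteq> 0"
  using c \<alpha>_\<beta> by (auto simp: \<kappa>_def)

lemma \<kappa>_derivatives:
  assumes u: "u \<in> D"
  shows "dd p u (U u) = 2 * \<nu> u * p u * (\<alpha> + \<kappa> * q u)"
    "dd q u (U u) = - 2 * \<kappa> * \<nu> u * p u * q u"
    "dd p u (V u) = 2 * \<kappa> * \<nu> u * p u * q u"
    "dd q u (V u) = 2 * \<nu> u * q u * (\<beta> - \<kappa> * p u)"
  using dU_pq[OF u] V_derivatives(3,4)[OF u] by (simp_all add: \<kappa>_def mult_ac)

text \<open>In dimension two the fields \<open>U\<close> and \<open>V\<close> span, so their bracket is determined; applied to the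
  function \<open>p\<close> it yields the Gauss equation of the surface.\<close>

lemma gauss_equation:
  assumes dim: "CARD('n) = 2" and u: "u \<in> D" and nz: "p u \<noteq> 0" "q u \<noteq> 0"
  shows "\<kappa> * (\<alpha> * p u - \<beta> * q u) - 2 * c * (\<nu> u)\<^sup>2 - 2 * \<kappa>\<^sup>2 * (\<nu> u)\<^sup>2 * (1 - (\<nu> u)\<^sup>2) - \<alpha> * \<beta> = 0"
proof -
  interpret inner_form "G u" by (rule inner_form_G[OF u])
  define W where "W = dd V u (U u) - dd U u (V u)"
  define k where "k = - 2 * \<kappa> * \<nu> u"
  have "G u W (U u) = k * p u * q u" "G u W (V u) = k * p u * q u"
    using commutator[OF u smooth_U smooth_V]
    by (simp_all add: W_def[symmetric] cov_U_U[OF u] V_derivatives[OF u] k_def \<kappa>_def)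
  then have "W - (k * q u) *\<^sub>R U u - (k * p u) *\<^sub>R V u = 0"
    using nz by (intro orthogonal_to_pair_dim2[of "U u" "V u"])
      (auto simp: dim G_simps G_UV[OF u] p_def q_def)
  then have W: "W = (k * q u) *\<^sub>R U u + (k * p u) *\<^sub>R V u" by (simp add: algebra_simps)
  have l: "linear (dd p u)" by (rule smooth_on_linear_dd[OF smooth_pq(1) u])
  have W_p: "dd p u W = k * q u * dd p u (U u) + k * p u * dd p u (V u)"
    unfolding W by (simp add: linear_add[OF l] linear_scale[OF l])
  note h = has_derivative_pq\<nu>[OF u]
  have "dd (\<lambda>y. dd p y (V y)) u = dd (\<lambda>y. 2 * \<kappa> * \<nu> y * p y * q y) u"
    by (rule dd_cong[OF open_D u]) (rule \<kappa>_derivatives(3))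
  also have "\<dots> = (\<lambda>v. 2 * \<kappa> * (dd \<nu> u v * p u * q u + \<nu> u * dd p u v * q u + \<nu> u * p u * dd q u v))"
    using h by (intro dd_eq) (auto intro!: derivative_eq_intros simp: algebra_simps)
  finally have 1: "dd (\<lambda>y. dd p y (V y)) u (U u) = 2 * \<kappa> * (dd \<nu> u (U u) * p u * q u
      + \<nu> u * dd p u (U u) * q u + \<nu> u * p u * dd q u (U u))" by simp
  have "dd (\<lambda>y. dd p y (U y)) u = dd (\<lambda>y. 2 * \<nu> y * p y * (\<alpha> + \<kappa> * q y)) u"
    by (rule dd_cong[OF open_D u]) (rule \<kappa>_derivatives(1))
  also have "\<dots> = (\<lambda>v. 2 * (dd \<nu> u v * p u * (\<alpha> + \<kappa> * q u) + \<nu> u * dd p u v * (\<alpha> + \<kappa> * q u)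
      + \<nu> u * p u * \<kappa> * dd q u v))"
    using h by (intro dd_eq) (auto intro!: derivative_eq_intros simp: algebra_simps)
  finally have 2: "dd (\<lambda>y. dd p y (U y)) u (V u) = 2 * (dd \<nu> u (V u) * p u * (\<alpha> + \<kappa> * q u)
      + \<nu> u * dd p u (V u) * (\<alpha> + \<kappa> * q u) + \<nu> u * p u * \<kappa> * dd q u (V u))" by simp
  have "dd (\<lambda>y. dd p y (V y)) u (U u) - dd (\<lambda>y. dd p y (U y)) u (V u) = dd p u W"
    unfolding W_def by (rule dd_commutator[OF open_D smooth_pq(1) smooth_U smooth_V u])
  \<comment> \<open>Every term of the bracket identity has the factor 2 p q. The product
    \<open>\<kappa> * (\<alpha> - \<beta>)\<close> is left unevaluated so that the identity is
    polynomial; it becomes \<open>c\<close> in the last step.\<close>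
  then have E: "2 * p u * q u * (- \<kappa> * (\<alpha> * p u - \<beta> * q u) + \<alpha> * \<beta> + 2 * (\<kappa> * (\<alpha> - \<beta>)) * (\<nu> u)\<^sup>2
      + 2 * \<kappa>\<^sup>2 * (\<nu> u)\<^sup>2 * (p u + q u)) = 0"
    unfolding 1 2 W_p \<kappa>_derivatives[OF u] d\<nu>_U[OF u] V_derivatives(5)[OF u] k_def
    by algebra
  show ?thesis
    using E nz unfolding pq_\<nu>[OF u] \<kappa>(1) by simp
qed

text \<open>The Gauss equation holds on the open set where p and q are nonzero, so it may be
  differentiated along \<open>U\<close> and \<open>V\<close>. The two results \<open>E1\<close> and
  \<open>E2\<close> eliminate p and q.\<close>

lemma angle_dim2:
  assumes dim: "CARD('n) = 2" and u: "u \<in> D" and nz: "p u \<noteq> 0" "q u \<noteq> 0" "\<nu> u \<noteq> 0"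
  shows "(\<nu> u)\<^sup>2 \<in> {3 * (c + \<kappa>\<^sup>2) / (5 * \<kappa>\<^sup>2), (\<kappa> * \<alpha> + 2 * c + 2 * \<kappa>\<^sup>2) / (4 * \<kappa>\<^sup>2)}"
proof -
  define S where "S = (p -` (- {0}) \<inter> D) \<inter> (q -` (- {0}) \<inter> D)"
  have S: "open S" unfolding S_def
    by (intro open_Int[OF open_vimage_Int open_vimage_Int] smooth_pq[THEN smooth_on_continuous_on] open_D)
      auto
  have uS: "u \<in> S" using u nz by (auto simp: S_def)
  note h = has_derivative_pq\<nu>[OF u]
  have "dd (\<lambda>y. \<kappa> * (\<alpha> * p y - \<beta> * q y) - 2 * c * (\<nu> y)\<^sup>2 - 2 * \<kappa>\<^sup>2 * (\<nu> y)\<^sup>2 * (1 - (\<nu> y)\<^sup>2) - \<alpha> * \<beta>) u v = 0"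
    for v
    by (rule dd_eq_0[OF S uS]) (use gauss_equation[OF dim] in \<open>auto simp: S_def\<close>)
  moreover have "((\<lambda>y. \<kappa> * (\<alpha> * p y - \<beta> * q y) - 2 * c * (\<nu> y)\<^sup>2 - 2 * \<kappa>\<^sup>2 * (\<nu> y)\<^sup>2 * (1 - (\<nu> y)\<^sup>2) - \<alpha> * \<beta>)
    has_derivative (\<lambda>v. \<kappa> * (\<alpha> * dd p u v - \<beta> * dd q u v) - 4 * c * \<nu> u * dd \<nu> u v
      - 4 * \<kappa>\<^sup>2 * \<nu> u * dd \<nu> u v * (1 - 2 * (\<nu> u)\<^sup>2))) (at u)"
    using h by (auto intro!: derivative_eq_intros simp: algebra_simps power2_eq_square power3_eq_cube)
  ultimately have d: "\<kappa> * (\<alpha> * dd p u v - \<beta> * dd q u v) - 4 * c * \<nu> u * dd \<nu> u v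
      - 4 * \<kappa>\<^sup>2 * \<nu> u * dd \<nu> u v * (1 - 2 * (\<nu> u)\<^sup>2) = 0" for v
    by (simp add: dd_eq)
  have "2 * \<nu> u * p u * (\<kappa> * \<alpha>\<^sup>2 + \<kappa>\<^sup>2 * q u * (\<alpha> + \<beta>) + 2 * c * \<alpha> + 2 * \<kappa>\<^sup>2 * \<alpha> * (1 - 2 * (\<nu> u)\<^sup>2)) = 0"
    using d[of "U u"] unfolding \<kappa>_derivatives[OF u] d\<nu>_U[OF u] by algebra
  then have E1: "\<kappa> * \<alpha>\<^sup>2 + \<kappa>\<^sup>2 * q u * (\<alpha> + \<beta>) + 2 * c * \<alpha> + 2 * \<kappa>\<^sup>2 * \<alpha> * (1 - 2 * (\<nu> u)\<^sup>2) = 0"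
    using nz by simp
  have "2 * \<nu> u * q u * (- \<kappa> * \<beta>\<^sup>2 + \<kappa>\<^sup>2 * p u * (\<alpha> + \<beta>) + 2 * c * \<beta> + 2 * \<kappa>\<^sup>2 * \<beta> * (1 - 2 * (\<nu> u)\<^sup>2)) = 0"
    using d[of "V u"] unfolding \<kappa>_derivatives[OF u] V_derivatives(5)[OF u] by algebra
  then have E2: "- \<kappa> * \<beta>\<^sup>2 + \<kappa>\<^sup>2 * p u * (\<alpha> + \<beta>) + 2 * c * \<beta> + 2 * \<kappa>\<^sup>2 * \<beta> * (1 - 2 * (\<nu> u)\<^sup>2) = 0"
    using nz by simp
  \<comment> \<open>The sum of \<open>E1\<close> and \<open>E2\<close>, using
    \<open>pq_\<nu>\<close> and \<kappa> (\<alpha> - \<beta>) = c. If \<alpha> + \<beta> = 0 it is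
    void, but then q drops out of \<open>E1\<close>.\<close>
  have "(\<alpha> + \<beta>) * (3 * c + 3 * \<kappa>\<^sup>2 - 5 * \<kappa>\<^sup>2 * (\<nu> u)\<^sup>2) = 0"
    using E1 E2 pq_\<nu>[OF u] \<kappa>(1) by algebra
  then have "\<alpha> + \<beta> = 0 \<or> 5 * \<kappa>\<^sup>2 * (\<nu> u)\<^sup>2 = 3 * (c + \<kappa>\<^sup>2)"
    unfolding mult_eq_0_iff by (elim disjE) simp_all
  then consider "\<alpha> + \<beta> = 0" | "5 * \<kappa>\<^sup>2 * (\<nu> u)\<^sup>2 = 3 * (c + \<kappa>\<^sup>2)" by blast
  then show ?thesis
  proof cases
    case 1
    then have "\<alpha> * (\<kappa> * \<alpha> + 2 * c + 2 * \<kappa>\<^sup>2 - 4 * \<kappa>\<^sup>2 * (\<nu> u)\<^sup>2) = 0"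
      using E1 by algebra
    moreover have "\<alpha> \<noteq> 0" using 1 \<alpha>_\<beta> by auto
    ultimately have "\<kappa> * \<alpha> + 2 * c + 2 * \<kappa>\<^sup>2 - 4 * \<kappa>\<^sup>2 * (\<nu> u)\<^sup>2 = 0" by simp
    then show ?thesis using \<kappa>(2) by (simp add: field_simps)
  next
    case 2
    then show ?thesis using \<kappa>(2) by (simp add: field_simps)
  qed
qed

end

section \<open>Eigenprojections in a chart and the values of the angle function\<close>

locale three_curvature_chart = hypersurface_chart c D F N
  for c and D :: "(real ^ 'n::finite) set" and F N :: "real ^ 'n \<Rightarrow> 'n ambient" +
  fixes l1 l2 l3 :: real
  assumes distinct_l: "l1 \<noteq> l2" "l1 \<noteq> l3" "l2 \<noteq> l3"
    and eigenvalues: "u \<in> D \<Longrightarrow> X \<noteq> 0 \<Longrightarrow> A u X = l *\<^sub>R X \<Longrightarrow> l \<in> {l1, l2, l3}"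
begin

lemma three_eigenvalues: "u \<in> D \<Longrightarrow> three_eigenvalues (A u) l1 l2 l3"
  using distinct_l eigenvalues
  by (intro three_eigenvalues.intro linear_A self_adjoint_form.cubic_annihilates[OF self_adjoint_A]) auto

lemma rotate_chart: "three_curvature_chart c D F N l2 l3 l1"
  by unfold_locales (use distinct_l eigenvalues in auto)

definition "P u = eigenproj (A u) l1 l2 l3"

lemma smooth_shift: "smooth_on D X \<Longrightarrow> smooth_on D (\<lambda>u. shift (A u) l (X u))"
  unfolding shift_def by (intro smooth_intros smooth_A)

lemma smooth_eigenproj: "smooth_on D X \<Longrightarrow> smooth_on D (\<lambda>u. eigenproj (A u) k1 k2 k3 (X u))"
  unfolding eigenproj_def by (intro smooth_intros smooth_shift)

lemma A_P: "u \<in> D \<Longrightarrow> A u (P u X) = l1 *\<^sub>R P u X"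
  unfolding P_def by (rule three_eigenvalues.A_eigenproj[OF three_eigenvalues])

lemma P_eigenvector: "u \<in> D \<Longrightarrow> A u X = l1 *\<^sub>R X \<Longrightarrow> P u X = X"
  unfolding P_def by (rule three_eigenvalues.eigenproj_eigenvector[OF three_eigenvalues])

text \<open>With constant \<open>X\<close> this is the source of eigenfields: by
  \<open>P_eigenvector\<close> the field \<open>\<lambda>y. P y X\<close> extends any eigenvector
  \<open>X\<close> for \<open>l1\<close> at \<open>u\<close>.\<close>

lemma smooth_P: "smooth_on D X \<Longrightarrow> smooth_on D (\<lambda>u. P u (X u))"
  unfolding P_def by (rule smooth_eigenproj)

lemma decompose: "u \<in> D \<Longrightarrow> P u X + eigenproj (A u) l2 l3 l1 X + eigenproj (A u) l3 l1 l2 X = X"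
  unfolding P_def by (rule three_eigenvalues.eigenproj_sum[OF three_eigenvalues])

lemma A_eigenproj23:
  "u \<in> D \<Longrightarrow> A u (eigenproj (A u) l2 l3 l1 X) = l2 *\<^sub>R eigenproj (A u) l2 l3 l1 X"
  "u \<in> D \<Longrightarrow> A u (eigenproj (A u) l3 l1 l2 X) = l3 *\<^sub>R eigenproj (A u) l3 l1 l2 X"
  using three_eigenvalues.A_eigenproj[OF three_eigenvalues.rotate[OF three_eigenvalues]]
    three_eigenvalues.A_eigenproj[OF three_eigenvalues.rotate[OF three_eigenvalues.rotate[OF three_eigenvalues]]]
  by auto

text \<open>An eigenspace of dimension at least two is orthogonal to \<open>T\<close> where \<open>\<nu> \<noteq> 0\<close>: the Codazzi
  equation for two vectors of the eigenspace has no component in it.\<close>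

lemma P_T_eq_0:
  assumes u: "u \<in> D" and "\<nu> u \<noteq> 0"
    and Z: "Z \<noteq> 0" "A u Z = l1 *\<^sub>R Z" "G u Z (P u (T u)) = 0"
  shows "P u (T u) = 0"
proof -
  interpret inner_form "G u" by (rule inner_form_G[OF u])
  define W where "W = P u (T u)"
  have AW: "A u W = l1 *\<^sub>R W" unfolding W_def by (rule A_P[OF u])
  have diag: "b u Y X X' = 0" if "A u X = l1 *\<^sub>R X" "A u X' = l1 *\<^sub>R X'" for Y X X'
    using eigenfield_diagonal[OF u smooth_P[OF smooth_on_const] A_P that(2), of Y X]
    by (simp add: P_eigenvector[OF u that(1)])
  have GT: "G u X (T u) = G u X W" if "A u X = l1 *\<^sub>R X" for X
  proof -
    have "G u X (T u) = G u X (P u (T u) + eigenproj (A u) l2 l3 l1 (T u) + eigenproj (A u) l3 l1 l2 (T u))"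
      unfolding decompose[OF u] ..
    also have "\<dots> = G u X W"
      using eigenvectors_orthogonal[OF u that A_eigenproj23(1)[OF u] distinct_l(1)]
        eigenvectors_orthogonal[OF u that A_eigenproj23(2)[OF u] distinct_l(2)]
      by (simp add: G_simps W_def)
    finally show ?thesis .
  qed
  have "dh u W = G u W W" "dh u Z = 0"
    using G_T(1)[OF u] GT[OF AW] GT[OF Z(2)] Z(3) by (simp_all add: W_def)
  \<comment> \<open>Both terms on the left of the Codazzi equation vanish by \<open>diag\<close>,
    and \<open>dh u Z = 0\<close> leaves one curvature term.\<close>
  then have "c * \<nu> u * (G u W W * G u Z Z) = 0"
    using codazzi[OF u, of Z W Z] diag[OF AW Z(2), of Z] diag[OF Z(2) Z(2), of W] by simp
  then have "W = 0" using c assms(2) Z(1) by (auto simp: G_eq_0_iff)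
  then show ?thesis by (simp add: W_def)
qed

text \<open>The projections of \<open>X\<close> and \<open>Y\<close> stay independent near
  \<open>u\<close>, so the eigenspace of \<open>l1\<close> stays at least two-dimensional and
  contains a nonzero vector orthogonal to the component of \<open>T\<close>. Hence \<open>T\<close>
  splits into the other two eigenspaces nearby, and \<open>P y X\<close> is a third
  eigenfield.\<close>

lemma angle_if_multiple:
  assumes u: "u \<in> D" and X: "X \<noteq> 0" "A u X = l1 *\<^sub>R X" and Y: "A u Y = l1 *\<^sub>R Y" "\<And>r. Y \<noteq> r *\<^sub>R X"
  shows "(\<nu> u)\<^sup>2 \<in> angle_values c {l1, l2, l3}"
proof (cases "\<nu> u = 0")
  case True
  then show ?thesis by (intro angle_valuesI[of l1 _ l1 l1]) auto
next
  case False
  define gram where "gram y = G y (P y X) (P y X) * G y (P y Y) (P y Y) - (G y (P y X) (P y Y))\<^sup>2" for y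
  have sP: "smooth_on D (\<lambda>u. P u Z)" for Z by (rule smooth_P[OF smooth_on_const])
  have "smooth_on D gram"
    unfolding gram_def power2_eq_square by (intro smooth_intros smooth_G sP)
  then have cont: "continuous_on D gram" "continuous_on D \<nu>"
    using smooth_\<nu> by (simp_all add: smooth_on_continuous_on)
  define S where "S = (gram -` {0<..} \<inter> D) \<inter> (\<nu> -` (- {0}) \<inter> D)"
  have S: "open S" "S \<subseteq> D" unfolding S_def
    using cont open_D by (auto intro!: open_Int[OF open_vimage_Int open_vimage_Int])
  have "gram u > 0"
    unfolding gram_def P_eigenvector[OF u X(2)] P_eigenvector[OF u Y(1)]
    by (rule inner_form.G_Gram_pos[OF inner_form_G[OF u] X(1) Y(2)])
  then have uS: "u \<in> S" using u False by (auto simp: S_def)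
  interpret S: hypersurface_chart c S F N by (rule subchart[OF S])
  have PT: "P y (T y) = 0" if y: "y \<in> S" for y
  proof -
    have yD: "y \<in> D" and \<nu>: "\<nu> y \<noteq> 0" and "gram y > 0" using y by (auto simp: S_def)
    then obtain r s where "r *\<^sub>R P y X + s *\<^sub>R P y Y \<noteq> 0" "G y (r *\<^sub>R P y X + s *\<^sub>R P y Y) (P y (T y)) = 0"
      using inner_form.exists_orthogonal_combination[OF inner_form_G[OF yD]] unfolding gram_def by blast
    moreover have "A y (r *\<^sub>R P y X + s *\<^sub>R P y Y) = l1 *\<^sub>R (r *\<^sub>R P y X + s *\<^sub>R P y Y)"
      by (simp add: linear_add[OF linear_A[OF yD]] linear_scale[OF linear_A[OF yD]] A_P[OF yD] algebra_simps)
    ultimately show ?thesis using P_T_eq_0[OF yD \<nu>] by blast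
  qed
  have sub: "smooth_on S Z" if "smooth_on D Z" for Z :: "real ^ 'n \<Rightarrow> real ^ 'n"
    using smooth_on_subset[OF that S(2)] .
  interpret S: two_component_chart c S F N "\<lambda>y. eigenproj (A y) l2 l3 l1 (T y)"
    "\<lambda>y. eigenproj (A y) l3 l1 l2 (T y)" l2 l3
  proof unfold_locales
    fix y assume y: "y \<in> S"
    then have yD: "y \<in> D" using S(2) by blast
    show "T y = eigenproj (A y) l2 l3 l1 (T y) + eigenproj (A y) l3 l1 l2 (T y)"
      using decompose[OF yD, of "T y"] PT[OF y] by simp
  qed (use S(2) distinct_l A_eigenproj23 in \<open>auto intro!: sub smooth_eigenproj smooth_T\<close>)
  have "(\<nu> u)\<^sup>2 \<in> {1 - c * l1 * (l3 - l1), 1 - c * l2 * (l3 - l1) + c * (l2 - l1)\<^sup>2}"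
  proof (rule S.angle_if_third_eigenfield[OF uS sub[OF sP]])
    fix y assume y: "y \<in> S"
    then have yD: "y \<in> D" using S(2) by blast
    show "A y (P y X) = l1 *\<^sub>R P y X" by (rule A_P[OF yD])
    have "gram y > 0" using y by (auto simp: S_def)
    then show "P y X \<noteq> 0"
      by (auto simp: gram_def inner_form.G_simps[OF inner_form_G[OF yD]])
    show "\<nu> y \<noteq> 0" using y by (auto simp: S_def)
  qed (use distinct_l in auto)
  then show ?thesis by (intro angle_valuesI[of l2 _ l3 l1]) auto
qed

text \<open>Here \<open>l1\<close> is the padding number. If \<open>u\<close> violated the claim, so
  would all nearby points, as the candidate set is closed; by \<open>angle_dim2\<close> one
  component of \<open>T\<close> then vanishes at each of them. A component that is nonzero at
  \<open>u\<close> stays nonzero nearby, so there \<open>T\<close> lies in one eigenspace.\<close>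

lemma angle_if_dim2:
  assumes dim: "CARD('n) = 2" and u: "u \<in> D"
    and not_l1: "\<And>y X. y \<in> D \<Longrightarrow> X \<noteq> 0 \<Longrightarrow> A y X \<noteq> l1 *\<^sub>R X"
    and l2: "X2 \<noteq> 0" "A u X2 = l2 *\<^sub>R X2" and l3: "X3 \<noteq> 0" "A u X3 = l3 *\<^sub>R X3"
  shows "(\<nu> u)\<^sup>2 \<in> angle_values c {l1, l2, l3}"
proof -
  interpret R: three_curvature_chart c D F N l2 l3 l1 by (rule rotate_chart)
  interpret Q: three_curvature_chart c D F N l3 l1 l2 by (rule R.rotate_chart)
  have P0: "P y X = 0" if "y \<in> D" for y X using not_l1[OF that] A_P[OF that] by blast
  have dec: "R.P y X + Q.P y X = X" if "y \<in> D" for y X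
    using decompose[OF that, of X] P0[OF that] by (simp add: R.P_def Q.P_def)
  define U V where "U y = R.P y (T y)" and "V y = Q.P y (T y)" for y
  have sUV: "smooth_on D U" "smooth_on D V"
    unfolding U_def V_def by (intro R.smooth_P Q.smooth_P smooth_T)+
  have AU: "A y (U y) = l2 *\<^sub>R U y" and AV: "A y (V y) = l3 *\<^sub>R V y" if "y \<in> D" for y
    unfolding U_def V_def using R.A_P[OF that] Q.A_P[OF that] by auto
  interpret B: two_component_chart c D F N U V l2 l3
    by unfold_locales (use sUV AU AV dec distinct_l in \<open>auto simp: U_def V_def\<close>)
  \<comment> \<open>The zero field with eigenvalue \<open>l1\<close> stands in for the missing
    component of \<open>T\<close>, and \<open>Y\<close>, an eigenfield of the other principal
    curvature, acts as third eigenfield.\<close>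
  have one_sided: "(\<nu> u)\<^sup>2 = 1 - c * m * (k - m)"
    if S: "open S" "S \<subseteq> D" "u \<in> S" and Z: "smooth_on D Z" "\<And>y. y \<in> D \<Longrightarrow> A y (Z y) = k *\<^sub>R Z y"
      and TZ: "\<And>y. y \<in> S \<Longrightarrow> T y = Z y" and "\<nu> u \<noteq> 0"
      and Y: "smooth_on D Y" "\<And>y. y \<in> D \<Longrightarrow> A y (Y y) = m *\<^sub>R Y y" "Y u \<noteq> 0"
      and ne: "k \<noteq> m" "k \<noteq> l1" "m \<noteq> l1" for S Z Y k m
  proof -
    interpret S: hypersurface_chart c S F N by (rule subchart[OF S(1,2)])
    interpret S: two_component_chart c S F N Z "\<lambda>_. 0" k l1
      by unfold_locales (use S(2) Z TZ ne linear_0[OF linear_A]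
        in \<open>auto intro: smooth_on_subset smooth_on_const\<close>)
    have "c * S.p u / (k - m) + c * S.q u / (l1 - m) = m"
      by (rule S.third_eigenfield[OF S(3) smooth_on_subset[OF Y(1) S(2)] Y(2) Y(3) \<open>\<nu> u \<noteq> 0\<close>])
        (use S(2) ne in auto)
    moreover have "S.q u = 0" using u by (simp add: S.q_def inner_form.G_simps[OF inner_form_G])
    ultimately have "c * S.p u = m * (k - m)" using ne by (simp add: field_simps)
    then have "S.p u = c * m * (k - m)" using c_c(2)[of "S.p u"] by simp
    then show ?thesis using S.pq_\<nu>[OF S(3)] \<open>S.q u = 0\<close> by simp
  qed
  show ?thesis
  proof (rule ccontr)
    assume "\<not> ?thesis"
    then have notin: "(\<nu> u)\<^sup>2 \<notin> angle_values c {l1, l2, l3}" .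
    have n0: "\<nu> u \<noteq> 0"
      using angle_valuesI[of l1 "{l1, l2, l3}" l1 l1 _ c "(\<nu> u)\<^sup>2"] notin by auto
    have cont: "continuous_on D B.p" "continuous_on D B.q" "continuous_on D (\<lambda>y. (\<nu> y)\<^sup>2)"
      by (intro smooth_on_continuous_on B.smooth_pq continuous_on_power smooth_\<nu>)+
    define S where "S = (\<lambda>y. (\<nu> y)\<^sup>2) -` (- angle_values c {l1, l2, l3}) \<inter> D"
    have S: "open S" "S \<subseteq> D" "u \<in> S"
      unfolding S_def using cont(3) open_D u notin finite_angle_values[of "{l1, l2, l3}" c]
      by (auto simp: continuous_on_open_vimage finite_imp_closed open_Compl)
    \<comment> \<open>near \<open>u\<close> the candidate values are avoided, so \<open>T\<close> lies in a single eigenspace there\<close>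
    have pq0: "B.p y = 0 \<or> B.q y = 0" if y: "y \<in> S" for y
    proof (rule ccontr)
      assume nz: "\<not> (B.p y = 0 \<or> B.q y = 0)"
      have yD: "y \<in> D" and ny: "(\<nu> y)\<^sup>2 \<notin> angle_values c {l1, l2, l3}" using y by (auto simp: S_def)
      have "\<nu> y \<noteq> 0"
        using angle_valuesI[of l1 "{l1, l2, l3}" l1 l1 _ c "(\<nu> y)\<^sup>2"] ny by auto
      then show False
        using B.angle_dim2[OF dim yD] nz ny
          angle_valuesI[of l2 "{l1, l2, l3}" l3 l1 B.\<kappa> c "(\<nu> y)\<^sup>2"] by (auto simp: B.\<kappa>_def)
    qed
    have G0: "Z = 0" if "y \<in> D" "G y Z Z = 0" for y Z
      using inner_form.G_eq_0_iff[OF inner_form_G[OF that(1)]] that(2) by simp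
    have fields: "smooth_on D (\<lambda>y. R.P y X2)" "smooth_on D (\<lambda>y. Q.P y X3)"
      by (intro R.smooth_P Q.smooth_P smooth_on_const)+
    consider "B.p u \<noteq> 0" | "B.q u \<noteq> 0" | "B.p u = 0" "B.q u = 0" by blast
    then show False
    proof cases
      case 1
      define S' where "S' = S \<inter> (B.p -` (- {0}) \<inter> D)"
      have S': "open S'" "S' \<subseteq> D" "u \<in> S'"
        unfolding S'_def using S cont(1) open_D u 1 by (auto intro!: open_Int[OF _ open_vimage_Int])
      have "T y = U y" if "y \<in> S'" for y
      proof -
        have "y \<in> D" "B.q y = 0" using that pq0 by (auto simp: S'_def)
        then show ?thesis using G0[of y "V y"] B.T_UV by (simp add: B.q_def)
      qed
      then have "(\<nu> u)\<^sup>2 = 1 - c * l3 * (l2 - l3)"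
        using distinct_l fields(2) n0 Q.P_eigenvector[OF u l3(2)] l3(1) Q.A_P
        by (intro one_sided[OF S' sUV(1) AU, of "\<lambda>y. Q.P y X3"]) auto
      then show False using notin angle_valuesI[of l1 "{l1, l2, l3}" l2 l3 _ c "(\<nu> u)\<^sup>2"] by auto
    next
      case 2
      define S' where "S' = S \<inter> (B.q -` (- {0}) \<inter> D)"
      have S': "open S'" "S' \<subseteq> D" "u \<in> S'"
        unfolding S'_def using S cont(2) open_D u 2 by (auto intro!: open_Int[OF _ open_vimage_Int])
      have "T y = V y" if "y \<in> S'" for y
      proof -
        have "y \<in> D" "B.p y = 0" using that pq0 by (auto simp: S'_def)
        then show ?thesis using G0[of y "U y"] B.T_UV by (simp add: B.p_def)
      qed
      then have "(\<nu> u)\<^sup>2 = 1 - c * l2 * (l3 - l2)"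
        using distinct_l fields(1) n0 R.P_eigenvector[OF u l2(2)] l2(1) R.A_P
        by (intro one_sided[OF S' sUV(2) AV, of "\<lambda>y. R.P y X2"]) auto
      then show False using notin angle_valuesI[of l1 "{l1, l2, l3}" l3 l2 _ c "(\<nu> u)\<^sup>2"] by auto
    next
      case 3
      then show False using B.pq_\<nu>[OF u] notin
          angle_valuesI[of l1 "{l1, l2, l3}" l1 l1 _ c "(\<nu> u)\<^sup>2"] by auto
    qed
  qed
qed

end

section \<open>Geodesics\<close>

lemma QxR_iff: "z \<in> QxR c \<longleftrightarrow> bil c (horizontal z) (horizontal z) = c \<and> (c = -1 \<longrightarrow> snd (fst z) > 0)"
  by (cases z; cases "fst z") (auto simp: QxR_def bil_def horizontal_def power2_eq_square)

lemma tangent_space_iff: "v \<in> tangent_space c z \<longleftrightarrow> bil c (horizontal z) v = 0"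
  by (simp add: tangent_space_def horizontal_def)

lemma bil_horizontal_horizontal: "bil c (horizontal v) (horizontal w) = bil c (horizontal v) w"
  "bil c (horizontal v) (horizontal w) = bil c v (horizontal w)"
  by (simp_all add: bil_def horizontal_def)

lemma horizontal_simps:
  "horizontal (v + w) = horizontal v + horizontal w" "horizontal (r *\<^sub>R v) = r *\<^sub>R horizontal v"
  "horizontal d_dt = 0" "horizontal (horizontal v) = horizontal v"
  by (simp_all add: horizontal_def d_dt_def zero_prod_def)

lemma horizontal_decomp: "v = horizontal v + snd v *\<^sub>R d_dt"
  by (simp add: horizontal_def d_dt_def prod_eq_iff)

lemma snd_d_dt [simp]: "snd d_dt = 1"
  by (simp add: d_dt_def)

text \<open>The solutions of \<open>y'' = - c k y\<close> with initial values \<open>(1, 0)\<close> and \<open>(0, 1)\<close>.\<close>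

definition gcos :: "real \<Rightarrow> real \<Rightarrow> real \<Rightarrow> real" where
  "gcos c k s = (if c = 1 then cos (sqrt k * s) else cosh (sqrt k * s))"

definition gsin :: "real \<Rightarrow> real \<Rightarrow> real \<Rightarrow> real" where
  "gsin c k s = (if k = 0 then s else if c = 1 then sin (sqrt k * s) / sqrt k else sinh (sqrt k * s) / sqrt k)"

lemma gcos_0 [simp]: "gcos c k 0 = 1" and gsin_0 [simp]: "gsin c k 0 = 0"
  by (simp_all add: gcos_def gsin_def)

lemma gcos_derivative:
  assumes "c = 1 \<or> c = -1" "k \<ge> 0"
  shows "(gcos c k has_real_derivative - c * k * gsin c k s) (at s)"
proof (cases "k = 0")
  case True
  then show ?thesis by (simp add: gcos_def[abs_def] cong: if_cong)
next
  case False
  define m where "m = sqrt k"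
  have m: "m > 0" "k = m * m" using assms(2) False by (simp_all add: m_def)
  have "(gcos c k has_real_derivative - c * m * (if c = 1 then sin (m * s) else sinh (m * s))) (at s)"
    using assms(1) unfolding gcos_def[abs_def] m_def[symmetric]
    by (auto intro!: derivative_eq_intros)
  then show ?thesis
    using m(1) False by (auto simp: gsin_def m_def[symmetric] m(2) mult.assoc)
qed

lemma gsin_derivative:
  assumes "c = 1 \<or> c = -1" "k \<ge> 0"
  shows "(gsin c k has_real_derivative gcos c k s) (at s)"
proof (cases "k = 0")
  case True
  then show ?thesis by (simp add: gcos_def gsin_def[abs_def] cong: if_cong)
next
  case False
  with assms show ?thesis
    by (auto simp: gcos_def gsin_def[abs_def] mult.assoc intro!: derivative_eq_intros)
qed

lemma gcos_gsin:
  assumes "c = 1 \<or> c = -1" "k \<ge> 0"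
  shows "(gcos c k s)\<^sup>2 + c * k * (gsin c k s)\<^sup>2 = 1"
  using assms cosh_square_eq[of "sqrt k * s"]
  by (auto simp: gcos_def gsin_def power_divide)

text \<open>\<open>exp_map\<close> runs for time 1 with velocity \<open>t *\<^sub>R v\<close>, whose
  squared horizontal speed carries the factor \<open>t\<^sup>2\<close>. This converts it to time
  \<open>t\<close> with velocity \<open>v\<close>; parity covers negative \<open>t\<close>.\<close>

lemma gcos_rescale: "gcos c (t\<^sup>2 * k) 1 = gcos c k t" if "k \<ge> 0"
  using that by (cases "t \<ge> 0") (auto simp: gcos_def real_sqrt_mult real_sqrt_abs abs_real_def mult.commute)

lemma gsin_rescale: "t * gsin c (t\<^sup>2 * k) 1 = gsin c k t" if "k \<ge> 0"
  using that by (cases "t \<ge> 0") (auto simp: gsin_def real_sqrt_mult real_sqrt_abs abs_real_def mult.commute)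

text \<open>A great circle or hyperbola of squared speed \<open>k\<close> in the curved factor,
  combined with affine motion in the real line.\<close>

definition geod :: "real \<Rightarrow> 'n::finite ambient \<Rightarrow> 'n ambient \<Rightarrow> real \<Rightarrow> 'n ambient" where
  "geod c z v s = (let k = bil c (horizontal v) (horizontal v) in
     gcos c k s *\<^sub>R horizontal z + gsin c k s *\<^sub>R horizontal v + (snd z + s * snd v) *\<^sub>R d_dt)"

lemma bil_horizontal_nonneg:
  assumes "c = 1 \<or> c = -1" "z \<in> QxR c" "v \<in> tangent_space c z"
  shows "bil c (horizontal v) (horizontal v) \<ge> 0"
proof (cases "horizontal v = 0")
  case False
  have "bil c (horizontal z) (horizontal v) = 0"
    using assms(3) by (simp add: tangent_space_iff bil_horizontal_horizontal(1))
  then show ?thesis using bil_tangent_pos[OF assms(1,2) _ False] by simp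
qed (simp add: bil_simps)

lemma geod_is_geodesic:
  fixes z v :: "'n::finite ambient"
  assumes c: "c = 1 \<or> c = -1" and z: "z \<in> QxR c" and v: "v \<in> tangent_space c z"
  shows "\<exists>\<gamma>'. is_geodesic c (geod c z v) \<gamma>' \<and> \<gamma>' 0 = v"
proof -
  define k where "k = bil c (horizontal v) (horizontal v)"
  have k: "k \<ge> 0" unfolding k_def by (rule bil_horizontal_nonneg[OF c z v])
  define C S where "C = gcos c k" and "S = gsin c k"
  have CS: "(C s)\<^sup>2 + c * k * (S s)\<^sup>2 = 1" for s unfolding C_def S_def by (rule gcos_gsin[OF c k])
  have dC: "(C has_real_derivative - c * k * S s) (at s)" for s
    unfolding C_def S_def by (rule gcos_derivative[OF c k])
  have dS: "(S has_real_derivative C s) (at s)" for s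
    unfolding C_def S_def by (rule gsin_derivative[OF c k])
  define \<gamma> where "\<gamma> s = C s *\<^sub>R horizontal z + S s *\<^sub>R horizontal v + (snd z + s * snd v) *\<^sub>R d_dt" for s
  define \<gamma>' where "\<gamma>' s = (- c * k * S s) *\<^sub>R horizontal z + C s *\<^sub>R horizontal v + snd v *\<^sub>R d_dt" for s
  have geod: "geod c z v = \<gamma>" by (simp add: fun_eq_iff geod_def \<gamma>_def Let_def k_def C_def S_def)
  have zv: "bil c (horizontal z) (horizontal v) = 0"
    using v by (simp add: tangent_space_iff bil_horizontal_horizontal(1))
  then have vz: "bil c (horizontal v) (horizontal z) = 0" by (simp add: bil_commute)
  have h\<gamma>: "horizontal (\<gamma> s) = C s *\<^sub>R horizontal z + S s *\<^sub>R horizontal v" for s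
    by (simp add: \<gamma>_def horizontal_simps)
  have norm: "bil c (horizontal (\<gamma> s)) (horizontal (\<gamma> s)) = c" for s
  proof -
    have "bil c (horizontal (\<gamma> s)) (horizontal (\<gamma> s)) = (C s)\<^sup>2 * c + (S s)\<^sup>2 * k"
      by (simp add: h\<gamma> bil_simps zv vz QxR_bil[OF z] k_def[symmetric] power2_eq_square)
    also have "\<dots> = c * ((C s)\<^sup>2 + c * k * (S s)\<^sup>2)" using c by (auto simp: algebra_simps)
    finally show ?thesis by (simp add: CS)
  qed
  have contC: "continuous_on UNIV C" "continuous_on UNIV S"
    using dC dS by (auto intro!: continuous_at_imp_continuous_on DERIV_isCont)
  have "\<gamma> s \<in> QxR c" for s
  proof -
    \<comment> \<open>The curve cannot change the sheet of the hyperboloid: the last coordinate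
      starts positive, depends continuously on time, and its square never vanishes.\<close>
    have "snd (fst (\<gamma> s)) > 0" if c': "c = -1"
    proof (rule ccontr)
      define \<sigma> where "\<sigma> r = snd (fst (\<gamma> r))" for r
      have sq: "(\<sigma> r)\<^sup>2 > 0" for r
      proof -
        have "fst (fst (\<gamma> r)) \<bullet> fst (fst (\<gamma> r)) - (\<sigma> r)\<^sup>2 = -1"
          using norm[of r] c' by (simp add: bil_def horizontal_def \<sigma>_def power2_eq_square)
        then show ?thesis by (smt (verit) inner_ge_zero)
      qed
      assume "\<not> snd (fst (\<gamma> s)) > 0"
      then have neg: "\<sigma> s \<le> 0" by (simp add: \<sigma>_def)
      have pos: "\<sigma> 0 > 0"
        using z c' by (simp add: \<sigma>_def \<gamma>_def C_def S_def QxR_iff horizontal_def d_dt_def)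
      have "continuous_on UNIV \<sigma>"
        unfolding \<sigma>_def \<gamma>_def by (intro continuous_intros contC)
      then have "connected (range \<sigma>)" by (simp add: connected_continuous_image)
      then have "0 \<in> range \<sigma>" using connectedD_interval[of "range \<sigma>" "\<sigma> s" "\<sigma> 0" 0] neg pos by simp
      then show False using sq by auto
    qed
    then show ?thesis using norm[of s] by (simp add: QxR_iff)
  qed
  moreover have "(\<gamma> has_vector_derivative \<gamma>' s) (at s)" for s
    unfolding \<gamma>_def \<gamma>'_def using dC dS by (auto intro!: derivative_eq_intros)
  moreover have "(\<gamma>' has_vector_derivative (- c * k) *\<^sub>R horizontal (\<gamma> s)) (at s)" for s
    unfolding h\<gamma> unfolding \<gamma>'_def using dC dS
    by (auto intro!: derivative_eq_intros simp: algebra_simps)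
  moreover have "tan_proj c (\<gamma> s) ((- c * k) *\<^sub>R horizontal (\<gamma> s)) = 0" for s
    using c norm[of s] by (auto simp: tan_proj_eq bil_simps)
  ultimately have "is_geodesic c \<gamma> \<gamma>'" unfolding is_geodesic_def by blast
  moreover have "\<gamma>' 0 = v"
    using horizontal_decomp[of v] by (simp add: \<gamma>'_def C_def S_def)
  ultimately show ?thesis unfolding geod by blast
qed

lemma vector_derivative_const_zero:
  assumes "\<And>s. f s = k" "(f has_vector_derivative d) (at s)"
  shows "d = 0"
proof -
  have "f = (\<lambda>_. k)" using assms(1) by auto
  then show ?thesis
    using assms(2) has_vector_derivative_const vector_derivative_unique_at by metis
qed

lemma has_vector_derivative_0_constant:
  fixes f :: "real \<Rightarrow> 'b::banach"
  assumes "\<And>s. (f has_vector_derivative 0) (at s)"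
  shows "f s = f 0"
  using has_derivative_zero_unique[of UNIV f s 0] assms by (simp add: has_vector_derivative_def)

text \<open>The horizontal part \<open>x\<close> of a geodesic solves \<open>x'' = - c k x\<close>, so that \<open>C x - S x'\<close> and
  \<open>c k S x + C x'\<close> are constant.\<close>

lemma geodesic_unique:
  fixes z v :: "'n::finite ambient"
  assumes c: "c = 1 \<or> c = -1" and g: "is_geodesic c \<gamma> \<gamma>'" and init: "\<gamma> 0 = z" "\<gamma>' 0 = v"
  shows "\<gamma> s = geod c z v s"
proof -
  note bb = bounded_bilinear.has_vector_derivative[OF bounded_bilinear_bil]
  have cc: "c * c = 1" "c * (c * r) = r" for r using c by auto
  define x y where "x s = horizontal (\<gamma> s)" and "y s = horizontal (\<gamma>' s)" for s
  have Q: "\<gamma> s \<in> QxR c" and d\<gamma>: "(\<gamma> has_vector_derivative \<gamma>' s) (at s)" for s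
    using g by (auto simp: is_geodesic_def)
  obtain a where da: "\<And>s. (\<gamma>' has_vector_derivative a s) (at s)" and "\<And>s. tan_proj c (\<gamma> s) (a s) = 0"
    using g unfolding is_geodesic_def by metis
  then have a: "a s = (c * bil c (x s) (a s)) *\<^sub>R x s" for s by (simp add: tan_proj_eq x_def)
  have dx: "(x has_vector_derivative y s) (at s)" for s
    unfolding x_def y_def by (rule bounded_linear.has_vector_derivative[OF bounded_linear_horizontal d\<gamma>])
  have "horizontal (a s) = a s" for s
    by (subst (1 2) a) (simp add: horizontal_simps x_def)
  then have dy: "(y has_vector_derivative a s) (at s)" for s
    using bounded_linear.has_vector_derivative[OF bounded_linear_horizontal da[of s]] by (simp add: y_def[abs_def])
  have xx: "bil c (x s) (x s) = c" for s unfolding x_def by (rule QxR_bil[OF Q])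
  have xy_yx: "bil c (x s) (y s) + bil c (y s) (x s) = 0" for s
    by (rule vector_derivative_const_zero[OF xx bb[OF dx dx]])
  have xy: "bil c (x s) (y s) = 0" for s
    using xy_yx[of s] bil_commute[of c "y s" "x s"] by simp
  have xa: "bil c (x s) (a s) = - bil c (y s) (y s)" for s
    using vector_derivative_const_zero[OF xy bb[OF dx dy], of s] by simp
  have "((\<lambda>s. bil c (y s) (y s)) has_vector_derivative 0) (at s)" for s
  proof -
    have ya: "bil c (y s) (a s) = 0"
      by (subst a) (use xy[of s] in \<open>simp add: bil_simps bil_commute[of c "y s" "x s"]\<close>)
    then show ?thesis using bb[OF dy[of s] dy[of s], of c] by (simp add: bil_commute[of c "a s" "y s"])
  qed
  from has_vector_derivative_0_constant[OF this]
  have yy: "bil c (y s) (y s) = bil c (y 0) (y 0)" for s .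
  define k where "k = bil c (horizontal v) (horizontal v)"
  have a_x: "a s = (- c * k) *\<^sub>R x s" for s
  proof -
    have "bil c (y s) (y s) = k" using yy[of s] by (simp add: k_def y_def init)
    then show ?thesis using a[of s] by (simp add: xa)
  qed
  have "bil c (horizontal (\<gamma> 0)) (\<gamma>' 0) = 0"
    using xy[of 0] by (simp add: x_def y_def bil_horizontal_horizontal(1))
  then have k: "k \<ge> 0"
    unfolding k_def init[symmetric]
    by (intro bil_horizontal_nonneg[OF c Q[of 0]]) (simp add: tangent_space_iff)
  define C S where "C = gcos c k" and "S = gsin c k"
  have dC: "(C has_vector_derivative - c * k * S s) (at s)" for s
    using gcos_derivative[OF c k] by (simp add: C_def S_def has_real_derivative_iff_has_vector_derivative)
  have dS: "(S has_vector_derivative C s) (at s)" for s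
    using gsin_derivative[OF c k] by (simp add: C_def S_def has_real_derivative_iff_has_vector_derivative)
  note sc = bounded_bilinear.has_vector_derivative[OF bounded_bilinear_scaleR]
  have "((\<lambda>s. C s *\<^sub>R x s - S s *\<^sub>R y s) has_vector_derivative 0) (at s)" for s
    using has_vector_derivative_diff[OF sc[OF dC[of s] dx] sc[OF dS[of s] dy]]
    by (simp add: a_x algebra_simps)
  from has_vector_derivative_0_constant[OF this, of s]
  have 1: "C s *\<^sub>R x s - S s *\<^sub>R y s = horizontal z" by (simp add: C_def S_def x_def init)
  have "((\<lambda>s. (c * k) *\<^sub>R (S s *\<^sub>R x s) + C s *\<^sub>R y s) has_vector_derivative 0) (at s)" for s
    using has_vector_derivative_add[OF
        bounded_linear.has_vector_derivative[OF bounded_linear_scaleR_right sc[OF dS[of s] dx], of "c * k"]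
        sc[OF dC[of s] dy]]
    by (simp add: a_x algebra_simps)
  from has_vector_derivative_0_constant[OF this, of s]
  have 2: "(c * k) *\<^sub>R (S s *\<^sub>R x s) + C s *\<^sub>R y s = horizontal v" by (simp add: C_def S_def y_def init)
  \<comment> \<open>Solves the two conserved quantities for \<open>x s\<close>; the determinant of
    the system is 1 by \<open>gcos_gsin\<close>.\<close>
  have "C s *\<^sub>R horizontal z + S s *\<^sub>R horizontal v = ((C s)\<^sup>2 + c * k * (S s)\<^sup>2) *\<^sub>R x s"
    unfolding 1[symmetric] 2[symmetric] by (simp add: algebra_simps power2_eq_square)
  then have X: "x s = C s *\<^sub>R horizontal z + S s *\<^sub>R horizontal v"
    using gcos_gsin[OF c k, of s] by (simp add: C_def S_def)
  have "snd (a s) = 0" for s using a_x[of s] by (simp add: x_def)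
  then have "((\<lambda>s. snd (\<gamma>' s)) has_vector_derivative 0) (at s)" for s
    using bounded_linear.has_vector_derivative[OF bounded_linear_snd da[of s]] by simp
  from has_vector_derivative_0_constant[OF this] have h': "snd (\<gamma>' s) = snd v" for s by (simp add: init)
  have "((\<lambda>s. snd (\<gamma> s) - s * snd v) has_vector_derivative snd (\<gamma>' s) - snd v) (at s)" for s
    by (intro has_vector_derivative_diff bounded_linear.has_vector_derivative[OF bounded_linear_snd d\<gamma>])
      (auto intro!: derivative_eq_intros)
  then have "((\<lambda>s. snd (\<gamma> s) - s * snd v) has_vector_derivative 0) (at s)" for s by (simp add: h')
  from has_vector_derivative_0_constant[OF this, of s] have "snd (\<gamma> s) = snd z + s * snd v"
    by (simp add: init)
  then show ?thesis
    using horizontal_decomp[of "\<gamma> s"] X by (simp add: geod_def Let_def k_def C_def S_def x_def)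
qed

lemma geod_0: "geod c z v 0 = z"
  using horizontal_decomp[of z] by (simp add: geod_def)

lemma exp_map_eq:
  assumes c: "c = 1 \<or> c = -1" and z: "z \<in> QxR c" and v: "v \<in> tangent_space c z"
  shows "exp_map c z v = geod c z v 1"
  unfolding exp_map_def
proof (rule the_equality)
  show "\<exists>\<gamma> \<gamma>'. is_geodesic c \<gamma> \<gamma>' \<and> \<gamma> 0 = z \<and> \<gamma>' 0 = v \<and> \<gamma> 1 = geod c z v 1"
    using geod_is_geodesic[OF assms] geod_0 by blast
next
  fix w
  assume "\<exists>\<gamma> \<gamma>'. is_geodesic c \<gamma> \<gamma>' \<and> \<gamma> 0 = z \<and> \<gamma>' 0 = v \<and> \<gamma> 1 = w"
  then show "w = geod c z v 1" using geodesic_unique[OF c] by blast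
qed

lemma exp_map_scaled:
  assumes c: "c = 1 \<or> c = -1" and z: "z \<in> QxR c" and v: "v \<in> tangent_space c z"
    and q: "q = bil c (horizontal v) (horizontal v)"
  shows "exp_map c z (t *\<^sub>R v) =
    gcos c q t *\<^sub>R horizontal z + gsin c q t *\<^sub>R horizontal v + (snd z + t * snd v) *\<^sub>R d_dt"
    and "exp_map c z (t *\<^sub>R v) \<in> QxR c"
proof -
  have tv: "t *\<^sub>R v \<in> tangent_space c z" using v by (simp add: tangent_space_iff bil_simps)
  have q0: "q \<ge> 0" unfolding q by (rule bil_horizontal_nonneg[OF c z v])
  have "bil c (horizontal (t *\<^sub>R v)) (horizontal (t *\<^sub>R v)) = t\<^sup>2 * q"
    by (simp add: horizontal_simps bil_simps q power2_eq_square)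
  moreover have "gsin c (t\<^sup>2 * q) 1 * t = gsin c q t"
    using gsin_rescale[OF q0, of t c] by (simp add: mult.commute)
  ultimately show "exp_map c z (t *\<^sub>R v) =
    gcos c q t *\<^sub>R horizontal z + gsin c q t *\<^sub>R horizontal v + (snd z + t * snd v) *\<^sub>R d_dt"
    by (simp add: exp_map_eq[OF c z tv] geod_def Let_def gcos_rescale[OF q0])
      (simp add: horizontal_simps)
  show "exp_map c z (t *\<^sub>R v) \<in> QxR c"
    unfolding exp_map_eq[OF c z tv] using geod_is_geodesic[OF c z tv] by (auto simp: is_geodesic_def)
qed

section \<open>Parallel hypersurfaces\<close>

definition tr :: "(real ^ 'n \<Rightarrow> real ^ 'n) \<Rightarrow> real" where
  "tr B = trace (matrix B)"

lemma tr_sum: "tr B = (\<Sum>i\<in>UNIV. B (axis i 1) $ i)"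
  by (simp add: tr_def trace_def matrix_def)

lemma tr_simps:
  "tr (\<lambda>X. B X + B' X) = tr B + tr B'" "tr (\<lambda>X. B X - B' X) = tr B - tr B'"
  "tr (\<lambda>X. r *\<^sub>R B X) = r * tr B"
  by (simp_all add: tr_sum sum.distrib sum_subtractf sum_distrib_left)

lemma tr_rank_one:
  assumes "linear h"
  shows "tr (\<lambda>X. h X *\<^sub>R Z) = h Z"
proof -
  have "h Z = h (\<Sum>i\<in>UNIV. Z $ i *\<^sub>R axis i 1)"
    by (simp add: basis_expansion scalar_mult_eq_scaleR[symmetric])
  then show ?thesis
    by (simp add: tr_sum linear_sum[OF assms] linear_scale[OF assms] mult.commute)
qed

text \<open>\<open>F'\<close> is the point at time \<open>t\<close> of the normal geodesic and
  \<open>N'\<close> its velocity; \<open>C\<close> and \<open>S\<close> stand for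
  \<open>gcos c q t\<close> and \<open>gsin c q t\<close>. As \<nu> is constant, so is the squared
  horizontal speed \<open>q\<close> of the normal, and these coefficients are not differentiated.
  The numbers \<open>C - S * l\<close> are nonzero away from focal points.\<close>

locale parallel_chart = three_curvature_chart c D F N l1 l2 l3
  for c and D :: "(real ^ 'n::finite) set" and F N :: "real ^ 'n \<Rightarrow> 'n ambient" and l1 l2 l3 :: real +
  fixes n0 t C S q :: real and F' N' :: "real ^ 'n \<Rightarrow> 'n ambient"
  assumes \<nu>_const: "u \<in> D \<Longrightarrow> \<nu> u = n0"
    and q: "q = 1 - n0\<^sup>2"
    and CS: "C\<^sup>2 + c * q * S\<^sup>2 = 1"
    and nondegenerate: "C - S * l1 \<noteq> 0" "C - S * l2 \<noteq> 0" "C - S * l3 \<noteq> 0"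
    and F': "u \<in> D \<Longrightarrow> F' u = C *\<^sub>R horizontal (F u) + S *\<^sub>R horizontal (N u) + (snd (F u) + t * n0) *\<^sub>R d_dt"
    and N': "u \<in> D \<Longrightarrow> N' u = (- c * q * S) *\<^sub>R horizontal (F u) + C *\<^sub>R horizontal (N u) + n0 *\<^sub>R d_dt"
    and F'_QxR: "u \<in> D \<Longrightarrow> F' u \<in> QxR c"
begin

lemma d\<nu>_0: "u \<in> D \<Longrightarrow> dd \<nu> u X = 0"
  by (rule dd_eq_0[OF open_D, where k = n0]) (auto simp: \<nu>_const)

lemma dh_A: assumes u: "u \<in> D" shows "dh u (A u X) = 0"
  using d\<nu>[OF u, of X] d\<nu>_0[OF u, of X] by simp

lemma A_T: assumes u: "u \<in> D" shows "A u (T u) = 0"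
proof -
  interpret self_adjoint_form "G u" "A u" by (rule self_adjoint_A[OF u])
  have "G u (A u (T u)) (A u (T u)) = 0"
    unfolding G_A[of "T u"] G_T(2)[OF u] by (rule dh_A[OF u])
  then show ?thesis by (simp add: G_eq_0_iff)
qed

lemma smooth_F': "smooth_on D F'"
proof (rule smooth_on_cong[OF open_D])
  show "smooth_on D (\<lambda>u. C *\<^sub>R horizontal (F u) + S *\<^sub>R horizontal (N u) + (snd (F u) + t * n0) *\<^sub>R d_dt)"
    by (intro smooth_intros)
qed (simp add: F')

lemma smooth_N': "smooth_on D N'"
proof (rule smooth_on_cong[OF open_D])
  show "smooth_on D (\<lambda>u. (- c * q * S) *\<^sub>R horizontal (F u) + C *\<^sub>R horizontal (N u) + n0 *\<^sub>R d_dt)"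
    by (intro smooth_intros)
qed (simp add: N')

lemma horizontal_dN: assumes u: "u \<in> D"
  shows "horizontal (dd N u X) = (c * n0 * dh u X) *\<^sub>R horizontal (F u) - dd F u (A u X)"
proof -
  have "snd (dd N u X) = dd \<nu> u X"
    unfolding \<nu>_def using dd_bounded_linear[OF bounded_linear_snd diff_N[OF u], of X] by simp
  then have "snd (dd N u X) = 0" using d\<nu>_0[OF u] by simp
  then have "horizontal (dd N u X) = dd N u X" using horizontal_decomp[of "dd N u X"] by simp
  then show ?thesis using dF_A[OF u, of X] \<nu>_const[OF u] by simp
qed

lemma horizontal_dF: "horizontal (dd F u X) = dd F u X - dh u X *\<^sub>R d_dt"
  using horizontal_decomp[of "dd F u X"] by (simp add: dh_def algebra_simps)

lemma horizontal_N: "u \<in> D \<Longrightarrow> horizontal (N u) = N u - n0 *\<^sub>R d_dt"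
  using horizontal_decomp[of "N u"] \<nu>_const[of u] by (simp add: \<nu>_def algebra_simps)

lemma dd_F':
  assumes u: "u \<in> D"
  shows "dd F' u X = C *\<^sub>R horizontal (dd F u X) + S *\<^sub>R horizontal (dd N u X) + dh u X *\<^sub>R d_dt"
proof -
  have bl: "bounded_linear (\<lambda>v :: 'n ambient. C *\<^sub>R horizontal v + snd v *\<^sub>R d_dt)"
    "bounded_linear (\<lambda>v :: 'n ambient. S *\<^sub>R horizontal v)"
    by (intro bounded_linear_add bounded_linear_const_scaleR bounded_linear_horizontal
        bounded_linear_scaleR_const bounded_linear_snd)+
  have "((\<lambda>u. (C *\<^sub>R horizontal (F u) + snd (F u) *\<^sub>R d_dt) + S *\<^sub>R horizontal (N u) + (t * n0) *\<^sub>R d_dt)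
    has_derivative (\<lambda>X. (C *\<^sub>R horizontal (dd F u X) + snd (dd F u X) *\<^sub>R d_dt) + S *\<^sub>R horizontal (dd N u X) + 0)) (at u)"
    by (intro has_derivative_add has_derivative_const bounded_linear.has_derivative[OF bl(1)]
        bounded_linear.has_derivative[OF bl(2)] smooth_on_has_derivative[OF _ u] smooth_F smooth_N)
  moreover have "dd F' u = dd (\<lambda>u. (C *\<^sub>R horizontal (F u) + snd (F u) *\<^sub>R d_dt) + S *\<^sub>R horizontal (N u) + (t * n0) *\<^sub>R d_dt) u"
    by (rule dd_cong[OF open_D u]) (simp add: F' algebra_simps)
  ultimately show ?thesis by (simp add: dd_eq dh_def)
qed

lemma dd_N':
  assumes u: "u \<in> D"
  shows "dd N' u X = (- c * q * S) *\<^sub>R horizontal (dd F u X) + C *\<^sub>R horizontal (dd N u X)"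
proof -
  have bl: "bounded_linear (\<lambda>v :: 'n ambient. r *\<^sub>R horizontal v)" for r
    by (intro bounded_linear_const_scaleR bounded_linear_horizontal)
  have "((\<lambda>u. (- c * q * S) *\<^sub>R horizontal (F u) + C *\<^sub>R horizontal (N u) + n0 *\<^sub>R d_dt)
    has_derivative (\<lambda>X. (- c * q * S) *\<^sub>R horizontal (dd F u X) + C *\<^sub>R horizontal (dd N u X) + 0)) (at u)"
    by (intro has_derivative_add has_derivative_const bounded_linear.has_derivative[OF bl]
        smooth_on_has_derivative[OF _ u] smooth_F smooth_N)
  moreover have "dd N' u = dd (\<lambda>u. (- c * q * S) *\<^sub>R horizontal (F u) + C *\<^sub>R horizontal (N u) + n0 *\<^sub>R d_dt) u"
    by (rule dd_cong[OF open_D u]) (rule N')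
  ultimately show ?thesis by (simp only: dd_eq add_0_right)
qed

lemma bil_horizontals:
  assumes u: "u \<in> D"
  shows "bil c (horizontal (F u)) (horizontal (F u)) = c"
    "bil c (horizontal (F u)) (horizontal (N u)) = 0" "bil c (horizontal (N u)) (horizontal (F u)) = 0"
    "bil c (horizontal (N u)) (horizontal (N u)) = q"
    "bil c (horizontal (dd F u X)) (horizontal (F u)) = 0"
    "bil c (horizontal (dd F u X)) (horizontal (N u)) = - n0 * dh u X"
    "bil c (horizontal (dd N u X)) (horizontal (F u)) = n0 * dh u X"
    "bil c (horizontal (dd N u X)) (horizontal (N u)) = 0"
proof -
  show 1: "bil c (horizontal (F u)) (horizontal (F u)) = c" by (rule x_x[OF u])
  show "bil c (horizontal (F u)) (horizontal (N u)) = 0"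
    using x_N[OF u] by (simp add: bil_horizontal_horizontal(1))
  then show "bil c (horizontal (N u)) (horizontal (F u)) = 0" by (simp add: bil_commute)
  show "bil c (horizontal (N u)) (horizontal (N u)) = q"
    by (simp add: horizontal_N[OF u] bil_simps bil_d_dt N_N[OF u] q \<nu>_const[OF u, unfolded \<nu>_def] power2_eq_square)
  show 5: "bil c (horizontal (dd F u X)) (horizontal (F u)) = 0" for X
    using dF_x[OF u, of X] by (simp add: bil_horizontal_horizontal(2))
  show 6: "bil c (horizontal (dd F u X)) (horizontal (N u)) = - n0 * dh u X" for X
    by (simp add: horizontal_N[OF u] horizontal_dF bil_simps bil_d_dt dF_N[OF u] dh_def
        \<nu>_const[OF u, unfolded \<nu>_def])
  have 7: "bil c (dd F u Y) (horizontal (N u)) = - n0 * dh u Y" for Y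
    using 6[of Y] by (simp add: horizontal_dF bil_simps bil_d_dt)
  show "bil c (horizontal (dd N u X)) (horizontal (F u)) = n0 * dh u X"
    unfolding horizontal_dN[OF u] by (simp add: bil_simps 1 dF_x[OF u] c_c)
  show "bil c (horizontal (dd N u X)) (horizontal (N u)) = 0"
    unfolding horizontal_dN[OF u]
    using x_N[OF u] by (simp add: bil_simps 7 dh_A[OF u] bil_horizontal_horizontal(1))
qed

lemma bil_d_dt_horizontal: "bil c (horizontal v) d_dt = 0" "bil c d_dt (horizontal v) = 0" "bil c d_dt d_dt = 1"
  by (simp_all add: bil_d_dt)

lemma horizontal_F': "u \<in> D \<Longrightarrow> horizontal (F' u) = C *\<^sub>R horizontal (F u) + S *\<^sub>R horizontal (N u)"
  by (simp add: F' horizontal_simps)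

lemma eigenvalue_nondegenerate:
  assumes "u \<in> D" "X \<noteq> 0" "C *\<^sub>R X = S *\<^sub>R A u X"
  shows False
proof (cases "S = 0")
  case True
  then show False using assms CS by simp
next
  case False
  have "A u X = (C / S) *\<^sub>R X"
    using arg_cong[OF assms(3), of "\<lambda>Y. (1 / S) *\<^sub>R Y"] False by simp
  from eigenvalues[OF assms(1,2) this] show False
    using nondegenerate False by auto
qed

lemma parallel_hypersurface: "hypersurface_chart c D F' N'"
proof
  fix u assume u: "u \<in> D"
  note b = bil_horizontals[OF u] bil_d_dt_horizontal
  show "F' u \<in> QxR c" by (rule F'_QxR[OF u])
  show "inj (dd F' u)"
    unfolding linear_injective_0[OF smooth_on_linear_dd[OF smooth_F' u]]
  proof (intro allI impI)
    \<comment> \<open>The \<open>d_dt\<close>-component gives \<open>dh u X = 0\<close>; what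
      remains says that \<open>C *\<^sub>R X = S *\<^sub>R A u X\<close>.\<close>
    fix X assume 0: "dd F' u X = 0"
    then have "snd (dd F' u X) = 0" by simp
    then have h: "dh u X = 0" by (simp add: dd_F'[OF u])
    have "dd F u (C *\<^sub>R X - S *\<^sub>R A u X) = dd F u 0"
      using 0 by (simp add: dd_F'[OF u] horizontal_dF horizontal_dN[OF u] h dF_simps[OF u])
    then have "C *\<^sub>R X = S *\<^sub>R A u X" using injD[OF inj_dF[OF u]] by fastforce
    then show "X = 0" using eigenvalue_nondegenerate[OF u] by blast
  qed
  show "bil c (horizontal (F' u)) (N' u) = 0"
    unfolding horizontal_F'[OF u] N'[OF u] using c_c
    by (simp add: bil_simps b algebra_simps)
  have "bil c (N' u) (N' u) = q * (C\<^sup>2 + (c * c) * (c * q * S\<^sup>2)) + n0\<^sup>2"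
    unfolding N'[OF u] by (simp add: bil_simps b algebra_simps power2_eq_square)
  then show "bil c (N' u) (N' u) = 1" using CS by (simp add: c_c(1) q)
  fix X
  have "bil c (dd F' u X) (N' u) = n0 * dh u X * (1 - (C\<^sup>2 + c * q * S\<^sup>2))"
    unfolding N'[OF u] dd_F'[OF u] by (simp add: bil_simps b algebra_simps power2_eq_square)
  then show "bil c (dd F' u X) (N' u) = 0" by (simp add: CS)
qed (use c open_D smooth_F' smooth_N' in auto)

sublocale par: hypersurface_chart c D F' N'
  by (rule parallel_hypersurface)

text \<open>On an eigenvector \<open>X\<close> for \<open>l\<close> orthogonal to \<open>T\<close>,
  the derivatives of \<open>F'\<close> and \<open>- N'\<close> are \<open>C - S * l\<close> and
  \<open>c * q * S + C * l\<close> times \<open>dd F u X\<close>; their quotient is the principal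
  curvature of the parallel hypersurface.\<close>

definition "\<phi> l = (c * q * S + C * l) / (C - S * l)"

definition "R u X = \<phi> l1 *\<^sub>R eigenproj (A u) l1 l2 l3 X + \<phi> l2 *\<^sub>R eigenproj (A u) l2 l3 l1 X
  + \<phi> l3 *\<^sub>R eigenproj (A u) l3 l1 l2 X"

lemma R_eq: assumes u: "u \<in> D" shows "C *\<^sub>R R u X - S *\<^sub>R A u (R u X) = (c * q * S) *\<^sub>R X + C *\<^sub>R A u X"
proof -
  define X1 X2 X3 where "X1 = eigenproj (A u) l1 l2 l3 X" and "X2 = eigenproj (A u) l2 l3 l1 X"
    and "X3 = eigenproj (A u) l3 l1 l2 X"
  have X: "X = X1 + X2 + X3" using decompose[OF u, of X] by (simp add: P_def X1_def X2_def X3_def)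
  have AX: "A u X1 = l1 *\<^sub>R X1" "A u X2 = l2 *\<^sub>R X2" "A u X3 = l3 *\<^sub>R X3"
    using A_P[OF u] A_eigenproj23[OF u] by (simp_all add: P_def X1_def X2_def X3_def)
  have \<phi>: "\<phi> l * (C - S * l) = c * q * S + C * l" if "C - S * l \<noteq> 0" for l
    using that by (simp add: \<phi>_def)
  have "C *\<^sub>R R u X - S *\<^sub>R A u (R u X) = (\<phi> l1 * (C - S * l1)) *\<^sub>R X1 + (\<phi> l2 * (C - S * l2)) *\<^sub>R X2
      + (\<phi> l3 * (C - S * l3)) *\<^sub>R X3"
    unfolding R_def X1_def[symmetric] X2_def[symmetric] X3_def[symmetric]
    by (simp add: linear_add[OF linear_A[OF u]] linear_scale[OF linear_A[OF u]] AX algebra_simps)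
  also have "\<dots> = (c * q * S) *\<^sub>R (X1 + X2 + X3) + C *\<^sub>R (A u X1 + A u X2 + A u X3)"
    unfolding \<phi>[OF nondegenerate(1)] \<phi>[OF nondegenerate(2)] \<phi>[OF nondegenerate(3)] AX
    by (simp add: algebra_simps)
  also have "\<dots> = (c * q * S) *\<^sub>R X + C *\<^sub>R A u X"
    by (simp add: X linear_add[OF linear_A[OF u]])
  finally show ?thesis .
qed

text \<open>\<open>R\<close> is right only on directions orthogonal to \<open>T\<close>. Since
  \<open>A T = 0\<close>, it multiplies \<open>T\<close> by \<open>c * q * S / C\<close>, whereas
  the parallel hypersurface again has constant angle and its shape operator annihilates
  \<open>T\<close>. The rank-one term corrects this.\<close>

lemma parallel_shape_operator:
  assumes u: "u \<in> D"
  shows "par.A u X = R u X - (c * S / C * dh u X) *\<^sub>R T u"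
proof -
  define k where "k = c * S / C * dh u X"
  define Y where "Y = R u X - k *\<^sub>R T u"
  have hT: "dh u (T u) = q" using dh_T[OF u] by (simp add: q \<nu>_const[OF u])
  \<comment> \<open>A nonzero \<open>T\<close> makes 0 a principal curvature, so
    \<open>C = 0\<close> would be a focal point. If \<open>T u = 0\<close>, then \<open>dh\<close>
    vanishes and the quotient by \<open>C\<close> does not matter.\<close>
  have C_T: "C \<noteq> 0 \<or> T u = 0"
    using eigenvalue_nondegenerate[OF u, of "T u"] A_T[OF u] by auto
  have dh0: "dh u Z = 0" if "T u = 0" for Z
    using G_T(1)[OF u, of Z] that by (simp add: inner_form.G_simps[OF inner_form_G[OF u]])
  have Ck: "C * k = c * S * dh u X" using C_T dh0[of X] by (auto simp: k_def)
  have "C * dh u (R u X) = c * q * S * dh u X"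
    using arg_cong[OF R_eq[OF u, of X], of "dh u"]
    by (simp add: dh_add[OF u] dh_diff[OF u] dh_scale[OF u] dh_A[OF u])
  then have "C * dh u Y = 0"
    using Ck by (simp add: Y_def dh_diff[OF u] dh_scale[OF u] hT algebra_simps)
  then have hY: "dh u Y = 0" using C_T dh0[of Y] by auto
  have "C *\<^sub>R Y - S *\<^sub>R A u Y = (C *\<^sub>R R u X - S *\<^sub>R A u (R u X)) - (C * k) *\<^sub>R T u"
    by (simp add: Y_def linear_diff[OF linear_A[OF u]] linear_scale[OF linear_A[OF u]] A_T[OF u] algebra_simps)
  also have "\<dots> = (c * q * S) *\<^sub>R X + C *\<^sub>R A u X - (c * S * dh u X) *\<^sub>R T u"
    unfolding R_eq[OF u] Ck ..
  finally have CY: "C *\<^sub>R Y - S *\<^sub>R A u Y = (c * q * S) *\<^sub>R X + C *\<^sub>R A u X - (c * S * dh u X) *\<^sub>R T u" .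
  have "dd F' u Y = dd F u (C *\<^sub>R Y - S *\<^sub>R A u Y)"
    by (simp add: dd_F'[OF u] horizontal_dF horizontal_dN[OF u] hY dF_simps[OF u])
  then have F'Y: "dd F' u Y = (c * q * S) *\<^sub>R dd F u X + C *\<^sub>R dd F u (A u X)
      - (c * S * dh u X) *\<^sub>R (d_dt - n0 *\<^sub>R N u)"
    unfolding CY by (simp add: dF_simps[OF u] dF_T[OF u] \<nu>_const[OF u])
  have N'X: "dd N' u X = (- c * q * S) *\<^sub>R (dd F u X - dh u X *\<^sub>R d_dt)
      + C *\<^sub>R ((c * n0 * dh u X) *\<^sub>R horizontal (F u) - dd F u (A u X))"
    unfolding dd_N'[OF u] horizontal_dF horizontal_dN[OF u] ..
  \<comment> \<open>The sum is a multiple of the normal of \<open>QxR c\<close> at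
    \<open>F' u\<close>, which \<open>tan_proj\<close> discards.\<close>
  have "dd F' u Y + dd N' u X = (c * n0 * dh u X) *\<^sub>R
      (C *\<^sub>R horizontal (F u) + S *\<^sub>R (N u - n0 *\<^sub>R d_dt))"
    unfolding F'Y N'X by (simp add: q algebra_simps power2_eq_square)
  also have "\<dots> = (c * n0 * dh u X) *\<^sub>R horizontal (F' u)"
    by (simp add: horizontal_F'[OF u] horizontal_N[OF u])
  finally have N'X: "dd N' u X = (c * n0 * dh u X) *\<^sub>R horizontal (F' u) - dd F' u Y"
    by (simp add: algebra_simps)
  have "tan_proj c (F' u) (dd N' u X) = - dd F' u Y"
    unfolding tan_proj_eq N'X using c
    by (auto simp: bil_simps par.x_x[OF u] par.x_dF[OF u])
  then show ?thesis
    using par.A_unique[OF u, of Y X] by (simp add: Y_def k_def)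
qed

lemma parallel_trace:
  assumes u: "u \<in> D"
  shows "tr (par.A u) = \<phi> l1 * tr (eigenproj (A u) l1 l2 l3) + \<phi> l2 * tr (eigenproj (A u) l2 l3 l1)
    + \<phi> l3 * tr (eigenproj (A u) l3 l1 l2) - c * S / C * q"
proof -
  have l: "linear (\<lambda>X. c * S / C * dh u X)"
    by (intro linearI) (simp_all add: dh_add[OF u] dh_scale[OF u] distrib_left)
  have hT: "dh u (T u) = q" using dh_T[OF u] by (simp add: q \<nu>_const[OF u])
  have "par.A u = (\<lambda>X. R u X - (c * S / C * dh u X) *\<^sub>R T u)"
    by (rule ext) (rule parallel_shape_operator[OF u])
  then have "tr (par.A u) = tr (R u) - c * S / C * q"
    by (simp only: tr_simps(2) tr_rank_one[OF l] hT)
  moreover have "tr (R u) = \<phi> l1 * tr (eigenproj (A u) l1 l2 l3) + \<phi> l2 * tr (eigenproj (A u) l2 l3 l1)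
    + \<phi> l3 * tr (eigenproj (A u) l3 l1 l2)"
    unfolding R_def[abs_def] tr_simps ..
  ultimately show ?thesis by simp
qed

end

section \<open>Local constancy of the angle function and of the traces\<close>

context three_curvature_chart
begin

text \<open>Eigenvectors span, so fewer eigenvalues than dimensions leave a multiple one; the
  rotated locales \<open>R\<close> and \<open>Q\<close> move it to the first place, where
  \<open>angle_if_multiple\<close> expects it.\<close>

lemma angle_value:
  assumes u: "u \<in> D"
    and L: "\<And>y. y \<in> D \<Longrightarrow> {l. \<exists>X. X \<noteq> 0 \<and> A y X = l *\<^sub>R X} = L" "L \<subseteq> {l1, l2, l3}"
    and cases: "card L < CARD('n) \<or> (CARD('n) = 2 \<and> L = {l2, l3})"
  shows "(\<nu> u)\<^sup>2 \<in> angle_values c {l1, l2, l3}"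
proof -
  have ev: "l \<in> L" if "y \<in> D" "X \<noteq> 0" "A y X = l *\<^sub>R X" for y X l using L(1)[OF that(1)] that(2,3) by blast
  interpret R: three_curvature_chart c D F N l2 l3 l1 by (rule rotate_chart)
  interpret Q: three_curvature_chart c D F N l3 l1 l2 by (rule R.rotate_chart)
  from cases show ?thesis
  proof
    assume card: "card L < CARD('n)"
    have in_E: "Z \<in> span (\<Union>l\<in>L. {X. A u X = l *\<^sub>R X})" if "A u Z = l *\<^sub>R Z" for Z l
      using ev[OF u _ that] that by (cases "Z = 0") (auto intro: span_base simp: span_zero)
    have "X \<in> span (\<Union>l\<in>L. {X. A u X = l *\<^sub>R X})" for X
      by (subst decompose[OF u, of X, symmetric], intro span_add)
        (rule in_E, rule A_P[OF u] A_eigenproj23(1)[OF u] A_eigenproj23(2)[OF u])+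
    then have "UNIV \<subseteq> span (\<Union>l\<in>L. {X. A u X = l *\<^sub>R X})" by blast
    from multiple_eigenvalue[OF finite_subset[OF L(2)] _ this] card
    obtain l X Y where l: "l \<in> L" and X: "X \<noteq> 0" "A u X = l *\<^sub>R X"
      and Y: "A u Y = l *\<^sub>R Y" "\<And>r. Y \<noteq> r *\<^sub>R X" by auto
    from l L(2) consider "l = l1" | "l = l2" | "l = l3" by blast
    then show ?thesis
    proof cases
      case 1
      then show ?thesis using angle_if_multiple[OF u X(1) _ _ Y(2)] X(2) Y(1) by simp
    next
      case 2
      then show ?thesis using R.angle_if_multiple[OF u X(1) _ _ Y(2)] X(2) Y(1)
        by (simp add: insert_commute)
    next
      case 3
      then show ?thesis using Q.angle_if_multiple[OF u X(1) _ _ Y(2)] X(2) Y(1)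
        by (simp add: insert_commute)
    qed
  next
    assume *: "CARD('n) = 2 \<and> L = {l2, l3}"
    then obtain X2 X3 where "X2 \<noteq> 0" "A u X2 = l2 *\<^sub>R X2" "X3 \<noteq> 0" "A u X3 = l3 *\<^sub>R X3"
      using L(1)[OF u] by blast
    moreover have "A y X \<noteq> l1 *\<^sub>R X" if "y \<in> D" "X \<noteq> 0" for y X
      using ev[OF that, of l1] * distinct_l by auto
    ultimately show ?thesis using angle_if_dim2[OF _ u] * by blast
  qed
qed

text \<open>The image of a ball is connected and contained in the finite set of square roots of the
  candidates.\<close>

lemma angle_locally_constant:
  assumes u: "u \<in> D"
    and L: "\<And>y. y \<in> D \<Longrightarrow> {l. \<exists>X. X \<noteq> 0 \<and> A y X = l *\<^sub>R X} = L" "L \<subseteq> {l1, l2, l3}"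
    and cases: "card L < CARD('n) \<or> (CARD('n) = 2 \<and> L = {l2, l3})"
  shows "\<exists>S. open S \<and> u \<in> S \<and> S \<subseteq> D \<and> \<nu> constant_on S"
proof -
  obtain e where e: "e > 0" "ball u e \<subseteq> D" using open_D u open_contains_ball by blast
  define V where "V = angle_values c {l1, l2, l3}"
  have "finite V" unfolding V_def by (simp add: finite_angle_values)
  then have fin: "finite (sqrt ` V \<union> (\<lambda>w. - sqrt w) ` V)" by simp
  have sub: "\<nu> ` ball u e \<subseteq> sqrt ` V \<union> (\<lambda>w. - sqrt w) ` V"
  proof
    fix r assume "r \<in> \<nu> ` ball u e"
    then obtain y where "y \<in> D" "r = \<nu> y" using e by blast
    then have "r\<^sup>2 \<in> V" unfolding V_def using angle_value[OF _ L cases] by blast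
    moreover have "r = sqrt (r\<^sup>2) \<or> r = - sqrt (r\<^sup>2)" by (simp add: real_sqrt_abs abs_real_def)
    ultimately show "r \<in> sqrt ` V \<union> (\<lambda>w. - sqrt w) ` V" by blast
  qed
  have "connected (\<nu> ` ball u e)"
    using smooth_on_continuous_on[OF smooth_\<nu>] e
    by (intro connected_continuous_image) (auto intro: continuous_on_subset)
  then have "\<nu> ` ball u e = {} \<or> (\<exists>r. \<nu> ` ball u e = {r})"
    using finite_subset[OF sub fin] by (metis connected_finite_iff_sing)
  then have "\<nu> constant_on ball u e" unfolding constant_on_def by blast
  then show ?thesis using e by (intro exI[of _ "ball u e"]) auto
qed

lemma trace_locally_constant:
  assumes u: "u \<in> D"
  shows "\<exists>S. open S \<and> u \<in> S \<and> S \<subseteq> D \<and> (\<lambda>y. tr (eigenproj (A y) l1 l2 l3)) constant_on S"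
proof -
  obtain e where e: "e > 0" "ball u e \<subseteq> D" using open_D u open_contains_ball by blast
  have "(\<lambda>y. tr (eigenproj (A y) l1 l2 l3)) constant_on ball u e"
    unfolding tr_def
    using e smooth_on_subset[OF smooth_eigenproj[OF smooth_on_const] e(2)]
      linear_eigenproj[OF linear_A]
      three_eigenvalues.eigenproj_idem[OF three_eigenvalues]
    by (intro trace_idempotent_constant) auto
  then show ?thesis using e by (intro exI[of _ "ball u e"]) auto
qed

end

section \<open>Hypersurfaces of a manifold\<close>

locale manifold =
  fixes M :: "'m topology" and \<A> :: "('n::finite, 'm) atlas"
  assumes smooth_manifold: "smooth_manifold M \<A>"
begin

lemma chart:
  assumes "(D, y) \<in> \<A>"
  shows "open D" "openin M (y ` D)" "homeomorphic_map (top_of_set D) (subtopology M (y ` D)) y"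
    "inj_on y D"
proof -
  show "open D" "openin M (y ` D)"
    and h: "homeomorphic_map (top_of_set D) (subtopology M (y ` D)) y"
    using smooth_manifold assms unfolding smooth_manifold_def by fast+
  show "inj_on y D" using homeomorphic_imp_injective_map[OF h] by simp
qed

lemma chart_in_M: "(D, y) \<in> \<A> \<Longrightarrow> u \<in> D \<Longrightarrow> y u \<in> topspace M"
  using openin_subset[OF chart(2)] by blast

lemma chart_exists: "p \<in> topspace M \<Longrightarrow> \<exists>D y u. (D, y) \<in> \<A> \<and> u \<in> D \<and> p = y u"
  using smooth_manifold unfolding smooth_manifold_def by blast

lemma transition_smooth:
  "(D, y) \<in> \<A> \<Longrightarrow> (E, z) \<in> \<A> \<Longrightarrow> smooth_on {u\<in>D. y u \<in> z ` E} (\<lambda>u. inv_into E z (y u))"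
  using smooth_manifold unfolding smooth_manifold_def by fast

lemma open_chart_image:
  assumes "(D, y) \<in> \<A>" "open S" "S \<subseteq> D"
  shows "openin M (y ` S)"
proof -
  have "openin (top_of_set D) S" using assms(2,3) by (simp add: openin_open_eq chart(1)[OF assms(1)])
  then have "openin (subtopology M (y ` D)) (y ` S)"
    using homeomorphic_imp_open_map[OF chart(3)[OF assms(1)]] by (simp add: open_map_def)
  then show ?thesis using chart(2)[OF assms(1)] openin_trans_full by blast
qed

lemma open_chart_preimage:
  assumes "(D, y) \<in> \<A>" "openin M W"
  shows "open {u\<in>D. y u \<in> W}"
proof -
  have "continuous_map (top_of_set D) M y"
    using homeomorphic_imp_continuous_map[OF chart(3)[OF assms(1)]]
    by (simp add: continuous_map_in_subtopology)
  from openin_continuous_map_preimage[OF this assms(2)]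
  have "openin (top_of_set D) {u\<in>D. y u \<in> W}" by simp
  then show ?thesis using openin_open_trans chart(1)[OF assms(1)] by blast
qed

lemma param_at:
  assumes "p \<in> topspace M"
  obtains E z where "param_at \<A> p = (E, z)" "(E, z) \<in> \<A>" "p \<in> z ` E"
proof -
  have "\<exists>P. P \<in> \<A> \<and> p \<in> snd P ` fst P"
    using chart_exists[OF assms] by force
  from someI_ex[OF this] show ?thesis
    using that unfolding param_at_def[symmetric] by (cases "param_at \<A> p") auto
qed

text \<open>\<open>differential\<close> uses the parametrization picked by \<open>param_at\<close>,
  not the given one. \<open>J\<close> is the derivative of the transition map from the former to the
  latter and \<open>K\<close> its inverse. Neither depends on \<open>h\<close>, so passing to the
  given chart conjugates all operators by the same maps.\<close>

lemma differential_in_chart: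
  assumes D: "(D, y) \<in> \<A>" and u: "u \<in> D"
  obtains J K where "linear J" "linear K" "\<And>X. J (K X) = X" "\<And>X. K (J X) = X"
    "\<And>(h :: 'm \<Rightarrow> 'b::real_normed_vector) X. (h \<circ> y) differentiable (at u) \<Longrightarrow>
      differential \<A> h (y u) X = dd (h \<circ> y) u (J X)"
proof -
  obtain E z where Ez: "param_at \<A> (y u) = (E, z)" and E: "(E, z) \<in> \<A>" and "y u \<in> z ` E"
    using param_at chart_in_M[OF D u] by blast
  define v where "v = inv_into E z (y u)"
  have v: "v \<in> E" "z v = y u" using \<open>y u \<in> z ` E\<close> by (auto simp: v_def inv_into_into f_inv_into_f)
  define W1 where "W1 = {v\<in>E. z v \<in> y ` D}"
  define W2 where "W2 = {u\<in>D. y u \<in> z ` E}"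
  have W: "open W1" "v \<in> W1" "open W2" "u \<in> W2"
    unfolding W1_def W2_def
    using open_chart_preimage[OF E chart(2)[OF D]] open_chart_preimage[OF D chart(2)[OF E]]
      v u \<open>y u \<in> z ` E\<close> by auto
  define \<phi> where "\<phi> v = inv_into D y (z v)" for v
  define \<psi> where "\<psi> u = inv_into E z (y u)" for u
  have s: "smooth_on W1 \<phi>" "smooth_on W2 \<psi>"
    unfolding W1_def W2_def \<phi>_def \<psi>_def using transition_smooth[OF E D] transition_smooth[OF D E] by auto
  have \<phi>v: "\<phi> v = u" and \<psi>u: "\<psi> u = v"
    using inv_into_f_f[OF chart(4)[OF D] u] v by (simp_all add: \<phi>_def \<psi>_def v_def)
  have inv: "\<phi> (\<psi> w) = w" if "w \<in> W2" for w
    using that inv_into_f_f[OF chart(4)[OF D]] by (simp add: W2_def \<phi>_def \<psi>_def f_inv_into_f)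
  have inv': "\<psi> (\<phi> w) = w" if "w \<in> W1" for w
    using that inv_into_f_f[OF chart(4)[OF E]] by (simp add: W1_def \<phi>_def \<psi>_def f_inv_into_f)
  define J K where "J = dd \<phi> v" and "K = dd \<psi> u"
  have dJ: "(\<phi> has_derivative J) (at v)" and dK: "(\<psi> has_derivative K) (at u)"
    unfolding J_def K_def using smooth_on_has_derivative s W by blast+
  have "((\<lambda>w. \<phi> (\<psi> w)) has_derivative (\<lambda>X. J (K X))) (at u)"
    by (rule has_derivative_compose[OF dK]) (simp add: \<psi>u dJ)
  then have "((\<lambda>w. w) has_derivative (\<lambda>X. J (K X))) (at u)"
    by (rule has_derivative_transform_within_open[OF _ W(3,4)]) (rule inv)
  from fun_cong[OF has_derivative_unique[OF this has_derivative_ident]]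
  have JK: "J (K X) = X" for X .
  have "((\<lambda>w. \<psi> (\<phi> w)) has_derivative (\<lambda>X. K (J X))) (at v)"
    by (rule has_derivative_compose[OF dJ]) (simp add: \<phi>v dK)
  then have "((\<lambda>w. w) has_derivative (\<lambda>X. K (J X))) (at v)"
    by (rule has_derivative_transform_within_open[OF _ W(1,2)]) (rule inv')
  from fun_cong[OF has_derivative_unique[OF this has_derivative_ident]]
  have KJ: "K (J X) = X" for X .
  have diff: "differential \<A> h (y u) X = dd (h \<circ> y) u (J X)"
    if "(h \<circ> y) differentiable (at u)" for h :: "'m \<Rightarrow> 'b" and X
  proof -
    have "((h \<circ> y) has_derivative dd (h \<circ> y) u) (at (\<phi> v))"
      unfolding \<phi>v using that frechet_derivative_works by blast
    from has_derivative_compose[OF dJ this]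
    have "((\<lambda>w. (h \<circ> y) (\<phi> w)) has_derivative (\<lambda>X. dd (h \<circ> y) u (J X))) (at v)" .
    then have "((h \<circ> z) has_derivative (\<lambda>X. dd (h \<circ> y) u (J X))) (at v)"
    proof (rule has_derivative_transform_within_open[OF _ W(1,2)])
      fix w assume "w \<in> W1"
      then have "y (\<phi> w) = z w" by (simp add: W1_def \<phi>_def f_inv_into_f)
      then show "(h \<circ> y) (\<phi> w) = (h \<circ> z) w" by simp
    qed
    then show ?thesis by (simp add: differential_def Ez dd_eq v_def[symmetric])
  qed
  show ?thesis
    by (rule that[OF has_derivative_linear[OF dJ] has_derivative_linear[OF dK] JK KJ diff])
qed

lemma locally_constant_imp_constant_on:
  fixes h :: "'m \<Rightarrow> 'b"
  assumes conn: "connected_space M"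
    and loc: "\<And>D y u. (D, y) \<in> \<A> \<Longrightarrow> u \<in> D \<Longrightarrow> \<exists>S. open S \<and> u \<in> S \<and> S \<subseteq> D \<and> (\<lambda>u. h (y u)) constant_on S"
  shows "h constant_on topspace M"
proof (cases "topspace M = {}")
  case False
  then obtain p0 where p0: "p0 \<in> topspace M" by blast
  \<comment> \<open>For an arbitrary predicate, so that both a level set and its complement are
    covered.\<close>
  have op: "openin M {p \<in> topspace M. Q (h p)}" for Q
  proof (subst openin_subopen, intro ballI)
    fix p assume p: "p \<in> {p \<in> topspace M. Q (h p)}"
    then obtain D y u where D: "(D, y) \<in> \<A>" and u: "u \<in> D" "p = y u" using chart_exists by blast
    obtain S where S: "open S" "u \<in> S" "S \<subseteq> D" and const: "(\<lambda>u. h (y u)) constant_on S"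
      using loc[OF D u(1)] by blast
    have "h (y w) = h p" if "w \<in> S" for w using const S(2) that u(2) by (metis constant_on_def)
    then have "y ` S \<subseteq> {p \<in> topspace M. Q (h p)}" using p S(3) chart_in_M[OF D] by auto
    then show "\<exists>W. openin M W \<and> p \<in> W \<and> W \<subseteq> {p \<in> topspace M. Q (h p)}"
      using open_chart_image[OF D S(1,3)] S(2) u(2) by blast
  qed
  have "openin M {p \<in> topspace M. h p = h p0}" "openin M {p \<in> topspace M. h p \<noteq> h p0}"
    by (rule op)+
  moreover have "topspace M \<subseteq> {p \<in> topspace M. h p = h p0} \<union> {p \<in> topspace M. h p \<noteq> h p0}"
    "{p \<in> topspace M. h p = h p0} \<inter> {p \<in> topspace M. h p \<noteq> h p0} = {}"
    by blast+
  moreover have "{p \<in> topspace M. h p = h p0} \<noteq> {}" using p0 by blast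
  ultimately have "{p \<in> topspace M. h p \<noteq> h p0} = {}"
    using conn unfolding connected_space_def by blast
  then show ?thesis unfolding constant_on_def by blast
qed (simp add: constant_on_def)

lemma hypersurface_on_imp_chart:
  assumes c: "c = 1 \<or> c = -1" and H: "hypersurface_on \<A> c (topspace M) f \<eta>" and D: "(D, y) \<in> \<A>"
  shows "hypersurface_chart c D (f \<circ> y) (\<eta> \<circ> y)"
proof -
  note h = H[unfolded hypersurface_on_def]
  have "{u \<in> D. y u \<in> topspace M} = D" using chart_in_M[OF D] by blast
  then have s: "smooth_on D (f \<circ> y)" "smooth_on D (\<eta> \<circ> y)"
    using h D unfolding smooth_map_on_def by fastforce+
  show ?thesis
  proof
    fix u assume u: "u \<in> D"
    note p = chart_in_M[OF D u]
    obtain J K where JK: "linear J" "linear K" "\<And>X. J (K X) = X" "\<And>X. K (J X) = X"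
      and diff: "\<And>(h :: 'm \<Rightarrow> 'n ambient) X. (h \<circ> y) differentiable (at u) \<Longrightarrow>
        differential \<A> h (y u) X = dd (h \<circ> y) u (J X)"
      using differential_in_chart[OF D u] by blast
    have df: "dd (f \<circ> y) u X = differential \<A> f (y u) (K X)" for X
      using diff[OF smooth_on_differentiable[OF s(1) u], of "K X"] JK(3) by simp
    show "(f \<circ> y) u \<in> QxR c" using h p by auto
    show "inj (dd (f \<circ> y) u)"
    proof (rule injI)
      fix X Y assume "dd (f \<circ> y) u X = dd (f \<circ> y) u Y"
      then have "K X = K Y" using h p unfolding df by (meson injD)
      then show "X = Y" using JK(3) by metis
    qed
    show "bil c (horizontal ((f \<circ> y) u)) ((\<eta> \<circ> y) u) = 0"
      using h p by (simp add: tangent_space_iff)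
    show "bil c ((\<eta> \<circ> y) u) ((\<eta> \<circ> y) u) = 1" using h p by simp
    show "bil c (dd (f \<circ> y) u X) ((\<eta> \<circ> y) u) = 0" for X using h p by (simp add: df)
  qed (use c chart(1)[OF D] s in auto)
qed

lemma hypersurface_on_if_charts:
  assumes H: "\<And>D y. (D, y) \<in> \<A> \<Longrightarrow> hypersurface_chart c D (f \<circ> y) (\<eta> \<circ> y)"
  shows "hypersurface_on \<A> c (topspace M) f \<eta>"
  unfolding hypersurface_on_def
proof (intro conjI)
  have eq: "{u \<in> D. y u \<in> topspace M} = D" if "(D, y) \<in> \<A>" for D y using chart_in_M[OF that] by blast
  show "smooth_map_on \<A> (topspace M) f" "smooth_map_on \<A> (topspace M) \<eta>"
    unfolding smooth_map_on_def
    using hypersurface_chart.smooth_F[OF H] hypersurface_chart.smooth_N[OF H] by (auto simp: eq)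
  have "f p \<in> QxR c \<and> inj (differential \<A> f p) \<and> \<eta> p \<in> tangent_space c (f p) \<and> bil c (\<eta> p) (\<eta> p) = 1 \<and>
        (\<forall>X. bil c (differential \<A> f p X) (\<eta> p) = 0)" if p_M: "p \<in> topspace M" for p
  proof -
    obtain D y u where D: "(D, y) \<in> \<A>" and u: "u \<in> D" and p: "p = y u" using chart_exists[OF p_M] by blast
    interpret hypersurface_chart c D "f \<circ> y" "\<eta> \<circ> y" by (rule H[OF D])
    obtain J K where JK: "linear J" "linear K" "\<And>X. J (K X) = X" "\<And>X. K (J X) = X"
      and diff: "\<And>(h :: 'm \<Rightarrow> 'n ambient) X. (h \<circ> y) differentiable (at u) \<Longrightarrow>
        differential \<A> h (y u) X = dd (h \<circ> y) u (J X)"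
      using differential_in_chart[OF D u] by blast
    have df: "differential \<A> f p X = dd (f \<circ> y) u (J X)" for X
      unfolding p by (rule diff[OF diff_F[OF u]])
    have "inj (differential \<A> f p)"
    proof (rule injI)
      fix X Y assume "differential \<A> f p X = differential \<A> f p Y"
      then have "J X = J Y" using injD[OF inj_dF[OF u]] unfolding df by blast
      then show "X = Y" using JK(4) by metis
    qed
    then show ?thesis
      using F_QxR[OF u] x_N[OF u] N_N[OF u] dF_N[OF u] by (simp add: df[unfolded p] p tangent_space_iff)
  qed
  then show "f ` topspace M \<subseteq> QxR c" "\<forall>p\<in>topspace M. inj (differential \<A> f p)"
    "\<forall>p\<in>topspace M. \<eta> p \<in> tangent_space c (f p) \<and> bil c (\<eta> p) (\<eta> p) = 1 \<and>
      (\<forall>X. bil c (differential \<A> f p X) (\<eta> p) = 0)"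
    by blast+
qed

lemma shape_operator_in_chart:
  assumes H: "hypersurface_chart c D (f \<circ> y) (\<eta> \<circ> y)" and D: "(D, y) \<in> \<A>" and u: "u \<in> D"
  shows "\<exists>J K. linear J \<and> linear K \<and> (\<forall>X. J (K X) = X) \<and> (\<forall>X. K (J X) = X) \<and>
    shape_operator \<A> c f \<eta> (y u) = (\<lambda>X. K (hypersurface_chart.A c (f \<circ> y) (\<eta> \<circ> y) u (J X))) \<and>
    (\<forall>X. differential \<A> f (y u) X = dd (f \<circ> y) u (J X))"
proof -
  interpret hypersurface_chart c D "f \<circ> y" "\<eta> \<circ> y" by (rule H)
  obtain J K where JK: "linear J" "linear K" "\<And>X. J (K X) = X" "\<And>X. K (J X) = X"
    and diff: "\<And>(h :: 'm \<Rightarrow> 'n ambient) X. (h \<circ> y) differentiable (at u) \<Longrightarrow>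
      differential \<A> h (y u) X = dd (h \<circ> y) u (J X)"
    using differential_in_chart[OF D u] by blast
  note df = diff[OF diff_F[OF u]] and d\<eta> = diff[OF diff_N[OF u]]
  have "shape_operator \<A> c f \<eta> (y u) X = K (A u (J X))" for X
    unfolding shape_operator_def df d\<eta>
  proof (rule the_equality)
    have "dd (f \<circ> y) u (A u (J X)) = - tan_proj c ((f \<circ> y) u) (dd (\<eta> \<circ> y) u (J X))"
      unfolding tan_proj_dN[OF u] by (rule dF_A[OF u])
    then show "dd (f \<circ> y) u (J (K (A u (J X)))) = - tan_proj c (f (y u)) (dd (\<eta> \<circ> y) u (J X))"
      by (simp add: JK(3))
    fix Y assume "dd (f \<circ> y) u (J Y) = - tan_proj c (f (y u)) (dd (\<eta> \<circ> y) u (J X))"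
    then have "A u (J X) = J Y" by (intro A_unique[OF u]) simp
    then show "Y = K (A u (J X))" by (simp add: JK(4))
  qed
  then show ?thesis
    by (intro exI[of _ J] exI[of _ K] conjI allI ext JK df)
qed

lemma principal_curvatures_in_chart:
  assumes H: "hypersurface_chart c D (f \<circ> y) (\<eta> \<circ> y)" and D: "(D, y) \<in> \<A>" and u: "u \<in> D"
  shows "principal_curvatures \<A> c f \<eta> (y u) =
    {l. \<exists>X. X \<noteq> 0 \<and> hypersurface_chart.A c (f \<circ> y) (\<eta> \<circ> y) u X = l *\<^sub>R X}"
proof -
  obtain J K where JK: "linear J" "linear K" "\<And>X. J (K X) = X" "\<And>X. K (J X) = X"
    and so: "shape_operator \<A> c f \<eta> (y u) = (\<lambda>X. K (hypersurface_chart.A c (f \<circ> y) (\<eta> \<circ> y) u (J X)))"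
    and "\<And>X. differential \<A> f (y u) X = dd (f \<circ> y) u (J X)"
    using shape_operator_in_chart[OF H D u] by blast
  let ?A = "hypersurface_chart.A c (f \<circ> y) (\<eta> \<circ> y) u"
  have "(\<exists>X. X \<noteq> 0 \<and> K (?A (J X)) = l *\<^sub>R X) \<longleftrightarrow> (\<exists>X. X \<noteq> 0 \<and> ?A X = l *\<^sub>R X)" for l
  proof
    assume "\<exists>X. X \<noteq> 0 \<and> K (?A (J X)) = l *\<^sub>R X"
    then obtain X where X: "X \<noteq> 0" "K (?A (J X)) = l *\<^sub>R X" by blast
    have "?A (J X) = l *\<^sub>R J X"
      using arg_cong[OF X(2), of J] by (simp add: JK(3) linear_scale[OF JK(1)])
    moreover have "J X \<noteq> 0" using X(1) JK(4)[of X] linear_0[OF JK(2)] by auto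
    ultimately show "\<exists>X. X \<noteq> 0 \<and> ?A X = l *\<^sub>R X" by blast
  next
    assume "\<exists>X. X \<noteq> 0 \<and> ?A X = l *\<^sub>R X"
    then obtain X where X: "X \<noteq> 0" "?A X = l *\<^sub>R X" by blast
    have "K (?A (J (K X))) = l *\<^sub>R K X" by (simp add: JK(3) X(2) linear_scale[OF JK(2)])
    moreover have "K X \<noteq> 0" using X(1) JK(3)[of X] linear_0[OF JK(1)] by auto
    ultimately show "\<exists>X. X \<noteq> 0 \<and> K (?A (J X)) = l *\<^sub>R X" by blast
  qed
  then show ?thesis unfolding principal_curvatures_def so by simp
qed

lemma eigenproj_conj:
  assumes "linear K" "linear A" "linear J" "\<And>X. J (K X) = X" "\<And>X. K (J X) = X"
  shows "eigenproj (\<lambda>X. K (A (J X))) l1 l2 l3 = (\<lambda>X. K (eigenproj A l1 l2 l3 (J X)))"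
  using assms
  by (simp add: fun_eq_iff eigenproj_def shift_def linear_diff linear_scale)

lemma tr_eigenproj_in_chart:
  assumes H: "hypersurface_chart c D (f \<circ> y) (\<eta> \<circ> y)" and D: "(D, y) \<in> \<A>" and u: "u \<in> D"
  shows "tr (eigenproj (shape_operator \<A> c f \<eta> (y u)) l1 l2 l3) =
    tr (eigenproj (hypersurface_chart.A c (f \<circ> y) (\<eta> \<circ> y) u) l1 l2 l3)"
proof -
  interpret hypersurface_chart c D "f \<circ> y" "\<eta> \<circ> y" by (rule H)
  obtain J K where JK: "linear J" "linear K" "\<And>X. J (K X) = X" "\<And>X. K (J X) = X"
    and so: "shape_operator \<A> c f \<eta> (y u) = (\<lambda>X. K (A u (J X)))"
    and "\<And>X. differential \<A> f (y u) X = dd (f \<circ> y) u (J X)"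
    using shape_operator_in_chart[OF H D u] by blast
  show ?thesis
    unfolding so eigenproj_conj[OF JK(2) linear_A[OF u] JK(1) JK(3,4)] tr_def
    by (rule trace_matrix_conj[OF linear_eigenproj[OF linear_A[OF u]] JK(1,2) JK(3)])
qed

lemma mean_curvature_in_chart:
  assumes H: "hypersurface_chart c D (f \<circ> y) (\<eta> \<circ> y)" and D: "(D, y) \<in> \<A>" and u: "u \<in> D"
  shows "mean_curvature \<A> c f \<eta> (y u) = tr (hypersurface_chart.A c (f \<circ> y) (\<eta> \<circ> y) u) / real CARD('n)"
proof -
  interpret hypersurface_chart c D "f \<circ> y" "\<eta> \<circ> y" by (rule H)
  obtain J K where JK: "linear J" "linear K" "\<And>X. J (K X) = X" "\<And>X. K (J X) = X"
    and so: "shape_operator \<A> c f \<eta> (y u) = (\<lambda>X. K (A u (J X)))"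
    and "\<And>X. differential \<A> f (y u) X = dd (f \<circ> y) u (J X)"
    using shape_operator_in_chart[OF H D u] by blast
  show ?thesis
    unfolding mean_curvature_def so tr_def
    using trace_matrix_conj[OF linear_A[OF u] JK(1,2) JK(3)] by simp
qed

lemma angle_function_eq:
  assumes H: "hypersurface_chart c D (f \<circ> y) (\<eta> \<circ> y)" and D: "(D, y) \<in> \<A>" and u: "u \<in> D"
  shows "angle_function \<A> f \<eta> (y u) = snd (\<eta> (y u))"
proof -
  interpret hypersurface_chart c D "f \<circ> y" "\<eta> \<circ> y" by (rule H)
  obtain J K where JK: "linear J" "linear K" "\<And>X. J (K X) = X" "\<And>X. K (J X) = X"
    and "shape_operator \<A> c f \<eta> (y u) = (\<lambda>X. K (A u (J X)))"
    and df: "\<And>X. differential \<A> f (y u) X = dd (f \<circ> y) u (J X)"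
    using shape_operator_in_chart[OF H D u] by blast
  show ?thesis
    unfolding angle_function_def df
  proof (rule the_equality)
    have "d_dt = dd (f \<circ> y) u (J (K (T u))) + snd (\<eta> (y u)) *\<^sub>R \<eta> (y u)"
      using dF_T[OF u] by (simp add: JK(3) \<nu>_def)
    then show "\<exists>X. d_dt = dd (f \<circ> y) u (J X) + snd (\<eta> (y u)) *\<^sub>R \<eta> (y u)" by blast
  next
    fix a assume "\<exists>X. d_dt = dd (f \<circ> y) u (J X) + a *\<^sub>R \<eta> (y u)"
    then obtain X where "d_dt = dd (f \<circ> y) u (J X) + a *\<^sub>R \<eta> (y u)" by blast
    from arg_cong[OF this, of "\<lambda>v. bil c v (\<eta> (y u))"]
    show "a = snd (\<eta> (y u))"
      using dF_N[OF u, of "J X"] N_N[OF u] by (simp add: bil_simps bil_d_dt)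
  qed
qed

end

text \<open>Padding numbers need only avoid \<open>L\<close>. With two principal curvatures the
  padding goes into the first place, as in \<open>angle_if_dim2\<close>.\<close>

lemma three_distinct_reals:
  fixes L :: "real set"
  assumes "card L \<in> {1, 2, 3}"
  shows "\<exists>l1 l2 l3. l1 \<noteq> l2 \<and> l1 \<noteq> l3 \<and> l2 \<noteq> l3 \<and> L \<subseteq> {l1, l2, l3} \<and> (card L = 2 \<longrightarrow> L = {l2, l3})"
proof -
  from assms consider "card L = 1" | "card L = 2" | "card L = 3" by auto
  then show ?thesis
  proof cases
    case 1
    then obtain a where "L = {a}" by (rule card_1_singletonE)
    then show ?thesis by (intro exI[of _ a] exI[of _ "a + 1"] exI[of _ "a + 2"]) auto
  next
    case 2
    then obtain a b where "L = {a, b}" "a \<noteq> b" unfolding card_2_iff by blast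
    then show ?thesis
      by (intro exI[of _ "max a b + 1"] exI[of _ a] exI[of _ b]) auto
  next
    case 3
    then obtain a b d where "L = {a, b, d}" "a \<noteq> b" "b \<noteq> d" "a \<noteq> d" unfolding card_3_iff by blast
    then show ?thesis by (intro exI[of _ a] exI[of _ b] exI[of _ d]) auto
  qed
qed

theorem mainTheorem7:
  fixes M :: "'m topology"
    and \<A> :: "('n::finite, 'm) atlas"
    and c :: real
    and f \<eta> :: "'m \<Rightarrow> 'n ambient"
    and g :: nat
  assumes "c \<in> {1, -1}"
    and "smooth_manifold M \<A>" and "connected_space M"
    and "hypersurface_on \<A> c (topspace M) f \<eta>"
    and "principal_curvatures \<A> c f \<eta> constant_on topspace M"
    and "\<forall>p\<in>topspace M. card (principal_curvatures \<A> c f \<eta> p) = g"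
    and "(g = 1 \<and> CARD('n) \<ge> 2) \<or> (g = 2 \<and> CARD('n) \<ge> 2) \<or>
         (g = 3 \<and> CARD('n) \<ge> 4 \<and>
            (\<forall>l. curvature_multiplicity \<A> c f \<eta> l constant_on topspace M))"
  shows "angle_function \<A> f \<eta> constant_on topspace M \<and> isoparametric M \<A> c f \<eta>"
proof (cases "topspace M = {}")
  case True
  then show ?thesis by (simp add: constant_on_def isoparametric_def)
next
  case False
  interpret manifold M \<A> by unfold_locales (rule assms(2))
  have c: "c = 1 \<or> c = -1" using assms(1) by auto
  obtain L where L: "\<And>p. p \<in> topspace M \<Longrightarrow> principal_curvatures \<A> c f \<eta> p = L"
    using assms(5) unfolding constant_on_def by blast
  have g: "card L = g" using assms(6) L False by blast
  have "card L \<in> {1, 2, 3}" using assms(7) g by auto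
  then obtain l1 l2 l3 where l: "l1 \<noteq> l2" "l1 \<noteq> l3" "l2 \<noteq> l3" and Ll: "L \<subseteq> {l1, l2, l3}"
    and L2: "card L = 2 \<longrightarrow> L = {l2, l3}"
    using three_distinct_reals[of L] by blast
  \<comment> \<open>The inequality covers g = 1, g = 3, and g = 2 with n > 2; surfaces with two
    principal curvatures remain.\<close>
  have card_L: "card L < CARD('n) \<or> (CARD('n) = 2 \<and> L = {l2, l3})"
    using assms(7) g L2 by auto
  note hyp = hypersurface_on_imp_chart[OF c assms(4)]
  have pc: "{l. \<exists>X. X \<noteq> 0 \<and> hypersurface_chart.A c (f \<circ> y) (\<eta> \<circ> y) u X = l *\<^sub>R X} = L"
    if "(D, y) \<in> \<A>" "u \<in> D" for D y u
    using principal_curvatures_in_chart[OF hyp[OF that(1)] that] L[OF chart_in_M[OF that]] by simp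
  have three: "three_curvature_chart c D (f \<circ> y) (\<eta> \<circ> y) l1 l2 l3" if D: "(D, y) \<in> \<A>" for D y
    by (intro three_curvature_chart.intro three_curvature_chart_axioms.intro hyp[OF D] l)
      (use pc[OF D] Ll in blast)
  have "(\<lambda>p. snd (\<eta> p)) constant_on topspace M"
  proof (rule locally_constant_imp_constant_on[OF assms(3)])
    fix D y u assume D: "(D, y) \<in> \<A>" and u: "u \<in> D"
    interpret three_curvature_chart c D "f \<circ> y" "\<eta> \<circ> y" l1 l2 l3 by (rule three[OF D])
    show "\<exists>S. open S \<and> u \<in> S \<and> S \<subseteq> D \<and> (\<lambda>u. snd (\<eta> (y u))) constant_on S"
      using angle_locally_constant[OF u pc[OF D] Ll card_L] by (simp add: \<nu>_def[abs_def])
  qed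
  then obtain n0 where n0: "\<And>p. p \<in> topspace M \<Longrightarrow> snd (\<eta> p) = n0" unfolding constant_on_def by blast
  have "angle_function \<A> f \<eta> p = n0" if p_M: "p \<in> topspace M" for p
  proof -
    obtain D y u where D: "(D, y) \<in> \<A>" and u: "u \<in> D" and p: "p = y u" using chart_exists[OF p_M] by blast
    show ?thesis using angle_function_eq[OF hyp[OF D] D u] n0 p_M p by simp
  qed
  then have angle: "angle_function \<A> f \<eta> constant_on topspace M" unfolding constant_on_def by blast
  \<comment> \<open>The traces are taken of the shape operator on the manifold, which does not refer
    to a chart around the point; being invariant under conjugation, they agree with those in any
    chart, and local constancy becomes global.\<close>
  define m where "m k1 k2 k3 p = tr (eigenproj (shape_operator \<A> c f \<eta> p) k1 k2 k3)" for k1 k2 k3 p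
  have m_const: "m k1 k2 k3 constant_on topspace M"
    if three': "\<And>D y. (D, y) \<in> \<A> \<Longrightarrow> three_curvature_chart c D (f \<circ> y) (\<eta> \<circ> y) k1 k2 k3" for k1 k2 k3
  proof (rule locally_constant_imp_constant_on[OF assms(3)])
    fix D y u assume D: "(D, y) \<in> \<A>" and u: "u \<in> D"
    interpret three_curvature_chart c D "f \<circ> y" "\<eta> \<circ> y" k1 k2 k3 by (rule three'[OF D])
    obtain S where S: "open S" "u \<in> S" "S \<subseteq> D" "(\<lambda>y. tr (eigenproj (A y) k1 k2 k3)) constant_on S"
      using trace_locally_constant[OF u] by blast
    moreover have "m k1 k2 k3 (y w) = tr (eigenproj (A w) k1 k2 k3)" if "w \<in> S" for w
      unfolding m_def using tr_eigenproj_in_chart[OF hyp[OF D] D] that S(3) by blast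
    ultimately show "\<exists>S. open S \<and> u \<in> S \<and> S \<subseteq> D \<and> (\<lambda>u. m k1 k2 k3 (y u)) constant_on S"
      unfolding constant_on_def by (intro exI[of _ S]) auto
  qed
  have "m l1 l2 l3 constant_on topspace M" "m l2 l3 l1 constant_on topspace M" "m l3 l1 l2 constant_on topspace M"
    by (rule m_const; intro three three_curvature_chart.rotate_chart; assumption)+
  then obtain m1 m2 m3 where m: "\<And>p. p \<in> topspace M \<Longrightarrow> m l1 l2 l3 p = m1"
    "\<And>p. p \<in> topspace M \<Longrightarrow> m l2 l3 l1 p = m2" "\<And>p. p \<in> topspace M \<Longrightarrow> m l3 l1 l2 p = m3"
    unfolding constant_on_def by metis
  define q where "q = 1 - n0\<^sup>2"
  have \<eta>: "\<eta> p \<in> tangent_space c (f p)" "f p \<in> QxR c" "q = bil c (horizontal (\<eta> p)) (horizontal (\<eta> p))"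
    if p: "p \<in> topspace M" for p
  proof -
    show "\<eta> p \<in> tangent_space c (f p)" "f p \<in> QxR c"
      using assms(4) p unfolding hypersurface_on_def by auto
    have "bil c (\<eta> p) (\<eta> p) = 1" using assms(4) p unfolding hypersurface_on_def by blast
    then show "q = bil c (horizontal (\<eta> p)) (horizontal (\<eta> p))"
      by (simp add: bil_horizontal q_def n0[OF p] power2_eq_square)
  qed
  obtain p0 where "p0 \<in> topspace M" using False by blast
  then have q: "q \<ge> 0" using bil_horizontal_nonneg[OF c] \<eta> by metis
  have "\<forall>\<^sub>F t in nhds 0. gcos c q t - gsin c q t * k > 0" for k
  proof -
    have "isCont (gcos c q) 0" "isCont (gsin c q) 0"
      using gcos_derivative[OF c q] gsin_derivative[OF c q] DERIV_isCont by blast+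
    then have "isCont (\<lambda>t. gcos c q t - gsin c q t * k) 0" by (intro continuous_intros)
    then have "((\<lambda>t. gcos c q t - gsin c q t * k) \<longlongrightarrow> 1) (nhds 0)"
      by (simp add: continuous_at tendsto_nhds_iff)
    then show ?thesis by (rule order_tendstoD) simp
  qed
  \<comment> \<open>At t = 0 each expression equals 1. Since \<open>q\<close> and the three numbers
    are the same everywhere, one \<epsilon> works for all points.\<close>
  from eventually_conj[OF this[of l1] eventually_conj[OF this[of l2] this[of l3]]]
  obtain \<epsilon> where \<epsilon>: "\<epsilon> > 0" and nondeg: "\<And>t. \<bar>t\<bar> < \<epsilon> \<Longrightarrow> gcos c q t - gsin c q t * l1 \<noteq> 0 \<and>
      gcos c q t - gsin c q t * l2 \<noteq> 0 \<and> gcos c q t - gsin c q t * l3 \<noteq> 0"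
    unfolding eventually_nhds_metric by (force simp: dist_real_def)
  have par: "\<exists>\<xi>. hypersurface_on \<A> c (topspace M) (parallel_map c f \<eta> t) \<xi> \<and>
      mean_curvature \<A> c (parallel_map c f \<eta> t) \<xi> constant_on topspace M" if t: "\<bar>t\<bar> < \<epsilon>" for t
  proof -
    define C S where "C = gcos c q t" and "S = gsin c q t"
    define \<xi> where "\<xi> p = (- c * q * S) *\<^sub>R horizontal (f p) + C *\<^sub>R horizontal (\<eta> p) + n0 *\<^sub>R d_dt" for p
    let ?f = "parallel_map c f \<eta> t"
    have pm: "?f p = C *\<^sub>R horizontal (f p) + S *\<^sub>R horizontal (\<eta> p) + (snd (f p) + t * n0) *\<^sub>R d_dt"
      "?f p \<in> QxR c" if "p \<in> topspace M" for p
      unfolding parallel_map_def C_def S_def n0[OF that, symmetric]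
      using exp_map_scaled[OF c \<eta>(2,1,3)] that by auto
    have chart: "parallel_chart c D (f \<circ> y) (\<eta> \<circ> y) l1 l2 l3 n0 t C S q (?f \<circ> y) (\<xi> \<circ> y)"
      if D: "(D, y) \<in> \<A>" for D y
    proof (intro parallel_chart.intro parallel_chart_axioms.intro three[OF D])
      show "C\<^sup>2 + c * q * S\<^sup>2 = 1" unfolding C_def S_def by (rule gcos_gsin[OF c q])
    qed (use nondeg[OF t] pm chart_in_M[OF D] n0
        in \<open>auto simp: C_def S_def q_def \<xi>_def hypersurface_chart.\<nu>_def[OF hyp[OF D]]\<close>)
    note H = parallel_chart.parallel_hypersurface[OF chart]
    define mc where "mc = ((c * q * S + C * l1) / (C - S * l1) * m1 + (c * q * S + C * l2) / (C - S * l2) * m2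
      + (c * q * S + C * l3) / (C - S * l3) * m3 - c * S / C * q) / real CARD('n)"
    have "mean_curvature \<A> c ?f \<xi> p = mc" if p_M: "p \<in> topspace M" for p
    proof -
      obtain D y u where D: "(D, y) \<in> \<A>" and u: "u \<in> D" and p: "p = y u" using chart_exists[OF p_M] by blast
      interpret parallel_chart c D "f \<circ> y" "\<eta> \<circ> y" l1 l2 l3 n0 t C S q "?f \<circ> y" "\<xi> \<circ> y"
        by (rule chart[OF D])
      have "tr (eigenproj (A u) k1 k2 k3) = m k1 k2 k3 p" for k1 k2 k3
        unfolding m_def p using tr_eigenproj_in_chart[OF hyp[OF D] D u] by simp
      then show ?thesis
        unfolding p mean_curvature_in_chart[OF H[OF D] D u] mc_def parallel_trace[OF u] \<phi>_def
        using m[OF p_M] unfolding p by simp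
    qed
    then have "mean_curvature \<A> c ?f \<xi> constant_on topspace M" unfolding constant_on_def by blast
    moreover have "hypersurface_on \<A> c (topspace M) ?f \<xi>" by (rule hypersurface_on_if_charts[OF H])
    ultimately show ?thesis by blast
  qed
  \<comment> \<open>The connected manifold itself serves as the neighbourhood \<open>W\<close> of
    each of its points.\<close>
  have "isoparametric M \<A> c f \<eta>"
    unfolding isoparametric_def
    using assms(3) \<epsilon> par by (auto simp: connected_space_eq connectedin_topspace intro!: exI[of _ "topspace M"] exI[of _ \<epsilon>])
  with angle show ?thesis ..
qed

end
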